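(* Let $j$ be a positive integer. Then, as an identity of polynomials in complex variables $d,e$, \[ \operatorname{Ch}_{2j}\big( (e-d) \times (e+d) \big) = (-1)^{j-1} \binom{2j-1}{j} \sum_{k=0}^{j} g_k(j)\, 2d\left( \prod_{r=1}^{k} (d^2-r^2) \right) \left( \prod_{r=k+1}^{j} (e^2-r^2) \right), \] where $g_0(j)=1$ and $g_k(j)= (-1)^{k} \frac{j^{\downarrow k} \, (2j+1)^{\uparrow \uparrow k}}{k! \, (2k+1)!!}$ for $1 \le k \le j$.
   Context: For a partition $\pi$ of $k$ and a partition $\lambda$ of $n$, $\operatorname{Ch}_\pi(\lambda)= n^{\downarrow k}\, \chi^\lambda_{\pi\cup(1^{n-k})}/f^\lambda$ if $n\ge k$ and $0$ otherwise ($\chi^\lambda_\mu$ the irreducible character of $\mathfrak{S}_n$ at cycle type $\mu$, $f^\lambda$ its dimension, $n^{\downarrow k}=n(n-1)\cdots(n-k+1)$); $\operatorname{Ch}_k:=\operatorname{Ch}_{(k)}$. $p\times q$ is the rectangular Young diagram with $p$ rows of length $q$. For fixed $\pi$ there is a unique polynomial in $\mathbb{Q}[p,q]$ agreeing with $\operatorname{Ch}_\pi(p\times q)$ at all positive integers $p,q$ (namely $(-1)^k\sum_{\sigma_1\sigma_2=w_\pi}(-q)^{\kappa(\sigma_1)}p^{\kappa(\sigma_2)}$ over $\sigma_1,\sigma_2\in\mathfrak{S}_k$, $w_\pi$ of cycle type $\pi$, $\kappa$ = number of cycles); for complex $p,q$, $\operatorname{Ch}_\pi(p\times q)$ means this polynomial's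 value. $a^{\uparrow\uparrow k}=\prod_{r=0}^{k-1}(a+2r)$, $a^{\uparrow\uparrow0}=1$. *)

theory Defs
  imports
    Complex_Main
    "HOL-Library.Multiset"
    "HOL-Library.Function_Algebras"
    "HOL-Combinatorics.Permutations"
    "HOL-Combinatorics.Orbits"
    "HOL-Computational_Algebra.Polynomial"
begin

definition falling :: "'a::comm_ring_1 \<Rightarrow> nat \<Rightarrow> 'a"
  where "falling a k = (\<Prod>r<k. a - of_nat r)"

definition rising2 :: "'a::comm_semiring_1 \<Rightarrow> nat \<Rightarrow> 'a"
  where "rising2 a k = (\<Prod>r<k. a + 2 * of_nat r)"

fun dfact :: "nat \<Rightarrow> nat"
  where
    "dfact 0 = 1"
  | "dfact (Suc 0) = 1"
  | "dfact (Suc (Suc n)) = Suc (Suc n) * dfact n"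


section \<open>Young diagrams\<close>

text \<open>
  A partition is the multiset of its (positive) parts.  Its Young diagram is drawn with row and
  column indices starting from 0.
\<close>

definition parts :: "nat multiset \<Rightarrow> nat list"
  where "parts \<nu> = rev (sorted_list_of_multiset \<nu>)"

text \<open>
  The boxes of the diagram as (row, column), listed row by row.  This list is also the standard
  tableau used to build the Young symmetrizer: the entry \<open>m\<close>, for \<open>0 \<le> m < n\<close>, sits in the
  \<open>m\<close>-th box of the list.
\<close>

definition boxes :: "nat multiset \<Rightarrow> (nat \<times> nat) list"
  where "boxes \<nu> = concat (map (\<lambda>i. map (Pair i) [0..<parts \<nu> ! i]) [0..<size \<nu>])"

definition rect :: "nat \<Rightarrow> nat \<Rightarrow> nat multiset"
  where "rect p q = replicate_mset p q"


section \<open>Irreducible characters of the symmetric groups\<close>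

text \<open>The symmetric group of degree \<open>n\<close> is taken as the permutations of \<open>{0, \<dots>, n - 1}\<close>.\<close>

definition Sym :: "nat \<Rightarrow> (nat \<Rightarrow> nat) set"
  where "Sym n = {w. w permutes {..<n}}"

definition cycle_type :: "nat \<Rightarrow> (nat \<Rightarrow> nat) \<Rightarrow> nat multiset"
  where "cycle_type n w = image_mset card (mset_set (orbit w ` {..<n}))"

text \<open>
  The group algebra consists of the complex functions on permutations that vanish outside
  \<open>Sym n\<close>; a function \<open>x\<close> stands for the formal sum of \<open>x w \<cdot> w\<close>.
\<close>

type_synonym galg = "(nat \<Rightarrow> nat) \<Rightarrow> complex"

definition group_algebra :: "nat \<Rightarrow> galg set"
  where "group_algebra n = {x. \<forall>w. w \<notin> Sym n \<longrightarrow> x w = 0}"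

definition gscale :: "complex \<Rightarrow> galg \<Rightarrow> galg"
  where "gscale c x = (\<lambda>w. c * x w)"

global_interpretation galg: vector_space gscale
  by unfold_locales (auto simp: gscale_def fun_eq_iff algebra_simps)

definition gmult :: "nat \<Rightarrow> galg \<Rightarrow> galg \<Rightarrow> galg"
  where "gmult n x y = (\<lambda>w. \<Sum>u\<in>Sym n. \<Sum>v\<in>Sym n. if u \<circ> v = w then x u * y v else 0)"

definition gelem :: "(nat \<Rightarrow> nat) \<Rightarrow> galg"
  where "gelem w = (\<lambda>u. if u = w then 1 else 0)"

definition row_group :: "nat multiset \<Rightarrow> (nat \<Rightarrow> nat) set"
  where "row_group \<nu> =
    {w \<in> Sym (sum_mset \<nu>). \<forall>m<sum_mset \<nu>. fst (boxes \<nu> ! w m) = fst (boxes \<nu> ! m)}"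

definition column_group :: "nat multiset \<Rightarrow> (nat \<Rightarrow> nat) set"
  where "column_group \<nu> =
    {w \<in> Sym (sum_mset \<nu>). \<forall>m<sum_mset \<nu>. snd (boxes \<nu> ! w m) = snd (boxes \<nu> ! m)}"

definition young_symmetrizer :: "nat multiset \<Rightarrow> galg"
  where "young_symmetrizer \<nu> =
    gmult (sum_mset \<nu>)
      (\<Sum>u\<in>row_group \<nu>. gelem u)
      (\<Sum>v\<in>column_group \<nu>. gscale (of_int (sign v)) (gelem v))"

text \<open>The irreducible representation indexed by \<open>\<nu>\<close>: the left ideal generated by the symmetrizer.\<close>

definition specht :: "nat multiset \<Rightarrow> galg set"
  where "specht \<nu> =
    (\<lambda>x. gmult (sum_mset \<nu>) x (young_symmetrizer \<nu>)) ` group_algebra (sum_mset \<nu>)"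

text \<open>
  Trace of a linear operator \<open>T\<close> on a finite-dimensional \<open>T\<close>-invariant subspace \<open>V\<close>; it does not
  depend on the basis that is chosen.
\<close>

definition trace_on :: "galg set \<Rightarrow> (galg \<Rightarrow> galg) \<Rightarrow> complex"
  where "trace_on V T =
    (let B = (SOME B. galg.independent B \<and> galg.span B = V)
     in \<Sum>b\<in>B. galg.representation B (T b) b)"

definition irr_character :: "nat multiset \<Rightarrow> (nat \<Rightarrow> nat) \<Rightarrow> complex"
  where "irr_character \<nu> w = trace_on (specht \<nu>) (gmult (sum_mset \<nu>) (gelem w))"

definition irr_dim :: "nat multiset \<Rightarrow> nat"
  where "irr_dim \<nu> = galg.dim (specht \<nu>)"

definition irr_character_at :: "nat multiset \<Rightarrow> nat multiset \<Rightarrow> complex"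
  where "irr_character_at \<nu> \<mu> =
    irr_character \<nu> (SOME w. w \<in> Sym (sum_mset \<nu>) \<and> cycle_type (sum_mset \<nu>) w = \<mu>)"


section \<open>Normalized characters\<close>

definition Ch :: "nat multiset \<Rightarrow> nat multiset \<Rightarrow> complex"
  where "Ch \<pi> \<nu> =
    (let k = sum_mset \<pi>; n = sum_mset \<nu>
     in if k \<le> n
        then falling (of_nat n) k * irr_character_at \<nu> (\<pi> + replicate_mset (n - k) 1)
               / of_nat (irr_dim \<nu>)
        else 0)"

text \<open>
  Elements of \<open>\<rat>[p, q]\<close> are represented as polynomials in \<open>p\<close> whose coefficients are polynomials
  in \<open>q\<close>.
\<close>

definition eval2 :: "rat poly poly \<Rightarrow> complex \<Rightarrow> complex \<Rightarrow> complex"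
  where "eval2 P p q = poly (map_poly (\<lambda>c. poly (map_poly of_rat c) q) P) p"

definition Ch_rect_poly :: "nat multiset \<Rightarrow> rat poly poly"
  where "Ch_rect_poly \<pi> =
    (THE P. \<forall>p q. 0 < p \<longrightarrow> 0 < q \<longrightarrow> eval2 P (of_nat p) (of_nat q) = Ch \<pi> (rect p q))"

definition Ch_rect :: "nat multiset \<Rightarrow> complex \<Rightarrow> complex \<Rightarrow> complex"
  where "Ch_rect \<pi> p q = eval2 (Ch_rect_poly \<pi>) p q"

definition gcoeff :: "nat \<Rightarrow> nat \<Rightarrow> complex"
  where "gcoeff k j =
    (if k = 0 then 1
     else (-1) ^ k * (falling (of_nat j) k * rising2 (2 * of_nat j + 1) k)
            / (fact k * of_nat (dfact (2 * k + 1))))"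

end

theory Submission
  imports Defs "HOL-Library.FuncSet"
begin

text \<open>
  For a rectangle the Young symmetrizer \<open>c\<close> satisfies \<open>c\<^sup>2 = \<gamma> c\<close>, because a permutation either
  factors into a row and a column permutation or admits a sign-reversing transposition; taking
  traces, \<open>\<chi>(w) / f\<close> is the average of \<open>c\<close> over the conjugates of the inverse of \<open>w\<close>. Reading a
  conjugate as an injective placement of the support of \<open>w\<close> in the rectangle, and adding the
  non-injective maps, whose signed contributions cancel, \<open>Ch\<^sub>k(p \<times> q)\<close> becomes the signed sum of
  \<open>p\<^bsup>\<kappa>(\<sigma>\<^sub>1)\<^esup> q\<^bsup>\<kappa>(\<sigma>\<^sub>2)\<^esup>\<close> over the factorizations \<open>\<sigma>\<^sub>1 \<sigma>\<^sub>2\<close> of a \<open>k\<close>-cycle.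

  The indicator of the \<open>k\<close>-cycles is a signed combination of hook symmetrizers, and each of these
  is a common eigenvector of the Jucys--Murphy elements, whose eigenvalues are the contents of the
  hook. Hence \<open>k! Ch\<^sub>k(p \<times> q)\<close> is the alternating sum over \<open>m\<close> of
  \<open>(k-1 choose m) (p+k-1-m)\<^bsup>\<down>k\<^esup> (q+m)\<^bsup>\<down>k\<^esup>\<close>.

  For \<open>k = 2 j\<close>, \<open>p = e - d\<close> and \<open>q = e + d\<close> this is a finite difference of order \<open>2 j - 1\<close> in \<open>d\<close>
  of a product that is even in \<open>e\<close>. It is an odd polynomial in \<open>d\<close> of degree at most \<open>2 j + 1\<close>, so it
  is determined by its differences of order \<open>2 i + 1\<close> at \<open>-i\<close> for \<open>i \<le> j\<close>; by the Leibniz rule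
  these are polynomials in \<open>e\<close> of degree at most \<open>2 (j - i)\<close> vanishing at \<open>\<plusminus>(i+1), \<dots>, \<plusminus>j\<close>, and
  their value at \<open>e = -i\<close> is a single term.
\<close>


section \<open>Finite differences of falling factorials\<close>

text \<open>The sign of a permutation of k points is (-1) to the power k minus its number of cycles,
  so giving the sign to the column factor amounts to replacing q by -q, up to (-1)^k. Powers of p
  and q are counted as colourings constant on cycles: placements respecting rows and columns produce
  exactly these, and adjoining a point multiplies the count by p or by 1, so a weighted sum of
  permutations becomes a product over Jucys--Murphy elements.

  The scalar \<gamma> is never evaluated: right multiplication by \<open>c\<close> has trace n! on
  the group algebra, since \<open>c\<close> has coefficient 1 at the identity, and trace \<gamma> f
  on the ideal; the quotient of two such traces removes it.

  The nodes -i are chosen because d (d^2 - 1^2) ... (d^2 - k^2) is the falling factorial of length 2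
  k + 1 starting at d + k, whose difference of order 2 i + 1 at -i is (2 k + 1)! for i = k and 0
  otherwise. The differences are thus dual to the basis in the theorem, and each coefficient is read
  off separately.\<close>

lemma falling_Suc: "falling a (Suc k) = falling a k * (a - of_nat k)"
  by (simp add: falling_def)

lemma falling_0 [simp]: "falling a 0 = 1"
  by (simp add: falling_def)

lemma falling_Suc_shift: "falling (a + 1) (Suc k) = (a + 1) * falling a k"
  unfolding falling_def by (subst prod.lessThan_Suc_shift) (simp add: algebra_simps)

lemma falling_of_nat:
  "k \<le> n \<Longrightarrow> falling (of_nat n :: 'a::{comm_ring_1,semiring_char_0}) k * fact (n - k) = fact n"
proof (induction k)
  case (Suc k)
  then have "n - k = Suc (n - Suc k)" by simp
  then have "fact (n - k) = (of_nat (n - k) :: 'a) * fact (n - Suc k)"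
    by (metis fact_Suc)
  with Suc show ?case
    by (simp add: falling_Suc of_nat_diff mult.assoc mult.left_commute)
qed simp

lemma falling_of_nat_eq_0: "n < k \<Longrightarrow> falling (of_nat n :: 'a::comm_ring_1) k = 0"
  unfolding falling_def by (rule prod_zero) auto

definition fdiff :: "(complex \<Rightarrow> complex) \<Rightarrow> complex \<Rightarrow> complex"
  where "fdiff f = (\<lambda>t. f (t + 1) - f t)"

text \<open>Pascal's rule in summed form: the induction step shared by the binomial expansion of
  iterated differences and the Leibniz rule, both written with the binomial coefficient in front to
  match it.\<close>

lemma sum_pascal:
  fixes X :: "nat \<Rightarrow> 'a::comm_ring_1"
  shows "(\<Sum>a\<le>Suc N. of_nat (Suc N choose a) * X a) =
    (\<Sum>a\<le>N. of_nat (N choose a) * (X a + X (Suc a)))"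
proof -
  have "(\<Sum>a\<le>Suc N. of_nat (Suc N choose a) * X a) =
      X 0 + (\<Sum>a\<le>N. of_nat (N choose Suc a) * X (Suc a)) + (\<Sum>a\<le>N. of_nat (N choose a) * X (Suc a))"
    by (subst sum.atMost_Suc_shift) (simp add: distrib_right sum.distrib)
  also have "X 0 + (\<Sum>a\<le>N. of_nat (N choose Suc a) * X (Suc a)) =
      (\<Sum>a\<le>Suc N. of_nat (N choose a) * X a)"
    by (subst sum.atMost_Suc_shift) (simp add: binomial_eq_0)
  finally show ?thesis by (simp add: distrib_left sum.distrib binomial_eq_0)
qed

lemma fdiff_funpow_eq_sum:
  "(fdiff ^^ N) f t = (\<Sum>i\<le>N. of_nat (N choose i) * ((-1) ^ (N - i) * f (t + of_nat i)))"
proof (induction N arbitrary: t)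
  case (Suc N)
  have "(fdiff ^^ Suc N) f t = (fdiff ^^ N) f (t + 1) - (fdiff ^^ N) f t"
    by (simp add: fdiff_def)
  also have "\<dots> = (\<Sum>i\<le>N. of_nat (N choose i) *
      ((-1) ^ (Suc N - i) * f (t + of_nat i) + (-1) ^ (Suc N - Suc i) * f (t + of_nat (Suc i))))"
    unfolding Suc sum_subtractf [symmetric]
    by (intro sum.cong refl) (simp add: Suc_diff_le algebra_simps)
  finally show ?case
    unfolding sum_pascal .
qed simp

lemma fdiff_scale: "fdiff (\<lambda>t. c * f t) = (\<lambda>t. c * fdiff f t)"
  by (simp add: fdiff_def algebra_simps)

lemma fdiff_funpow_scale: "(fdiff ^^ N) (\<lambda>t. c * f t) = (\<lambda>t. c * (fdiff ^^ N) f t)"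
  by (induction N) (simp_all add: fdiff_scale)

lemma fdiff_funpow_sum:
  "(fdiff ^^ N) (\<lambda>t. \<Sum>x\<in>A. f x t) t = (\<Sum>x\<in>A. (fdiff ^^ N) (f x) t)"
  unfolding fdiff_funpow_eq_sum sum_distrib_left by (rule sum.swap)

lemma fdiff_funpow_diff:
  "(fdiff ^^ N) (\<lambda>t. f t - g t) t = (fdiff ^^ N) f t - (fdiff ^^ N) g t"
  unfolding fdiff_funpow_eq_sum sum_subtractf [symmetric] by (simp add: algebra_simps)

text \<open>Iterates the rule that the difference of f g at t is f (t + 1) times the difference of g
  plus g t times the difference of f. Every difference that falls on g shifts f by one, hence the
  argument t + (N - a).\<close>

lemma fdiff_funpow_mult:
  "(fdiff ^^ N) (\<lambda>t. f t * g t) t =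
    (\<Sum>a\<le>N. of_nat (N choose a) * ((fdiff ^^ a) f (t + of_nat (N - a)) * (fdiff ^^ (N - a)) g t))"
proof (induction N arbitrary: t)
  case (Suc N)
  have "(fdiff ^^ Suc N) (\<lambda>t. f t * g t) t =
      (fdiff ^^ N) (\<lambda>t. f t * g t) (t + 1) - (fdiff ^^ N) (\<lambda>t. f t * g t) t"
    by (simp add: fdiff_def)
  also have "\<dots> = (\<Sum>a\<le>N. of_nat (N choose a) *
      ((fdiff ^^ a) f (t + of_nat (Suc N - a)) * (fdiff ^^ (Suc N - a)) g t +
       (fdiff ^^ Suc a) f (t + of_nat (Suc N - Suc a)) * (fdiff ^^ (Suc N - Suc a)) g t))"
    unfolding Suc sum_subtractf [symmetric]
    by (intro sum.cong refl) (simp add: Suc_diff_le fdiff_def algebra_simps)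
  finally show ?case
    unfolding sum_pascal .
qed simp

lemma fdiff_falling_plus:
  "fdiff (\<lambda>t. falling (x + t) n) = (\<lambda>t. of_nat n * falling (x + t) (n - 1))"
proof (cases n)
  case (Suc m)
  have "falling (x + (t + 1)) (Suc m) - falling (x + t) (Suc m) = of_nat (Suc m) * falling (x + t) m" for t
    using falling_Suc_shift [of "x + t" m] by (simp add: falling_Suc algebra_simps)
  then show ?thesis by (simp add: fdiff_def Suc)
qed (simp add: fdiff_def)

lemma fdiff_falling_minus:
  "fdiff (\<lambda>t. falling (x - t) n) = (\<lambda>t. - of_nat n * falling (x - 1 - t) (n - 1))"
proof (cases n)
  case (Suc m)
  have "falling (x - (t + 1)) (Suc m) - falling (x - t) (Suc m) = - of_nat (Suc m) * falling (x - 1 - t) m" for t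
    using falling_Suc_shift [of "x - 1 - t" m] by (simp add: falling_Suc algebra_simps)
  then show ?thesis by (simp add: fdiff_def Suc)
qed (simp add: fdiff_def)

lemma fdiff_funpow_falling_plus:
  "(fdiff ^^ a) (\<lambda>t. falling (x + t) n) =
    (\<lambda>t. falling (of_nat n) a * falling (x + t) (n - a))"
proof (induction a)
  case (Suc a)
  \<comment> \<open>Valid for \<open>a > n\<close> as well: the truncated \<open>n - a\<close> is 0
    and \<open>falling (of_nat n) a\<close> already contains the factor 0.\<close>
  have "falling (of_nat n) a * of_nat (n - a) = (falling (of_nat n) (Suc a) :: complex)"
    by (cases "a \<le> n") (simp_all add: falling_Suc of_nat_diff falling_of_nat_eq_0)
  with Suc show ?case
    by (simp add: fdiff_scale fdiff_falling_plus mult.assoc [symmetric])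
qed simp

lemma fdiff_funpow_falling_minus:
  "(fdiff ^^ a) (\<lambda>t. falling (x - t) n) =
    (\<lambda>t. (-1) ^ a * falling (of_nat n) a * falling (x - of_nat a - t) (n - a))"
proof (induction a)
  case (Suc a)
  have "falling (of_nat n) a * of_nat (n - a) = (falling (of_nat n) (Suc a) :: complex)"
    by (cases "a \<le> n") (simp_all add: falling_Suc of_nat_diff falling_of_nat_eq_0)
  then have *: "(-1) ^ a * falling (of_nat n) a * (- of_nat (n - a) * z) =
      (-1) ^ Suc a * falling (of_nat n) (Suc a) * z" for z :: complex
    by (simp add: mult.assoc [symmetric])
  show ?case
    unfolding funpow.simps comp_def Suc fdiff_scale fdiff_falling_minus *
    by (simp add: algebra_simps)
qed simp


section \<open>Polynomial functions of bounded degree\<close>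

text \<open>Functions with a degree bound instead of polynomials: the differences below are
  expressions in e or in t that are compared at finitely many points, and only an upper bound on
  their degree matters.\<close>

definition polyfun :: "nat \<Rightarrow> (complex \<Rightarrow> complex) \<Rightarrow> bool"
  where "polyfun m f \<longleftrightarrow> (\<exists>P. degree P \<le> m \<and> (\<forall>x. f x = poly P x))"

lemma polyfun_const: "polyfun m (\<lambda>x. c)"
  unfolding polyfun_def by (rule exI [of _ "[:c:]"]) simp

lemma polyfun_mono: "polyfun m f \<Longrightarrow> m \<le> m' \<Longrightarrow> polyfun m' f"
  unfolding polyfun_def by (meson order_trans)

lemma polyfun_mult:
  assumes "polyfun m f" "polyfun m' g"
  shows "polyfun (m + m') (\<lambda>x. f x * g x)"
proof -
  from assms obtain P Q where "degree P \<le> m" "\<forall>x. f x = poly P x" "degree Q \<le> m'" "\<forall>x. g x = poly Q x"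
    unfolding polyfun_def by blast
  then show ?thesis
    unfolding polyfun_def
    by (intro exI [of _ "P * Q"]) (auto intro: order_trans [OF degree_mult_le])
qed

lemma polyfun_scale: "polyfun m f \<Longrightarrow> polyfun m (\<lambda>x. c * f x)"
  using polyfun_mult [OF polyfun_const [of 0 c]] by simp

lemma polyfun_diff:
  assumes "polyfun m f" "polyfun m g"
  shows "polyfun m (\<lambda>x. f x - g x)"
proof -
  from assms obtain P Q where "degree P \<le> m" "\<forall>x. f x = poly P x" "degree Q \<le> m" "\<forall>x. g x = poly Q x"
    unfolding polyfun_def by blast
  then show ?thesis
    unfolding polyfun_def by (intro exI [of _ "P - Q"]) (auto intro: degree_diff_le)
qed

lemma polyfun_sum:
  assumes "\<And>i. i \<in> A \<Longrightarrow> polyfun m (f i)"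
  shows "polyfun m (\<lambda>x. \<Sum>i\<in>A. f i x)"
  using assms
proof (induction A rule: infinite_finite_induct)
  case (insert i A)
  have "polyfun m (\<lambda>x. f i x - (-1) * (\<Sum>i\<in>A. f i x))"
    using insert by (intro polyfun_diff polyfun_scale) auto
  with insert show ?case by simp
qed (simp_all add: polyfun_const)

lemma polyfun_linear: "polyfun 1 (\<lambda>x. c * x + b)"
  unfolding polyfun_def by (rule exI [of _ "[:b, c:]"]) simp

lemma polyfun_prod:
  assumes "finite A" "\<And>i. i \<in> A \<Longrightarrow> polyfun m (f i)"
  shows "polyfun (m * card A) (\<lambda>x. \<Prod>i\<in>A. f i x)"
  using assms
proof (induction A)
  case (insert i A)
  then show ?case
    using polyfun_mult [of m "f i" "m * card A"] by simp
qed (simp add: polyfun_const)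

lemma polyfun_falling: "polyfun k (\<lambda>x. falling (c * x + b) k)"
proof -
  have "polyfun 1 (\<lambda>x. c * x + b - of_nat i)" for i
    using polyfun_linear [of c "b - of_nat i"] by (simp add: algebra_simps)
  then show ?thesis
    using polyfun_prod [of "{..<k}" 1] by (simp add: falling_def)
qed

lemma polyfun_eqI:
  assumes "polyfun m f" "polyfun m g" "finite A" "card A > m" "\<And>x. x \<in> A \<Longrightarrow> f x = g x"
  shows "f y = g y"
proof -
  obtain P where P: "degree P \<le> m" "\<And>x. f x - g x = poly P x"
    using polyfun_diff [OF assms(1,2)] unfolding polyfun_def by blast
  have "P = 0"
  proof (rule ccontr)
    assume "P \<noteq> 0"
    have "card A \<le> card {x. poly P x = 0}"
      using assms(5) by (intro card_mono poly_roots_finite \<open>P \<noteq> 0\<close>) (auto simp: P(2) [symmetric])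
    also have "\<dots> \<le> degree P" by (rule card_poly_roots_bound [OF \<open>P \<noteq> 0\<close>])
    finally show False using assms(4) P(1) by simp
  qed
  with P(2) [of y] show ?thesis by simp
qed


section \<open>A hypergeometric identity\<close>

lemma falling_reflect: "falling (- x) n = (-1) ^ n * falling (x + of_nat n - 1) n"
proof (induction n arbitrary: x)
  case (Suc n)
  have "falling (x + of_nat (Suc n) - 1) (Suc n) = (x + of_nat n) * falling (x + of_nat n - 1) n"
    using falling_Suc_shift [of "x + of_nat n - 1" n] by (simp add: algebra_simps)
  with Suc show ?case by (simp add: falling_Suc algebra_simps)
qed simp

text \<open>The factors d + r and d - r of the centred product are paired. The right-hand side is
  the odd basis of the theorem, the left-hand side the form on which differences act by lowering the
  length.\<close>

lemma falling_central:
  "falling (d + of_nat k) (2 * k + 1) = d * (\<Prod>r = 1..k. d\<^sup>2 - (of_nat r)\<^sup>2)"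
proof (induction k)
  case (Suc k)
  have "falling (d + of_nat (Suc k)) (2 * Suc k + 1) = falling (d + of_nat k + 1) (Suc (Suc (2 * k + 1)))"
    by (simp add: add_ac)
  also have "\<dots> = (d + of_nat k + 1) * (falling (d + of_nat k) (2 * k + 1) * (d + of_nat k - of_nat (2 * k + 1)))"
    by (simp only: falling_Suc_shift falling_Suc [of "d + of_nat k"])
  finally have "falling (d + of_nat (Suc k)) (2 * Suc k + 1) =
      (d + of_nat k + 1) * (falling (d + of_nat k) (2 * k + 1) * (d + of_nat k - of_nat (2 * k + 1)))" .
  with Suc show ?case by (simp add: algebra_simps power2_eq_square)
qed (simp add: falling_def)

text \<open>Each factor is (k - r) (k + r): the first kind multiplies up to (-1)^m m!, the second to
  (2 k + m)! / (2 k)!. This fixes the constant in \<open>fdiff_fprod_eq\<close>, at the node e =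
  -k.\<close>

lemma prod_square_diff:
  "(\<Prod>r = Suc k..k + m. (of_nat k)\<^sup>2 - (of_nat r)\<^sup>2) * fact (2 * k) =
    ((-1) ^ m * fact m * fact (2 * k + m) :: complex)"
proof (induction m)
  case (Suc m)
  have "(\<Prod>r = Suc k..k + Suc m. (of_nat k)\<^sup>2 - (of_nat r)\<^sup>2) =
     (\<Prod>r = Suc k..k + m. (of_nat k)\<^sup>2 - (of_nat r)\<^sup>2) * ((of_nat k)\<^sup>2 - (of_nat (Suc (k + m)))\<^sup>2 :: complex)"
    by simp
  then have "(\<Prod>r = Suc k..k + Suc m. (of_nat k)\<^sup>2 - (of_nat r)\<^sup>2) * fact (2 * k) =
     (-1) ^ m * fact m * fact (2 * k + m) * ((of_nat k)\<^sup>2 - (of_nat (Suc (k + m)))\<^sup>2 :: complex)"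
    using Suc by (simp add: mult_ac)
  then show ?case
    by (simp add: algebra_simps power2_eq_square)
qed simp

text \<open>The difference of order 2 k + 1 at -k involves the values at -k, ..., k + 1. By oddness
  and induction all but the last vanish, so the hypothesis forces h (k + 1) = 0. This yields the
  zeros -(j + 1), ..., j + 1, too many for the degree.\<close>

lemma polyfun_odd_eq_0:
  assumes "polyfun (2 * j + 1) h" "\<And>x. h (- x) = - h x"
    and fd: "\<And>k. k \<le> j \<Longrightarrow> (fdiff ^^ (2 * k + 1)) h (- of_nat k) = 0"
  shows "h x = 0"
proof -
  have nat: "h (of_nat i) = 0" if "i \<le> j + 1" for i
    using that
  proof (induction i rule: less_induct)
    case (less i)
    show ?case
    proof (cases i)
      case 0
      then show ?thesis using assms(2) [of 0] by simp
    next
      case (Suc k)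
      have z: "h (- of_nat k + of_nat l) = 0" if "l \<le> 2 * k" for l
      proof (cases "k \<le> l")
        case True
        then show ?thesis using less.IH [of "l - k"] that Suc less.prems by (simp add: of_nat_diff)
      next
        case False
        then have "- of_nat k + of_nat l = (- of_nat (k - l) :: complex)" by (simp add: of_nat_diff)
        then have "h (- of_nat k + of_nat l) = - h (of_nat (k - l))" by (simp only: assms(2))
        then show ?thesis using less.IH [of "k - l"] False Suc less.prems by simp
      qed
      have "0 = (fdiff ^^ (2 * k + 1)) h (- of_nat k)"
        using fd [of k] less.prems Suc by simp
      also have "\<dots> = h (- of_nat k + of_nat (2 * k + 1))"
      proof -
        have "(\<Sum>l\<le>2 * k. of_nat (Suc (2 * k) choose l) *
            ((-1) ^ (Suc (2 * k) - l) * h (- of_nat k + of_nat l))) = 0"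
        proof (rule sum.neutral, rule ballI)
          fix l assume "l \<in> {..2 * k}"
          then have "h (- of_nat k + of_nat l) = 0" by (intro z) simp
          then show "of_nat (Suc (2 * k) choose l) *
            ((-1) ^ (Suc (2 * k) - l) * h (- of_nat k + of_nat l)) = 0"
            by (simp only: mult_zero_right)
        qed
        then show ?thesis
          unfolding fdiff_funpow_eq_sum Suc_eq_plus1 [symmetric] sum.atMost_Suc by simp
      qed
      also have "- of_nat k + of_nat (2 * k + 1) = (of_nat i :: complex)"
        using Suc by simp
      finally show ?thesis by simp
    qed
  qed
  show ?thesis
  proof (rule polyfun_eqI [OF assms(1) polyfun_const, where A = "of_int ` {- int (j + 1)..int (j + 1)}"])
    fix x :: complex assume "x \<in> of_int ` {- int (j + 1)..int (j + 1)}"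
    then obtain i where i: "x = of_int i" "\<bar>i\<bar> \<le> int (j + 1)" by auto
    show "h x = 0"
    proof (cases "0 \<le> i")
      case True
      then show ?thesis using nat [of "nat i"] i by simp
    next
      case False
      then have "x = - of_nat (nat (- i))" using i by simp
      then show ?thesis using nat [of "nat (- i)"] i False assms(2) by simp
    qed
  qed (simp_all add: card_image inj_on_def)
qed

text \<open>For a cycle of length n, with p = e - d and q = e + d, the value at t = d + m is the
  m-th product of falling factorials in the hook sum. Both d and m enter only through t, which is
  why the alternating sum is a difference of order n - 1.\<close>

definition fprod :: "nat \<Rightarrow> complex \<Rightarrow> complex \<Rightarrow> complex"
  where "fprod n e t = falling (e + t) n * falling (e + of_nat n - 1 - t) n"

lemma fdiff_fprod:
  "(fdiff ^^ N) (fprod n e) t = (\<Sum>a\<le>N. of_nat (N choose a) *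
     (falling (of_nat n) a * falling (e + (t + of_nat (N - a))) (n - a) *
      ((-1) ^ (N - a) * falling (of_nat n) (N - a) *
        falling (e + of_nat n - 1 - of_nat (N - a) - t) (n - (N - a)))))"
  unfolding fprod_def [abs_def] fdiff_funpow_mult fdiff_funpow_falling_plus
    fdiff_funpow_falling_minus by simp

text \<open>Reflection turns each factor at -e into the other factor at e.\<close>

lemma fprod_uminus: "even n \<Longrightarrow> fprod n (- e) t = fprod n e t"
  using falling_reflect [of "e - t" n] falling_reflect [of "e + t - of_nat n + 1" n]
  by (simp add: fprod_def algebra_simps)

lemma fprod_reflect: "fprod n e (of_nat n - 1 - t) = fprod n e t"
  by (simp add: fprod_def algebra_simps)

text \<open>Every Leibniz term vanishes at e = -r. If one of the orders a, b exceeds 2 j, its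
  coefficient is 0; otherwise one of the two falling factorials starts at a nonnegative integer
  smaller than its length.\<close>

lemma fdiff_fprod_zero:
  assumes "k < r" "r \<le> j"
  shows "(fdiff ^^ (2 * j + 2 * k)) (fprod (2 * j) (- of_nat r)) (- of_nat k) = 0"
  unfolding fdiff_fprod
proof (rule sum.neutral, rule ballI)
  fix a assume "a \<in> {..2 * j + 2 * k}"
  then have a: "a \<le> 2 * j + 2 * k" by simp
  define b where "b = 2 * j + 2 * k - a"
  \<comment> \<open>The two falling factorials start at 2 j + k - a - r and a - k - 1 - r. The third
    and fourth case decide which start is nonnegative (in the fourth by r \<le> j); k < r keeps it
    below the length.\<close>
  consider "2 * j < a" | "2 * j < b" | "a \<le> 2 * j" "b \<le> 2 * j" "r + a \<le> 2 * j + k"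
    | "a \<le> 2 * j" "b \<le> 2 * j" "r + a > 2 * j + k"
    by linarith
  then have "falling (of_nat (2 * j)) a = (0 :: complex) \<or> falling (of_nat (2 * j)) b = (0 :: complex) \<or>
      falling (- of_nat r + (- of_nat k + of_nat b)) (2 * j - a) = (0 :: complex) \<or>
      falling (- of_nat r + of_nat (2 * j) - 1 - of_nat b - - of_nat k) (2 * j - b) = (0 :: complex)"
  proof cases
    case 3
    have "- of_nat r + (- of_nat k + of_nat b) = (of_nat (2 * j + k - a - r) :: complex)"
      using 3 a by (simp add: b_def of_nat_diff)
    moreover have "2 * j + k - a - r < 2 * j - a"
      using 3 assms b_def by simp
    ultimately show ?thesis by (simp only: falling_of_nat_eq_0) simp
  next
    case 4
    have le: "k + 1 + r \<le> a" using 4 assms by linarith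
    have "- of_nat r + of_nat (2 * j) - 1 - of_nat b - - of_nat k = (of_nat (a - (k + 1 + r)) :: complex)"
      using le a by (simp add: b_def of_nat_diff algebra_simps)
    moreover have "a - (k + 1 + r) < 2 * j - b"
      using 4 assms le a by (simp add: b_def)
    ultimately show ?thesis by (simp only: falling_of_nat_eq_0) simp
  qed (simp_all only: falling_of_nat_eq_0, simp_all)
  then show "of_nat (2 * j + 2 * k choose a) *
     (falling (of_nat (2 * j)) a * falling (- of_nat r + (- of_nat k + of_nat (2 * j + 2 * k - a))) (2 * j - a) *
      ((-1) ^ (2 * j + 2 * k - a) * falling (of_nat (2 * j)) (2 * j + 2 * k - a) *
        falling (- of_nat r + of_nat (2 * j) - 1 - of_nat (2 * j + 2 * k - a) - - of_nat k)
         (2 * j - (2 * j + 2 * k - a)))) = (0 :: complex)"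
    unfolding b_def [symmetric] by auto
qed

text \<open>Only the Leibniz term a = 2 k survives at e = -k: for smaller a the other order exceeds
  2 j, for larger a the second falling factorial starts at a - 2 k - 1, just below its length a - 2
  k.\<close>

lemma fdiff_fprod_value:
  assumes "k \<le> j"
  shows "(fdiff ^^ (2 * j + 2 * k)) (fprod (2 * j) (- of_nat k)) (- of_nat k) =
    of_nat ((2 * j + 2 * k) choose (2 * k)) * (fact (2 * j))\<^sup>2"
proof -
  let ?f = "\<lambda>a. of_nat (2 * j + 2 * k choose a) *
     (falling (of_nat (2 * j)) a * falling (- of_nat k + (- of_nat k + of_nat (2 * j + 2 * k - a))) (2 * j - a) *
      ((-1) ^ (2 * j + 2 * k - a) * falling (of_nat (2 * j)) (2 * j + 2 * k - a) *
        falling (- of_nat k + of_nat (2 * j) - 1 - of_nat (2 * j + 2 * k - a) - - of_nat k)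
         (2 * j - (2 * j + 2 * k - a)))) :: complex"
  have z: "?f a = 0" if "a \<le> 2 * j + 2 * k" "a \<noteq> 2 * k" for a
  proof (cases "a < 2 * k")
    case True
    then have "falling (of_nat (2 * j)) (2 * j + 2 * k - a) = (0 :: complex)"
      using that by (intro falling_of_nat_eq_0) simp
    then show ?thesis by simp
  next
    case False
    with that have "- of_nat k + of_nat (2 * j) - 1 - of_nat (2 * j + 2 * k - a) - - of_nat k =
        (of_nat (a - (2 * k + 1)) :: complex)"
      by (simp add: of_nat_diff algebra_simps)
    moreover have "a - (2 * k + 1) < 2 * j - (2 * j + 2 * k - a)"
      using that False by simp
    ultimately show ?thesis by (simp only: falling_of_nat_eq_0) simp
  qed
  have "(fdiff ^^ (2 * j + 2 * k)) (fprod (2 * j) (- of_nat k)) (- of_nat k) = (\<Sum>a\<le>2 * j + 2 * k. ?f a)"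
    unfolding fdiff_fprod ..
  also have "\<dots> = ?f (2 * k)"
  proof (subst sum.remove [of _ "2 * k"])
    have "(\<Sum>a\<in>{..2 * j + 2 * k} - {2 * k}. ?f a) = 0"
      by (rule sum.neutral, rule ballI, rule z) simp_all
    then show "?f (2 * k) + (\<Sum>a\<in>{..2 * j + 2 * k} - {2 * k}. ?f a) = ?f (2 * k)"
      by (simp only: add_0_right)
  qed simp_all
  also have "- of_nat k + (- of_nat k + of_nat (2 * j + 2 * k - 2 * k)) = (of_nat (2 * j - 2 * k) :: complex)"
    using assms by (simp add: of_nat_diff)
  also have "2 * j + 2 * k - 2 * k = 2 * j" by simp
  finally have "(fdiff ^^ (2 * j + 2 * k)) (fprod (2 * j) (- of_nat k)) (- of_nat k) =
      of_nat (2 * j + 2 * k choose (2 * k)) * ((falling (of_nat (2 * j)) (2 * k) *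
      falling (of_nat (2 * j - 2 * k)) (2 * j - 2 * k)) * falling (of_nat (2 * j)) (2 * j))"
    by simp
  also have "falling (of_nat (2 * j - 2 * k)) (2 * j - 2 * k) = (fact (2 * j - 2 * k) :: complex)"
    using falling_of_nat [of "2 * j - 2 * k" "2 * j - 2 * k", where 'a = complex] by simp
  also have "falling (of_nat (2 * j)) (2 * j) = (fact (2 * j) :: complex)"
    using falling_of_nat [of "2 * j" "2 * j", where 'a = complex] by simp
  also have "falling (of_nat (2 * j)) (2 * k) * fact (2 * j - 2 * k) = (fact (2 * j) :: complex)"
    using assms by (intro falling_of_nat) simp
  finally show ?thesis by (simp add: power2_eq_square)
qed

text \<open>In a nonzero Leibniz term a and b = 2 j + 2 k - a are at most 2 j, so the degrees 2 j -
  a and 2 j - b are not truncated and add up to 2 (j - k).\<close>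

lemma polyfun_fdiff_fprod:
  assumes "k \<le> j"
  shows "polyfun (2 * (j - k)) (\<lambda>e. (fdiff ^^ (2 * j + 2 * k)) (fprod (2 * j) e) (- of_nat k))"
  unfolding fdiff_fprod
proof (intro polyfun_sum polyfun_scale)
  fix a assume "a \<in> {..2 * j + 2 * k}"
  then have a: "a \<le> 2 * j + 2 * k" by simp
  define b where "b = 2 * j + 2 * k - a"
  have 1: "polyfun (2 * j - a) (\<lambda>e. falling (e + (- of_nat k + of_nat b)) (2 * j - a))"
    using polyfun_falling [of "2 * j - a" 1] by simp
  have 2: "polyfun (2 * j - b) (\<lambda>e. falling (e + of_nat (2 * j) - 1 - of_nat b - - of_nat k) (2 * j - b))"
    using polyfun_falling [of "2 * j - b" 1 "of_nat (2 * j) - 1 - of_nat b - - of_nat k"]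
    by (simp add: algebra_simps)
  consider "2 * j < a" | "2 * j < b" | "a \<le> 2 * j" "b \<le> 2 * j"
    by linarith
  then show "polyfun (2 * (j - k)) (\<lambda>e. falling (of_nat (2 * j)) a *
      falling (e + (- of_nat k + of_nat (2 * j + 2 * k - a))) (2 * j - a) *
      ((-1) ^ (2 * j + 2 * k - a) * falling (of_nat (2 * j)) (2 * j + 2 * k - a) *
        falling (e + of_nat (2 * j) - 1 - of_nat (2 * j + 2 * k - a) - - of_nat k)
         (2 * j - (2 * j + 2 * k - a))))"
    unfolding b_def [symmetric]
  proof cases
    case 3
    show "polyfun (2 * (j - k)) (\<lambda>e. falling (of_nat (2 * j)) a *
      falling (e + (- of_nat k + of_nat b)) (2 * j - a) *
      ((-1) ^ b * falling (of_nat (2 * j)) b *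
        falling (e + of_nat (2 * j) - 1 - of_nat b - - of_nat k) (2 * j - b)))"
      by (rule polyfun_mono [OF polyfun_mult [OF polyfun_scale [OF 1] polyfun_scale [OF 2]]])
        (use 3 a assms in \<open>simp add: b_def\<close>)
  qed (simp_all only: falling_of_nat_eq_0 mult_zero_left mult_zero_right polyfun_const)
qed

text \<open>Both sides have degree at most 2 (j - k) in e, vanish at r and -r for k < r \<le> j, and
  agree at -k. That is one node more than the degree, so the constant is the value at -k divided by
  the product there.\<close>

lemma fdiff_fprod_eq:
  assumes "k \<le> j"
  shows "(fdiff ^^ (2 * j + 2 * k)) (fprod (2 * j) e) (- of_nat k) =
    (-1) ^ (j - k) * fact (2 * j) * fact (2 * j + 2 * k) / (fact (j - k) * fact (j + k)) *
      (\<Prod>r = k + 1..j. e\<^sup>2 - (of_nat r)\<^sup>2)"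
proof -
  let ?c = "(-1) ^ (j - k) * fact (2 * j) * fact (2 * j + 2 * k) / (fact (j - k) * fact (j + k)) :: complex"
  let ?A = "{- int j..- int k} \<union> {int k + 1..int j}"
  let ?W = "\<lambda>e. (fdiff ^^ (2 * j + 2 * k)) (fprod (2 * j) e) (- of_nat k)"
  \<comment> \<open>Carries the zeros of \<open>fdiff_fprod_zero\<close> from -r over to r.\<close>
  have even: "?W (- e) = ?W e" for e
    by (simp add: fprod_uminus [of "2 * j"] fdiff_funpow_eq_sum)
  have "card ?A = (j - k + 1) + (j - k)"
    using assms by (subst card_Un_disjoint) auto
  then have cardA: "card (complex_of_int ` ?A) > 2 * (j - k)"
    by (subst card_image) (simp_all add: inj_on_def)
  have pf: "polyfun (2 * (j - k)) (\<lambda>e. \<Prod>r = k + 1..j. e\<^sup>2 - (of_nat r)\<^sup>2)"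
  proof -
    have "polyfun 2 (\<lambda>e. e\<^sup>2 - (of_nat r)\<^sup>2)" for r
      unfolding polyfun_def by (rule exI [of _ "[:- (of_nat r)\<^sup>2, 0, 1:]"]) (simp add: power2_eq_square)
    then show ?thesis
      using polyfun_prod [of "{k + 1..j}" 2] by simp
  qed
  show ?thesis
  proof (rule polyfun_eqI [OF polyfun_fdiff_fprod [OF assms] polyfun_scale [OF pf] _ cardA])
    fix x :: complex assume "x \<in> of_int ` ?A"
    then consider "x = - of_nat k" | r where "k < r" "r \<le> j" "x = - of_nat r"
      | r where "k < r" "r \<le> j" "x = of_nat r"
    proof -
      assume x: "x \<in> of_int ` ?A" and
        "x = - of_nat k \<Longrightarrow> thesis" and
        "\<And>r. k < r \<Longrightarrow> r \<le> j \<Longrightarrow> x = - of_nat r \<Longrightarrow> thesis" and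
        "\<And>r. k < r \<Longrightarrow> r \<le> j \<Longrightarrow> x = of_nat r \<Longrightarrow> thesis"
      note th = this(2-4)
      from x obtain i where i: "i \<in> ?A" "x = of_int i" by blast
      consider "i = - int k" | "i \<ge> int k + 1" "i \<le> int j" | "i < - int k" "i \<ge> - int j"
        using i by force
      then show thesis
        by cases (use i th(1) th(2) [of "nat (- i)"] th(3) [of "nat i"] in auto)
    qed
    then show "?W x = ?c * (\<Prod>r = k + 1..j. x\<^sup>2 - (of_nat r)\<^sup>2)"
    proof cases
      case 1
      have P: "(\<Prod>r = k + 1..j. (of_nat k)\<^sup>2 - (of_nat r)\<^sup>2) =
          ((-1) ^ (j - k) * fact (j - k) * fact (j + k) / fact (2 * k) :: complex)"
      proof -
        have "2 * k + (j - k) = j + k" using assms by simp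
        with prod_square_diff [of k "j - k"] assms show ?thesis
          by (simp add: field_simps)
      qed
      have "?W x = of_nat ((2 * j + 2 * k) choose (2 * k)) * (fact (2 * j))\<^sup>2"
        unfolding 1 by (rule fdiff_fprod_value [OF assms])
      also have "of_nat ((2 * j + 2 * k) choose (2 * k)) =
          (fact (2 * j + 2 * k) / (fact (2 * k) * fact (2 * j)) :: complex)"
        by (subst binomial_fact) simp_all
      finally have W: "?W x = fact (2 * j + 2 * k) / (fact (2 * k) * fact (2 * j)) * (fact (2 * j))\<^sup>2" .
      have x: "x\<^sup>2 = (of_nat k)\<^sup>2" using 1 by simp
      show ?thesis
        unfolding W x P by (simp add: power2_eq_square field_simps)
    next
      case (2 r)
      then have "(\<Prod>r = k + 1..j. x\<^sup>2 - (of_nat r)\<^sup>2) = 0"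
        by (intro prod_zero bexI [of _ r]) auto
      with fdiff_fprod_zero [OF 2(1,2)] 2(3) show ?thesis by simp
    next
      case (3 r)
      then have "(\<Prod>r = k + 1..j. x\<^sup>2 - (of_nat r)\<^sup>2) = 0"
        by (intro prod_zero bexI [of _ r]) auto
      with fdiff_fprod_zero [OF 3(1,2)] 3(3) even [of "of_nat r"] show ?thesis by simp
    qed
  qed simp
qed


text \<open>The degree in t this time: N differences are split as a and N - a, so each Leibniz term
  has degree (N + 1 - a) + (a + 1) = N + 2, down from 2 N + 2.\<close>

lemma polyfun_fdiff_fprod_argument:
  "polyfun (Suc N + 1) (\<lambda>t. (fdiff ^^ N) (fprod (Suc N) e) t)"
  unfolding fdiff_fprod
proof (intro polyfun_sum polyfun_scale)
  fix a assume "a \<in> {..N}"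
  then have a: "a \<le> N" by simp
  have 1: "polyfun (Suc N - a) (\<lambda>t. falling (e + (t + of_nat (N - a))) (Suc N - a))"
    using polyfun_falling [of "Suc N - a" 1 "e + of_nat (N - a)"] by (simp add: algebra_simps)
  have 2: "polyfun (Suc N - (N - a)) (\<lambda>t. falling (e + of_nat (Suc N) - 1 - of_nat (N - a) - t) (Suc N - (N - a)))"
    using polyfun_falling [of "Suc N - (N - a)" "- 1" "e + of_nat (Suc N) - 1 - of_nat (N - a)"]
    by (simp add: algebra_simps)
  show "polyfun (Suc N + 1) (\<lambda>t. falling (of_nat (Suc N)) a *
      falling (e + (t + of_nat (N - a))) (Suc N - a) *
      ((-1) ^ (N - a) * falling (of_nat (Suc N)) (N - a) *
        falling (e + of_nat (Suc N) - 1 - of_nat (N - a) - t) (Suc N - (N - a))))"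
    by (rule polyfun_mono [OF polyfun_mult [OF polyfun_scale [OF 1] polyfun_scale [OF 2]]])
      (use a in simp)
qed

text \<open>By \<open>fprod_reflect\<close>, negating t reverses the order of the N + 1 sampled
  values; reversing the alternating sum costs the sign (-1)^N.\<close>

lemma fdiff_fprod_odd:
  assumes "odd N"
  shows "(fdiff ^^ N) (fprod (Suc N) e) (- t) = - (fdiff ^^ N) (fprod (Suc N) e) t"
proof -
  let ?f = "fprod (Suc N) e"
  have "(fdiff ^^ N) ?f (- t) = (\<Sum>i\<le>N. of_nat (N choose i) * ((-1) ^ (N - i) * ?f (t + of_nat (N - i))))"
    unfolding fdiff_funpow_eq_sum
  proof (rule sum.cong [OF refl])
    fix i assume "i \<in> {..N}"
    then have "of_nat (Suc N) - 1 - (- t + of_nat i) = t + of_nat (N - i)"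
      by (simp add: of_nat_diff)
    then have "?f (- t + of_nat i) = ?f (t + of_nat (N - i))"
      using fprod_reflect [of "Suc N" e "- t + of_nat i"] by (simp only:)
    then show "of_nat (N choose i) * ((-1) ^ (N - i) * ?f (- t + of_nat i)) =
        of_nat (N choose i) * ((-1) ^ (N - i) * ?f (t + of_nat (N - i)))" by simp
  qed
  also have "\<dots> = (\<Sum>i\<le>N. of_nat (N choose i) * ((-1) ^ i * ?f (t + of_nat i)))"
    by (rule sum.reindex_bij_witness [of _ "\<lambda>i. N - i" "\<lambda>i. N - i"])
      (auto simp: binomial_symmetric [symmetric])
  also have "\<dots> = - (fdiff ^^ N) ?f t"
    unfolding fdiff_funpow_eq_sum sum_negf [symmetric]
  proof (rule sum.cong [OF refl])
    fix i assume "i \<in> {..N}"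
    then have "(-1) ^ i * (-1) ^ (N - i) = (-1 :: complex)"
      using assms by (simp add: power_add [symmetric])
    then have "(-1) ^ i = - ((-1) ^ (N - i) :: complex)"
      using assms by (cases "even i") (auto simp: minus_one_power_iff split: if_splits)
    then show "of_nat (N choose i) * ((-1) ^ i * ?f (t + of_nat i)) =
        - (of_nat (N choose i) * ((-1) ^ (N - i) * ?f (t + of_nat i)))" by simp
  qed
  finally show ?thesis .
qed

lemma fdiff_fprod_expansion:
  assumes "j \<ge> 1"
  shows "(fdiff ^^ (2 * j - 1)) (fprod (2 * j) e) d =
    (\<Sum>k\<le>j. (-1) ^ (j - k) * fact (2 * j) * fact (2 * j + 2 * k) /
        (fact (j - k) * fact (j + k) * fact (2 * k + 1)) *
      (\<Prod>r = k + 1..j. e\<^sup>2 - (of_nat r)\<^sup>2) * (d * (\<Prod>r = 1..k. d\<^sup>2 - (of_nat r)\<^sup>2)))"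
proof -
  define N where "N = 2 * j - 1"
  have N: "2 * j = Suc N" "odd N" using assms by (auto simp: N_def)
  \<comment> \<open>The forced value: the difference of order 2 k + 1 of the left-hand side at -k,
    which is a difference of \<open>fprod\<close> of order (2 j - 1) + (2 k + 1) = 2 j + 2 k,
    divided by (2 k + 1)!.\<close>
  define c where "c k = (-1) ^ (j - k) * fact (2 * j) * fact (2 * j + 2 * k) /
        (fact (j - k) * fact (j + k) * fact (2 * k + 1)) *
      (\<Prod>r = k + 1..j. e\<^sup>2 - (of_nat r)\<^sup>2)" for k
  define h where "h x = (fdiff ^^ N) (fprod (2 * j) e) x -
    (\<Sum>k\<le>j. c k * falling (of_nat k + x) (2 * k + 1))" for x
  have "h d = 0"
  proof (rule polyfun_odd_eq_0 [of j h])
    show "polyfun (2 * j + 1) h"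
      unfolding h_def [abs_def]
    proof (rule polyfun_diff [OF _ polyfun_sum])
      show "polyfun (2 * j + 1) (\<lambda>x. (fdiff ^^ N) (fprod (2 * j) e) x)"
        unfolding N by (rule polyfun_fdiff_fprod_argument)
      fix k assume "k \<in> {..j}"
      then show "polyfun (2 * j + 1) (\<lambda>x. c k * falling (of_nat k + x) (2 * k + 1))"
        using polyfun_scale [OF polyfun_mono [OF polyfun_falling [of "2 * k + 1" 1 "of_nat k"], of "2 * j + 1"]]
        by (simp add: add.commute)
    qed
    show "h (- x) = - h x" for x
    proof -
      have "falling (of_nat k + - x) (2 * k + 1) = - falling (of_nat k + x) (2 * k + 1)" for k
        using falling_central [of "- x" k] falling_central [of x k] by (simp add: add.commute)
      then show ?thesis
        unfolding h_def N fdiff_fprod_odd [OF N(2)] by (simp add: sum_negf)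
    qed
    fix k assume k: "k \<le> j"
    have "(fdiff ^^ (2 * k + 1)) ((fdiff ^^ N) (fprod (2 * j) e)) = (fdiff ^^ (2 * j + 2 * k)) (fprod (2 * j) e)"
      using N(1) by (simp add: funpow_add [symmetric, THEN fun_cong, unfolded comp_def] add_ac)
    then have 1: "(fdiff ^^ (2 * k + 1)) ((fdiff ^^ N) (fprod (2 * j) e)) (- of_nat k) = fact (2 * k + 1) * c k"
      by (simp add: fdiff_fprod_eq [OF k] c_def del: fact_Suc)
    \<comment> \<open>Duality: for i < k the order exceeds the degree; for i > k there remains a
      falling factorial of length 2 (i - k) starting at i - k, which contains the factor 0.\<close>
    have 2: "(fdiff ^^ (2 * k + 1)) (\<lambda>x. c i * falling (of_nat i + x) (2 * i + 1)) (- of_nat k) =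
        (if i = k then fact (2 * k + 1) * c k else 0)" for i
    proof -
      consider "i < k" | "i = k" | "k < i" by linarith
      then show ?thesis
      proof cases
        case 1
        then have "falling (of_nat (2 * i + 1)) (2 * k + 1) = (0 :: complex)"
          by (intro falling_of_nat_eq_0) simp
        with 1 show ?thesis
          by (simp only: fdiff_funpow_scale fdiff_funpow_falling_plus) simp
      next
        case 2
        have "falling (of_nat (2 * k + 1)) (2 * k + 1) = (fact (2 * k + 1) :: complex)"
          using falling_of_nat [of "2 * k + 1" "2 * k + 1", where 'a = complex] by simp
        with 2 show ?thesis
          by (simp only: fdiff_funpow_scale fdiff_funpow_falling_plus) simp
      next
        case 3
        then have "of_nat i + - of_nat k = (of_nat (i - k) :: complex)" by (simp add: of_nat_diff)
        moreover have "falling (of_nat (i - k)) (2 * i + 1 - (2 * k + 1)) = (0 :: complex)"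
          using 3 by (intro falling_of_nat_eq_0) simp
        ultimately show ?thesis
          using 3 by (simp only: fdiff_funpow_scale fdiff_funpow_falling_plus) simp
      qed
    qed
    show "(fdiff ^^ (2 * k + 1)) h (- of_nat k) = 0"
      unfolding h_def [abs_def] fdiff_funpow_diff fdiff_funpow_sum 1 2 using k by simp
  qed
  then show ?thesis
    unfolding h_def N_def [symmetric] c_def [symmetric] falling_central [symmetric]
    by (simp add: add.commute)
qed

section \<open>Closed forms of the coefficients\<close>

lemma dfact_odd: "dfact (2 * k + 1) * (2 ^ k * fact k) = fact (2 * k + 1)"
proof (induction k)
  case (Suc k)
  have "dfact (2 * Suc k + 1) * (2 ^ Suc k * fact (Suc k)) =
      (2 * k + 3) * (2 * k + 2) * (dfact (2 * k + 1) * (2 ^ k * fact k))"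
    by (simp add: algebra_simps)
  also have "\<dots> = fact (2 * Suc k + 1)"
    unfolding Suc by (simp add: algebra_simps)
  finally show ?case .
qed simp

text \<open>The product is (2 j + 1) (2 j + 3) ... (2 j + 2 k - 1). Filling in the even factors
  gives (2 j + 2 k)! / (2 j)!, and those even factors are 2^k (j + k)! / j!.\<close>

lemma rising2_odd:
  "rising2 (2 * of_nat j + 1 :: complex) k * (2 ^ k * fact (j + k) * fact (2 * j)) =
    fact (2 * j + 2 * k) * fact j"
proof (induction k)
  case (Suc k)
  have "rising2 (2 * of_nat j + 1 :: complex) (Suc k) * (2 ^ Suc k * fact (j + Suc k) * fact (2 * j)) =
    (rising2 (2 * of_nat j + 1 :: complex) k * (2 ^ k * fact (j + k) * fact (2 * j))) *
      ((2 * of_nat j + 1 + 2 * of_nat k) * (2 * (of_nat j + of_nat k + 1)))"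
    by (simp add: rising2_def algebra_simps)
  also have "\<dots> = fact (2 * j + 2 * Suc k) * fact j"
    unfolding Suc by (simp add: algebra_simps)
  finally show ?case .
qed (simp add: rising2_def)

text \<open>The powers 2^k of \<open>rising2_odd\<close> and \<open>dfact_odd\<close> cancel,
  leaving a form comparable with the coefficients of \<open>fdiff_fprod_expansion\<close>.\<close>

lemma gcoeff_eq:
  assumes "k \<le> j"
  shows "gcoeff k j = (-1) ^ k * fact (2 * j + 2 * k) * (fact j)\<^sup>2 /
    (fact (j - k) * fact (j + k) * fact (2 * j) * fact (2 * k + 1))"
proof (cases "k = 0")
  case False
  have 1: "falling (of_nat j) k = (fact j / fact (j - k) :: complex)"
    using falling_of_nat [OF assms, where 'a = complex] by (simp add: field_simps)
  have 2: "rising2 (2 * of_nat j + 1 :: complex) k =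
      fact (2 * j + 2 * k) * fact j / (2 ^ k * fact (j + k) * fact (2 * j))"
    using rising2_odd [of j k] by (simp add: field_simps)
  have "of_nat (dfact (2 * k + 1) * (2 ^ k * fact k)) = (of_nat (fact (2 * k + 1)) :: complex)"
    by (simp only: dfact_odd)
  then have 3: "of_nat (dfact (2 * k + 1)) = (fact (2 * k + 1) / (2 ^ k * fact k) :: complex)"
    by (simp add: field_simps del: dfact.simps fact_Suc)
  show ?thesis
    unfolding gcoeff_def 1 2 3 using False by (simp add: field_simps power2_eq_square del: fact_Suc)
qed (simp add: gcoeff_def power2_eq_square)

text \<open>Half of the central binomial coefficient; the missing factor 2 is the one in the 2 d of
  the theorem.\<close>

lemma central_binomial_half:
  assumes "j \<ge> 1"
  shows "2 * of_nat ((2 * j - 1) choose j) = (fact (2 * j) / (fact j)\<^sup>2 :: complex)"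
proof -
  obtain i where j: "j = Suc i" using assms by (cases j) auto
  have "of_nat ((2 * j - 1) choose j) = (fact (2 * j - 1) / (fact j * fact (2 * j - 1 - j)) :: complex)"
    by (rule binomial_fact) (use assms in simp)
  also have "2 * j - 1 - j = i" using j by simp
  finally have 1: "of_nat ((2 * j - 1) choose j) = (fact (2 * j - 1) / (fact j * fact i) :: complex)" .
  have 2: "fact (2 * j) = (of_nat (2 * j) * fact (2 * j - 1) :: complex)"
    by (rule fact_reduce) (use assms in simp)
  have 3: "(fact j)\<^sup>2 = (fact j * (of_nat j * fact i) :: complex)"
    using j by (simp add: power2_eq_square)
  show ?thesis
    unfolding 1 2 3 using assms by (simp add: field_simps)
qed

lemma hook_sum_eq:
  fixes d e :: complex
  assumes "j \<ge> 1"
  shows "(\<Sum>m\<le>2 * j - 1. of_nat ((2 * j - 1) choose m) * ((-1) ^ m *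
      falling (e - d + of_nat (2 * j - 1 - m)) (2 * j) * falling (e + d + of_nat m) (2 * j))) / fact (2 * j) =
    (-1) ^ (j - 1) * of_nat ((2 * j - 1) choose j) *
      (\<Sum>k = 0..j. gcoeff k j * (2 * d * (\<Prod>r = 1..k. d\<^sup>2 - (of_nat r)\<^sup>2)
                              * (\<Prod>r = k + 1..j. e\<^sup>2 - (of_nat r)\<^sup>2)))"
    (is "?L / _ = ?R")
proof -
  \<comment> \<open>The difference of order 2 j - 1 carries the sign (-1)^(2 j - 1 - m), opposite to
    (-1)^m.\<close>
  have "?L = - (fdiff ^^ (2 * j - 1)) (fprod (2 * j) e) d"
    unfolding fdiff_funpow_eq_sum sum_negf [symmetric]
  proof (rule sum.cong [OF refl])
    fix m assume m: "m \<in> {..2 * j - 1}"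
    have eq: "e + of_nat (2 * j) - 1 - (d + of_nat m) = e - d + of_nat (2 * j - 1 - m)"
      using m assms by (simp add: of_nat_diff algebra_simps)
    have "fprod (2 * j) e (d + of_nat m) =
        falling (e + d + of_nat m) (2 * j) * falling (e - d + of_nat (2 * j - 1 - m)) (2 * j)"
      unfolding fprod_def eq by (simp add: add.assoc)
    moreover have "(-1) ^ m = - ((-1) ^ (2 * j - 1 - m) :: complex)"
    proof -
      have "odd (m + (2 * j - 1 - m))" using m assms by simp
      then show ?thesis by (auto simp: minus_one_power_iff simp del: add_diff_assoc)
    qed
    ultimately show "of_nat ((2 * j - 1) choose m) * ((-1) ^ m *
      falling (e - d + of_nat (2 * j - 1 - m)) (2 * j) * falling (e + d + of_nat m) (2 * j)) =
      - (of_nat ((2 * j - 1) choose m) * ((-1) ^ (2 * j - 1 - m) * fprod (2 * j) e (d + of_nat m)))"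
      by simp
  qed
  also have "\<dots> / fact (2 * j) = ?R"
    unfolding fdiff_fprod_expansion [OF assms] sum_negf [symmetric] sum_divide_distrib
      sum_distrib_left atLeast0AtMost
  proof (rule sum.cong [OF refl])
    fix k assume "k \<in> {..j}"
    then have k: "k \<le> j" by simp
    have sgn: "(-1) ^ (j - 1) * (-1) ^ k = - ((-1) ^ (j - k) :: complex)"
      using k assms by (cases "even j"; cases "even k") (auto simp: minus_one_power_iff)
    let ?P = "\<Prod>r = k + 1..j. e\<^sup>2 - (of_nat r)\<^sup>2" and ?Q = "\<Prod>r = 1..k. d\<^sup>2 - (of_nat r)\<^sup>2"
    have "(-1) ^ (j - 1) * of_nat ((2 * j - 1) choose j) * (gcoeff k j * (2 * d * ?Q * ?P)) =
      (-1) ^ (j - 1) * (2 * of_nat ((2 * j - 1) choose j)) * gcoeff k j * (?P * (d * ?Q))"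
      by (simp add: mult_ac)
    also have "\<dots> = ((-1) ^ (j - 1) * (-1) ^ k) * fact (2 * j + 2 * k) /
        (fact (j - k) * fact (j + k) * fact (2 * k + 1)) * (?P * (d * ?Q))"
      unfolding central_binomial_half [OF assms] gcoeff_eq [OF k]
      by (simp add: field_simps power2_eq_square del: fact_Suc)
    finally show "- ((-1) ^ (j - k) * fact (2 * j) * fact (2 * j + 2 * k) /
        (fact (j - k) * fact (j + k) * fact (2 * k + 1)) * ?P * (d * ?Q)) / fact (2 * j) =
      (-1) ^ (j - 1) * of_nat ((2 * j - 1) choose j) * (gcoeff k j * (2 * d * ?Q * ?P))"
      unfolding sgn by (simp add: field_simps del: fact_Suc)
  qed
  finally show ?thesis .
qed



section \<open>Sums over permutations of a finite set\<close>

text \<open>Cosets of the permutations of S. The trivial coset is kept apart because weights change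
  differently there.\<close>

lemma sum_permutes_insert_left:
  fixes f :: "('a \<Rightarrow> 'a) \<Rightarrow> 'b::comm_monoid_add"
  assumes "finite S" "i \<notin> S"
  shows "(\<Sum>\<sigma> | \<sigma> permutes insert i S. f \<sigma>) =
    (\<Sum>\<sigma> | \<sigma> permutes S. f \<sigma> + (\<Sum>c\<in>S. f (transpose i c \<circ> \<sigma>)))"
  using assms by (subst sum_over_permutations_insert) (simp_all add: sum.distrib sum.swap [of _ S])

lemma sum_permutes_insert_right:
  fixes f :: "('a \<Rightarrow> 'a) \<Rightarrow> 'b::comm_monoid_add"
  assumes "finite S" "i \<notin> S"
  shows "(\<Sum>\<sigma> | \<sigma> permutes insert i S. f \<sigma>) =
    (\<Sum>\<sigma> | \<sigma> permutes S. f \<sigma> + (\<Sum>c\<in>S. f (\<sigma> \<circ> transpose i c)))"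
proof -
  have *: "inv (transpose i c \<circ> \<sigma>) = inv \<sigma> \<circ> transpose i c" if "\<sigma> permutes S" for \<sigma> c
    using permutes_bij [OF that] by (simp add: o_inv_distrib)
  have "(\<Sum>\<sigma> | \<sigma> permutes insert i S. f \<sigma>) = (\<Sum>\<sigma> | \<sigma> permutes insert i S. f (inv \<sigma>))"
    by (rule sum_permutations_inverse)
  also have "\<dots> = (\<Sum>\<sigma> | \<sigma> permutes S. f (inv \<sigma>) + (\<Sum>c\<in>S. f (inv \<sigma> \<circ> transpose i c)))"
    unfolding sum_permutes_insert_left [OF assms] by (intro sum.cong refl) (simp add: *)
  also have "\<dots> = (\<Sum>\<sigma> | \<sigma> permutes S. f \<sigma> + (\<Sum>c\<in>S. f (\<sigma> \<circ> transpose i c)))"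
    by (rule sum_permutations_inverse [symmetric])
  finally show ?thesis .
qed

lemma sign_permutes_compose:
  "finite S \<Longrightarrow> finite T \<Longrightarrow> p permutes S \<Longrightarrow> q permutes T \<Longrightarrow> sign (p \<circ> q) = sign p * sign q"
  by (meson permutes_imp_permutation sign_compose)

text \<open>In the group algebra the sum of all permutations weighted by \<phi> is a product of
  factors z + \<epsilon> J, one for each adjoined point i, where J is the sum of the transpositions
  of i with the earlier points. Here z is the weight of a new cycle, \<epsilon> that of extending
  one, and v an eigenvector of J with eigenvalue \<kappa>.\<close>

lemma sum_weight_insert:
  fixes \<phi> :: "'a set \<Rightarrow> ('a \<Rightarrow> 'a) \<Rightarrow> complex"
  assumes "finite Y" "i \<notin> Y"
    and \<phi>: "\<And>c \<sigma>. c \<in> insert i Y \<Longrightarrow> \<sigma> permutes Y \<Longrightarrow>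
      \<phi> (insert i Y) (transpose i c \<circ> \<sigma>) = (if c = i then z else \<epsilon>) * \<phi> Y \<sigma>"
    and v: "\<And>\<tau>. (\<Sum>c\<in>Y. v (transpose i c \<circ> \<tau>)) = \<kappa> * v \<tau>"
  shows "(\<Sum>\<sigma> | \<sigma> permutes insert i Y. \<phi> (insert i Y) \<sigma> * v (\<sigma> \<circ> \<tau>)) =
    (z + \<epsilon> * \<kappa>) * (\<Sum>\<sigma> | \<sigma> permutes Y. \<phi> Y \<sigma> * v (\<sigma> \<circ> \<tau>))"
  unfolding sum_permutes_insert_left [OF assms(1,2)] sum_distrib_left
proof (rule sum.cong [OF refl])
  fix \<sigma> assume "\<sigma> \<in> {\<sigma>. \<sigma> permutes Y}"
  then have \<sigma>: "\<sigma> permutes Y" by simp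
  have "(\<Sum>c\<in>Y. \<phi> (insert i Y) (transpose i c \<circ> \<sigma>) * v (transpose i c \<circ> \<sigma> \<circ> \<tau>)) =
      (\<Sum>c\<in>Y. \<epsilon> * \<phi> Y \<sigma> * v (transpose i c \<circ> (\<sigma> \<circ> \<tau>)))"
    using \<phi> [OF _ \<sigma>] assms(2) by (intro sum.cong refl) (auto simp: comp_assoc)
  also have "\<dots> = \<epsilon> * \<phi> Y \<sigma> * (\<kappa> * v (\<sigma> \<circ> \<tau>))"
    by (simp add: v [symmetric] sum_distrib_left)
  finally show "\<phi> (insert i Y) \<sigma> * v (\<sigma> \<circ> \<tau>) +
      (\<Sum>c\<in>Y. \<phi> (insert i Y) (transpose i c \<circ> \<sigma>) * v (transpose i c \<circ> \<sigma> \<circ> \<tau>)) =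
      (z + \<epsilon> * \<kappa>) * (\<phi> Y \<sigma> * v (\<sigma> \<circ> \<tau>))"
    using \<phi> [OF _ \<sigma>, of i] by (simp add: algebra_simps)
qed

text \<open>For \<open>\<sigma> permutes K\<close> this is \<open>q\<^bsup>\<kappa>(\<sigma>)\<^esup>\<close>, where \<open>\<kappa>\<close> counts the cycles in \<open>K\<close>.\<close>

definition colourings :: "nat \<Rightarrow> 'a set \<Rightarrow> ('a \<Rightarrow> 'a) \<Rightarrow> nat"
  where "colourings q K \<sigma> = card {r \<in> K \<rightarrow>\<^sub>E {..<q}. \<forall>x\<in>K. r (\<sigma> x) = r x}"

lemma colourings_empty [simp]: "colourings q {} \<sigma> = 1"
  by (simp add: colourings_def)

text \<open>For c = i the new point is a fixed point with q free colours. Otherwise i is spliced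
  into the cycle of c just before c, and its colour is forced.\<close>

lemma colourings_insert:
  assumes "finite Y" "i \<notin> Y" "\<sigma> permutes Y" "c \<in> insert i Y"
  shows "colourings q (insert i Y) (transpose i c \<circ> \<sigma>) = (if c = i then q else 1) * colourings q Y \<sigma>"
proof -
  let ?B = "{r \<in> Y \<rightarrow>\<^sub>E {..<q}. \<forall>x\<in>Y. r (\<sigma> x) = r x}"
  let ?A = "{r \<in> insert i Y \<rightarrow>\<^sub>E {..<q}. \<forall>x\<in>insert i Y. r ((transpose i c \<circ> \<sigma>) x) = r x}"
  have \<sigma>i: "\<sigma> i = i" using assms by (simp add: permutes_not_in)
  have \<sigma>Y: "\<sigma> x \<in> Y" if "x \<in> Y" for x using assms(3) that by (simp add: permutes_in_image)
  then have \<sigma>ne: "\<sigma> x \<noteq> i" if "x \<in> Y" for x using that assms(2) by metis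
  show ?thesis
  proof (cases "c = i")
    case True
    have "?A = (\<lambda>(y, r). r(i := y)) ` ({..<q} \<times> ?B)"
    proof (intro equalityI subsetI)
      fix r assume r: "r \<in> ?A"
      then obtain y s where s: "r = s(i := y)" "y < q" "s \<in> Y \<rightarrow>\<^sub>E {..<q}"
        unfolding PiE_insert_eq by auto
      have "s (\<sigma> x) = s x" if "x \<in> Y" for x
        using r s(1) True that \<sigma>ne assms(2) by (auto dest!: bspec [of _ _ x] split: if_splits)
      with s show "r \<in> (\<lambda>(y, r). r(i := y)) ` ({..<q} \<times> ?B)" by auto
    next
      fix r assume "r \<in> (\<lambda>(y, r). r(i := y)) ` ({..<q} \<times> ?B)"
      then show "r \<in> ?A"
        unfolding PiE_insert_eq using True \<sigma>i \<sigma>ne assms(2) by auto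
    qed
    moreover have "inj_on (\<lambda>(y, r). r(i := y)) ({..<q} \<times> ?B)"
      by (rule inj_on_subset [OF inj_combinator [OF assms(2), of "\<lambda>_. {..<q}"]]) auto
    ultimately show ?thesis
      using True by (simp add: colourings_def card_image card_cartesian_product)
  next
    case False
    then have c: "c \<in> Y" using assms by simp
    have "?A = (\<lambda>r. r(i := r c)) ` ?B"
    proof (intro equalityI subsetI)
      fix r assume r: "r \<in> ?A"
      then obtain y s where s: "r = s(i := y)" "y < q" "s \<in> Y \<rightarrow>\<^sub>E {..<q}"
        unfolding PiE_insert_eq by auto
      have inv: "r (transpose i c (\<sigma> x)) = r x" if "x \<in> insert i Y" for x
        using r that by auto
      have y: "y = s c" using inv [of i] s(1) \<sigma>i False by simp
      have "s (\<sigma> x) = s x" if "x \<in> Y" for x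
      proof (cases "\<sigma> x = c")
        case True
        moreover have "x \<noteq> i" using that assms(2) by auto
        ultimately show ?thesis using inv [of x] that s(1) y by simp
      next
        case False
        then show ?thesis using inv [of x] that s(1) \<sigma>ne [OF that] assms(2) by (auto simp: transpose_apply_other split: if_splits)
      qed
      with s y show "r \<in> (\<lambda>r. r(i := r c)) ` ?B" by auto
    next
      fix r assume "r \<in> (\<lambda>r. r(i := r c)) ` ?B"
      then obtain s where s: "r = s(i := s c)" "s \<in> Y \<rightarrow>\<^sub>E {..<q}" "\<And>x. x \<in> Y \<Longrightarrow> s (\<sigma> x) = s x" by auto
      have "r ((transpose i c \<circ> \<sigma>) x) = r x" if "x \<in> insert i Y" for x
      proof (cases "x = i")
        case True
        then show ?thesis using s(1) \<sigma>i False by simp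
      next
        case xi: False
        then have x: "x \<in> Y" using that by simp
        show ?thesis
          using s(1) s(3) [OF x] \<sigma>ne [OF x] xi False
          by (cases "\<sigma> x = c") (auto simp: transpose_apply_other)
      qed
      moreover have "r \<in> insert i Y \<rightarrow>\<^sub>E {..<q}"
        using s(1,2) c unfolding PiE_insert_eq by auto
      ultimately show "r \<in> ?A" by blast
    qed
    moreover have "inj_on (\<lambda>r. r(i := r c)) ?B"
    proof (rule inj_onI)
      fix r s assume rs: "r \<in> ?B" "s \<in> ?B" "r(i := r c) = s(i := s c)"
      show "r = s"
      proof
        fix x show "r x = s x"
        proof (cases "x = i")
          case True
          then show ?thesis using rs(1,2) assms(2) by (auto simp: PiE_def extensional_def)
        next
          case False
          then show ?thesis using fun_cong [OF rs(3), of x] by simp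
        qed
      qed
    qed
    ultimately show ?thesis
      using False by (simp add: colourings_def card_image)
  qed
qed


section \<open>Hook symmetrizers and Jucys--Murphy elements\<close>

definition hooksym :: "'a set \<Rightarrow> 'a set \<Rightarrow> ('a \<Rightarrow> 'a) \<Rightarrow> complex"
  where "hooksym A B \<tau> =
    (\<Sum>a | a permutes A. \<Sum>b | b permutes B. if a \<circ> b = \<tau> then of_int (sign a) else 0)"

lemma comp_left_cancel: "g permutes A \<Longrightarrow> g \<circ> s = g \<circ> t \<longleftrightarrow> s = t"
  by (metis comp_assoc id_comp permutes_inv_o(2))

lemma hooksym_column:
  assumes "finite A" "g permutes A"
  shows "hooksym A B (g \<circ> \<tau>) = of_int (sign g) * hooksym A B \<tau>"
proof -
  have "hooksym A B (g \<circ> \<tau>) =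
      (\<Sum>a | a permutes A. \<Sum>b | b permutes B. if g \<circ> a \<circ> b = g \<circ> \<tau> then of_int (sign (g \<circ> a)) else 0)"
    unfolding hooksym_def by (rule setum_permutations_compose_left [OF assms(2)])
  also have "\<dots> = of_int (sign g) * hooksym A B \<tau>"
    unfolding hooksym_def sum_distrib_left
    by (intro sum.cong refl)
      (auto simp: sign_permutes_compose [OF assms(1,1,2)] comp_assoc comp_left_cancel [OF assms(2)])
  finally show ?thesis .
qed

lemma permutes_disjoint_commute:
  assumes "a permutes A" "g permutes C" "A \<inter> C = {}"
  shows "a \<circ> g = g \<circ> a"
proof
  fix x
  have "a x \<in> A \<longleftrightarrow> x \<in> A" "g x \<in> C \<longleftrightarrow> x \<in> C" using assms by (simp_all add: permutes_in_image)
  then show "(a \<circ> g) x = (g \<circ> a) x"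
    using assms permutes_not_in [OF assms(1)] permutes_not_in [OF assms(2)]
    by (cases "x \<in> A"; cases "x \<in> C") fastforce+
qed

text \<open>The column factor stands on the left, so a row permutation reaches the row sum only by
  commuting past the column permutations; this restricts g to \<open>B - A\<close>.\<close>

lemma hooksym_row:
  assumes "g permutes (B - A)"
  shows "hooksym A B (g \<circ> \<tau>) = hooksym A B \<tau>"
proof -
  have g: "g permutes B" using assms by (rule permutes_subset) blast
  show ?thesis
    unfolding hooksym_def
  proof (rule sum.cong [OF refl])
    fix a assume "a \<in> {a. a permutes A}"
    then have "a \<circ> g = g \<circ> a"
      using assms by (intro permutes_disjoint_commute [of a A g "B - A"]) auto
    then have *: "a \<circ> (g \<circ> b) = g \<circ> (a \<circ> b)" for b
      by (metis comp_assoc)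
    have "(\<Sum>b | b permutes B. if a \<circ> b = g \<circ> \<tau> then complex_of_int (sign a) else 0) =
        (\<Sum>b | b permutes B. if a \<circ> (g \<circ> b) = g \<circ> \<tau> then of_int (sign a) else 0)"
      by (rule setum_permutations_compose_left [OF g])
    then show "(\<Sum>b | b permutes B. if a \<circ> b = g \<circ> \<tau> then complex_of_int (sign a) else 0) =
        (\<Sum>b | b permutes B. if a \<circ> b = \<tau> then of_int (sign a) else 0)"
      unfolding * comp_left_cancel [OF assms] .
  qed
qed

text \<open>The transposition of x and i lies in both groups; moving it from the column factor to
  the row factor keeps the product and reverses the sign.\<close>

lemma hooksym_eq_0:
  assumes "finite A" "x \<in> A" "i \<in> A" "x \<in> B" "i \<in> B" "x \<noteq> i"
  shows "hooksym A B \<tau> = 0"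
proof -
  let ?t = "transpose x i"
  have tA: "?t permutes A" and tB: "?t permutes B" using assms by (auto intro: permutes_swap_id)
  have "hooksym A B \<tau> =
      (\<Sum>a | a permutes A. \<Sum>b | b permutes B. if a \<circ> ?t \<circ> b = \<tau> then of_int (sign (a \<circ> ?t)) else 0)"
    unfolding hooksym_def by (rule sum_permutations_compose_right [OF tA])
  also have "\<dots> = (\<Sum>a | a permutes A. \<Sum>b | b permutes B. - (if a \<circ> b = \<tau> then of_int (sign a) else 0))"
  proof (rule sum.cong [OF refl])
    fix a assume "a \<in> {a. a permutes A}"
    then have s: "sign (a \<circ> ?t) = - sign a"
      using assms tA by (simp add: sign_permutes_compose [of A A] sign_swap_id)
    have tt: "a \<circ> ?t \<circ> (?t \<circ> b) = a \<circ> b" for b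
      by (simp add: fun_eq_iff)
    have "(\<Sum>b | b permutes B. if a \<circ> ?t \<circ> b = \<tau> then of_int (sign (a \<circ> ?t)) else (0 :: complex)) =
        (\<Sum>b | b permutes B. if a \<circ> ?t \<circ> (?t \<circ> b) = \<tau> then of_int (sign (a \<circ> ?t)) else 0)"
      by (rule setum_permutations_compose_left [OF tB])
    then show "(\<Sum>b | b permutes B. if a \<circ> ?t \<circ> b = \<tau> then of_int (sign (a \<circ> ?t)) else (0 :: complex)) =
        (\<Sum>b | b permutes B. - (if a \<circ> b = \<tau> then of_int (sign a) else 0))"
      unfolding tt s by (auto intro!: sum.cong)
  qed
  also have "\<dots> = - hooksym A B \<tau>"
    by (simp add: hooksym_def sum_negf)
  finally show ?thesis by simp
qed

text \<open>Adding i to the column makes it meet the row in both x and i, so the enlarged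
  symmetrizer is 0. Splitting its column group into cosets gives the relation.\<close>

lemma hooksym_garnir:
  assumes "finite A" "x \<in> A" "x \<in> B" "i \<in> B - A"
  shows "(\<Sum>c\<in>A. hooksym A B (transpose i c \<circ> \<tau>)) = hooksym A B \<tau>"
proof -
  have "0 = hooksym (insert i A) B \<tau>"
    using assms by (subst hooksym_eq_0 [of _ x i]) auto
  also have "\<dots> = (\<Sum>a | a permutes A. (\<Sum>b | b permutes B. if a \<circ> b = \<tau> then of_int (sign a) else 0) +
      (\<Sum>c\<in>A. \<Sum>b | b permutes B. if transpose i c \<circ> a \<circ> b = \<tau> then of_int (sign (transpose i c \<circ> a)) else 0))"
    unfolding hooksym_def using assms by (intro sum_permutes_insert_left) auto
  also have "\<dots> = (\<Sum>a | a permutes A. (\<Sum>b | b permutes B. if a \<circ> b = \<tau> then of_int (sign a) else 0) -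
      (\<Sum>c\<in>A. \<Sum>b | b permutes B. if a \<circ> b = transpose i c \<circ> \<tau> then of_int (sign a) else 0))"
  proof (rule sum.cong [OF refl])
    fix a assume "a \<in> {a. a permutes A}"
    then have a: "a permutes A" by simp
    have s: "sign (transpose i c \<circ> a) = - sign a" if "c \<in> A" for c
      using that assms a
      by (subst sign_permutes_compose [of "insert i A" A])
        (auto simp: sign_swap_id intro: permutes_swap_id)
    have e: "transpose i c \<circ> a \<circ> b = \<tau> \<longleftrightarrow> a \<circ> b = transpose i c \<circ> \<tau>" for b c
      by (metis comp_assoc id_comp transpose_comp_involutory)
    have "(\<Sum>c\<in>A. \<Sum>b | b permutes B. if transpose i c \<circ> a \<circ> b = \<tau> then of_int (sign (transpose i c \<circ> a)) else (0 :: complex))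
      = (\<Sum>c\<in>A. \<Sum>b | b permutes B. - (if a \<circ> b = transpose i c \<circ> \<tau> then of_int (sign a) else 0))"
      unfolding e by (intro sum.cong refl) (simp add: s)
    then show "(\<Sum>b | b permutes B. if a \<circ> b = \<tau> then of_int (sign a) else 0) +
      (\<Sum>c\<in>A. \<Sum>b | b permutes B. if transpose i c \<circ> a \<circ> b = \<tau> then of_int (sign (transpose i c \<circ> a)) else 0) =
      (\<Sum>b | b permutes B. if a \<circ> b = \<tau> then of_int (sign a) else 0) -
      (\<Sum>c\<in>A. \<Sum>b | b permutes B. if a \<circ> b = transpose i c \<circ> \<tau> then complex_of_int (sign a) else 0)"
      by (simp add: sum_negf)
  qed
  also have "\<dots> = hooksym A B \<tau> - (\<Sum>c\<in>A. hooksym A B (transpose i c \<circ> \<tau>))"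
    unfolding hooksym_def sum_subtractf by (simp add: sum.swap [of _ A])
  finally show ?thesis by simp
qed

text \<open>The two groups meet trivially, so the identity factors only trivially. With this
  normalization an eigenvalue is the value of the weighted sum at \<open>id\<close>.\<close>

lemma hooksym_id:
  assumes "finite A" "finite B" "A \<inter> B = {x}"
  shows "hooksym A B id = 1"
proof -
  have "a \<circ> b = id \<longleftrightarrow> a = id \<and> b = id" if "a permutes A" "b permutes B" for a b
  proof
    assume ab: "a \<circ> b = id"
    have "a = inv b"
      using ab that(2) by (metis comp_assoc comp_id id_comp permutes_inv_o(1))
    then have aB: "a permutes B" using that(2) by (simp add: permutes_inv)
    have "a y = y" if "y \<in> A - {x}" for y
      using permutes_not_in [OF aB, of y] that assms(3) by blast
    then have "a permutes {x}" using that(1) by (rule permutes_superset [rotated]) 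
    then have "a = id" by simp
    with ab show "a = id \<and> b = id" by simp
  qed simp
  then have "hooksym A B id =
      (\<Sum>a | a permutes A. \<Sum>b | b permutes B. if a = id \<and> b = id then of_int (sign a) else 0)"
    unfolding hooksym_def by (intro sum.cong refl if_cong) auto
  also have "\<dots> = (\<Sum>a | a permutes A. if a = id then 1 else 0)"
    using assms(2) by (intro sum.cong refl) (simp add: sum.delta' finite_permutations)
  also have "\<dots> = 1"
    using assms(1) by (simp add: sum.delta' finite_permutations)
  finally show ?thesis .
qed


text \<open>Transpositions inside the column act by -1, so the point adjoined after l others has
  Jucys--Murphy eigenvalue -l, its content.\<close>

lemma sum_weight_hooksym_column:
  fixes \<phi> :: "'a set \<Rightarrow> ('a \<Rightarrow> 'a) \<Rightarrow> complex"
  assumes \<phi>: "\<And>i c Y \<sigma>. finite Y \<Longrightarrow> i \<notin> Y \<Longrightarrow> c \<in> insert i Y \<Longrightarrow> \<sigma> permutes Y \<Longrightarrow>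
      \<phi> (insert i Y) (transpose i c \<circ> \<sigma>) = (if c = i then z else \<epsilon>) * \<phi> Y \<sigma>"
    and \<phi>0: "\<phi> {} id = 1" and "finite A" "finite Y" "Y \<subseteq> A"
  shows "(\<Sum>\<sigma> | \<sigma> permutes Y. \<phi> Y \<sigma> * hooksym A B (\<sigma> \<circ> \<tau>)) =
    (\<Prod>l<card Y. z - \<epsilon> * of_nat l) * hooksym A B \<tau>"
  using assms(4,5)
proof (induction Y)
  case empty
  then show ?case by (simp add: \<phi>0 \<phi>0 [unfolded id_def])
next
  case (insert i Y)
  have "(\<Sum>\<sigma> | \<sigma> permutes insert i Y. \<phi> (insert i Y) \<sigma> * hooksym A B (\<sigma> \<circ> \<tau>)) =
      (z + \<epsilon> * (- of_nat (card Y))) * (\<Sum>\<sigma> | \<sigma> permutes Y. \<phi> Y \<sigma> * hooksym A B (\<sigma> \<circ> \<tau>))"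
  proof (rule sum_weight_insert [OF insert.hyps(1,2) \<phi> [OF insert.hyps(1,2)]])
    fix \<tau>
    have "hooksym A B (transpose i c \<circ> \<tau>) = - hooksym A B \<tau>" if "c \<in> Y" for c
    proof -
      have "transpose i c permutes A" using that insert.prems by (auto intro: permutes_swap_id)
      moreover have "i \<noteq> c" using that insert.hyps by auto
      ultimately show ?thesis by (simp add: hooksym_column [OF \<open>finite A\<close>] sign_swap_id)
    qed
    then show "(\<Sum>c\<in>Y. hooksym A B (transpose i c \<circ> \<tau>)) = - of_nat (card Y) * hooksym A B \<tau>"
      by simp
  qed
  also have "(\<Sum>\<sigma> | \<sigma> permutes Y. \<phi> Y \<sigma> * hooksym A B (\<sigma> \<circ> \<tau>)) =
      (\<Prod>l<card Y. z - \<epsilon> * of_nat l) * hooksym A B \<tau>"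
    using insert.prems by (intro insert.IH) auto
  also have "(z + \<epsilon> * (- of_nat (card Y))) * ((\<Prod>l<card Y. z - \<epsilon> * of_nat l) * hooksym A B \<tau>) =
      (\<Prod>l<card (insert i Y). z - \<epsilon> * of_nat l) * hooksym A B \<tau>"
    using insert.hyps by simp
  finally show ?case .
qed

text \<open>After the column the points of the row are adjoined. The transpositions of i with the
  column contribute 1 in total by \<open>hooksym_garnir\<close>, that with each earlier row point 1,
  so the eigenvalue is again the content.\<close>

lemma sum_weight_hooksym:
  fixes \<phi> :: "'a set \<Rightarrow> ('a \<Rightarrow> 'a) \<Rightarrow> complex"
  assumes \<phi>: "\<And>i c Y \<sigma>. finite Y \<Longrightarrow> i \<notin> Y \<Longrightarrow> c \<in> insert i Y \<Longrightarrow> \<sigma> permutes Y \<Longrightarrow>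
      \<phi> (insert i Y) (transpose i c \<circ> \<sigma>) = (if c = i then z else \<epsilon>) * \<phi> Y \<sigma>"
    and \<phi>0: "\<phi> {} id = 1" and A: "finite A" "x \<in> A" "x \<in> B" and R: "finite R" "R \<subseteq> B - A"
  shows "(\<Sum>\<sigma> | \<sigma> permutes A \<union> R. \<phi> (A \<union> R) \<sigma> * hooksym A B (\<sigma> \<circ> \<tau>)) =
    (\<Prod>l<card R. z + \<epsilon> * of_nat (l + 1)) * (\<Prod>l<card A. z - \<epsilon> * of_nat l) * hooksym A B \<tau>"
  using R
proof (induction R)
  case empty
  have "(\<Sum>\<sigma> | \<sigma> permutes A. \<phi> A \<sigma> * hooksym A B (\<sigma> \<circ> \<tau>)) =
      (\<Prod>l<card A. z - \<epsilon> * of_nat l) * hooksym A B \<tau>"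
    by (rule sum_weight_hooksym_column [where \<phi> = \<phi>, OF _ \<phi>0 A(1) A(1) subset_refl]) (rule \<phi>)
  then show ?case
    by (simp only: Un_empty_right card.empty lessThan_0 prod.empty mult_1)
next
  case (insert i R)
  have i: "i \<notin> A \<union> R" "i \<in> B - A" and fin: "finite (A \<union> R)" using insert A by auto
  have "(\<Sum>\<sigma> | \<sigma> permutes insert i (A \<union> R). \<phi> (insert i (A \<union> R)) \<sigma> * hooksym A B (\<sigma> \<circ> \<tau>)) =
      (z + \<epsilon> * of_nat (card R + 1)) * (\<Sum>\<sigma> | \<sigma> permutes A \<union> R. \<phi> (A \<union> R) \<sigma> * hooksym A B (\<sigma> \<circ> \<tau>))"
  proof (rule sum_weight_insert [OF fin i(1) \<phi> [OF fin i(1)]])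
    fix \<tau>
    have "hooksym A B (transpose i c \<circ> \<tau>) = hooksym A B \<tau>" if "c \<in> R" for c
      using that insert.prems i by (intro hooksym_row permutes_swap_id) auto
    moreover have "A \<inter> R = {}" using insert by auto
    ultimately show "(\<Sum>c\<in>A \<union> R. hooksym A B (transpose i c \<circ> \<tau>)) = of_nat (card R + 1) * hooksym A B \<tau>"
      using A(1) insert.hyps
      by (simp add: sum.union_disjoint hooksym_garnir [OF A i(2)] algebra_simps)
  qed
  also have "(\<Sum>\<sigma> | \<sigma> permutes A \<union> R. \<phi> (A \<union> R) \<sigma> * hooksym A B (\<sigma> \<circ> \<tau>)) =
      (\<Prod>l<card R. z + \<epsilon> * of_nat (l + 1)) * (\<Prod>l<card A. z - \<epsilon> * of_nat l) * hooksym A B \<tau>"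
    using insert.prems by (intro insert.IH) auto
  also have "(z + \<epsilon> * of_nat (card R + 1)) *
      ((\<Prod>l<card R. z + \<epsilon> * of_nat (l + 1)) * (\<Prod>l<card A. z - \<epsilon> * of_nat l) * hooksym A B \<tau>) =
      (\<Prod>l<card (insert i R). z + \<epsilon> * of_nat (l + 1)) * (\<Prod>l<card A. z - \<epsilon> * of_nat l) * hooksym A B \<tau>"
    using insert.hyps by simp
  finally show ?case
    unfolding Un_insert_right .
qed

text \<open>The contents of a hook are consecutive integers, so the factors of arm and leg join into
  one falling factorial.\<close>

lemma falling_split:
  "(\<Prod>l<r. a + of_nat (l + 1)) * falling a m = falling (a + of_nat r) (r + m)"
proof (induction r)
  case (Suc r)
  have "falling (a + of_nat (Suc r)) (Suc r + m) = (a + of_nat r + 1) * falling (a + of_nat r) (r + m)"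
    using falling_Suc_shift [of "a + of_nat r" "r + m"] by (simp add: add_ac)
  also have "\<dots> = (a + of_nat r + 1) * ((\<Prod>l<r. a + of_nat (l + 1)) * falling a m)"
    by (simp only: Suc)
  finally show ?case by (simp add: mult_ac add_ac)
qed simp

lemma sum_colourings_hooksym:
  assumes "finite A" "x \<in> A" "x \<in> B" "finite B"
  shows "(\<Sum>\<sigma> | \<sigma> permutes A \<union> B. of_nat (colourings p (A \<union> B) \<sigma>) * hooksym A B (\<sigma> \<circ> \<tau>)) =
    falling (of_nat p + of_nat (card (B - A))) (card (A \<union> B)) * hooksym A B \<tau>"
proof -
  have AB: "A \<union> (B - A) = A \<union> B" by auto
  have "card (A \<union> (B - A)) = card A + card (B - A)"
    using assms by (intro card_Un_disjoint) auto
  then have card: "card (A \<union> B) = card (B - A) + card A"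
    by (simp add: AB)
  have "(\<Sum>\<sigma> | \<sigma> permutes A \<union> (B - A). of_nat (colourings p (A \<union> (B - A)) \<sigma>) * hooksym A B (\<sigma> \<circ> \<tau>)) =
      (\<Prod>l<card (B - A). of_nat p + 1 * of_nat (l + 1)) * (\<Prod>l<card A. of_nat p - 1 * of_nat l) * hooksym A B \<tau>"
  proof (rule sum_weight_hooksym [OF _ _ assms(1-3)])
    fix i c :: 'a and Y \<sigma> assume *: "finite Y" "i \<notin> Y" "c \<in> insert i Y" "\<sigma> permutes Y"
    then show "of_nat (colourings p (insert i Y) (transpose i c \<circ> \<sigma>)) =
        (if c = i then of_nat p else 1) * (of_nat (colourings p Y \<sigma>) :: complex)"
      by (subst colourings_insert) simp_all
  qed (use assms in auto)
  then show ?thesis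
    unfolding AB card falling_split [symmetric] by (simp add: falling_def)
qed

text \<open>The sign turns \<epsilon> into -1 and hence negates the contents: arm and leg exchange
  their roles in \<open>falling_split\<close>, which is applied with base q - 1.\<close>

lemma sum_sign_colourings_hooksym:
  assumes "finite A" "x \<in> A" "x \<in> B" "finite B"
  shows "(\<Sum>\<sigma> | \<sigma> permutes A \<union> B. of_int (sign \<sigma>) * of_nat (colourings q (A \<union> B) \<sigma>) * hooksym A B (\<sigma> \<circ> \<tau>)) =
    falling (of_nat q - 1 + of_nat (card A)) (card (A \<union> B)) * hooksym A B \<tau>"
proof -
  have AB: "A \<union> (B - A) = A \<union> B" by auto
  have "card (A \<union> (B - A)) = card A + card (B - A)"
    using assms by (intro card_Un_disjoint) auto
  then have card: "card (A \<union> B) = card A + card (B - A)"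
    by (simp add: AB)
  have "(\<Sum>\<sigma> | \<sigma> permutes A \<union> (B - A).
      of_int (sign \<sigma>) * of_nat (colourings q (A \<union> (B - A)) \<sigma>) * hooksym A B (\<sigma> \<circ> \<tau>)) =
      (\<Prod>l<card (B - A). of_nat q + (-1) * of_nat (l + 1)) * (\<Prod>l<card A. of_nat q - (-1) * of_nat l) * hooksym A B \<tau>"
  proof (rule sum_weight_hooksym [OF _ _ assms(1-3)])
    fix i c :: 'a and Y \<sigma> assume *: "finite Y" "i \<notin> Y" "c \<in> insert i Y" "\<sigma> permutes Y"
    have "sign (transpose i c \<circ> \<sigma>) = (if c = i then 1 else -1) * sign \<sigma>"
      using * by (subst sign_permutes_compose [of "insert i Y" Y]) (auto simp: sign_swap_id intro: permutes_swap_id)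
    with * show "of_int (sign (transpose i c \<circ> \<sigma>)) * of_nat (colourings q (insert i Y) (transpose i c \<circ> \<sigma>)) =
        (if c = i then of_nat q else -1) * (of_int (sign \<sigma>) * of_nat (colourings q Y \<sigma>) :: complex)"
      by (simp add: colourings_insert)
  qed (use assms in auto)
  also have "(\<Prod>l<card (B - A). of_nat q + (-1) * of_nat (l + 1)) * (\<Prod>l<card A. of_nat q - (-1) * of_nat l) =
     (\<Prod>l<card A. of_nat q - 1 + of_nat (l + 1)) * (falling (of_nat q - 1) (card (B - A)) :: complex)"
    by (simp add: falling_def algebra_simps)
  finally show ?thesis
    unfolding AB card falling_split .
qed


section \<open>Sums of class functions against hook symmetrizers\<close>

text \<open>Transitivity as absence of proper invariant subsets: a form that passes easily to the
  cycle with one point cut out.\<close>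

definition full_cycle :: "'a set \<Rightarrow> ('a \<Rightarrow> 'a) \<Rightarrow> bool"
  where "full_cycle K w \<longleftrightarrow> w permutes K \<and> K \<noteq> {} \<and> (\<forall>T\<subseteq>K. T \<noteq> {} \<longrightarrow> w ` T \<subseteq> T \<longrightarrow> T = K)"

lemma bij_transpose_comp: "bij f \<Longrightarrow> f \<circ> transpose a b = transpose (f a) (f b) \<circ> f"
  by (auto simp: fun_eq_iff transpose_def dest: bij_is_inj injD)

text \<open>b is the predecessor of i; composing with the transposition on the right lets b jump
  over i to \<open>w i\<close> and makes i a fixed point.\<close>

lemma full_cycle_remove:
  assumes "full_cycle (insert i Y) w" "i \<notin> Y" "Y \<noteq> {}"
  obtains b w' where "b \<in> Y" "full_cycle Y w'" "w = w' \<circ> transpose i b"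
proof -
  have w: "w permutes insert i Y" and tr: "\<And>T. T \<subseteq> insert i Y \<Longrightarrow> T \<noteq> {} \<Longrightarrow> w ` T \<subseteq> T \<Longrightarrow> T = insert i Y"
    using assms(1) by (auto simp: full_cycle_def)
  define b where "b = inv w i"
  have wb: "w b = i" using w by (simp add: b_def permutes_inverses)
  have "w i \<noteq> i"
  proof
    assume "w i = i"
    then have "{i} = insert i Y" by (intro tr) auto
    then show False using assms by auto
  qed
  then have "b \<noteq> i" using wb by auto
  have "b \<in> insert i Y" using wb permutes_in_image [OF w, of b] by simp
  then have bY: "b \<in> Y" using \<open>b \<noteq> i\<close> by simp
  define w' where "w' = w \<circ> transpose i b"
  have w'i: "w' i = i" and w'b: "w' b = w i" and w'o: "\<And>x. x \<noteq> i \<Longrightarrow> x \<noteq> b \<Longrightarrow> w' x = w x"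
    using wb by (auto simp: w'_def transpose_apply_other)
  have "w' permutes insert i Y"
    unfolding w'_def using bY by (intro permutes_compose [OF _ w] permutes_swap_id) auto
  then have "w' permutes Y"
    by (rule permutes_superset) (use w'i in auto)
  moreover have "T = Y" if T: "T \<subseteq> Y" "T \<noteq> {}" "w' ` T \<subseteq> T" for T
  proof -
    \<comment> \<open>Lift of an invariant set: w visits i exactly after b, so i has to be added
      precisely when b is present.\<close>
    define T' where "T' = (if b \<in> T then insert i T else T)"
    have "w ` T' \<subseteq> T'"
    proof
      fix y assume "y \<in> w ` T'"
      then obtain x where x: "x \<in> T'" "y = w x" by auto
      consider "x = i" "b \<in> T" | "x = b" "b \<in> T" | "x \<in> T" "x \<noteq> i" "x \<noteq> b"
        using x T(1) assms(2) by (auto simp: T'_def split: if_splits)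
      then show "y \<in> T'"
      proof cases
        case 1
        then have "w' b \<in> T" using T by auto
        then show ?thesis using 1 x w'b by (simp add: T'_def)
      next
        case 2
        then show ?thesis using x wb by (simp add: T'_def)
      next
        case 3
        then have "w' x \<in> T" using T by auto
        then show ?thesis using 3 x w'o by (simp add: T'_def)
      qed
    qed
    then have "T' = insert i Y" using T by (intro tr) (auto simp: T'_def)
    then show ?thesis using T(1) assms(2) by (auto simp: T'_def split: if_splits)
  qed
  ultimately have "full_cycle Y w'" using assms(3) by (simp add: full_cycle_def)
  moreover have "w = w' \<circ> transpose i b" by (simp add: w'_def comp_assoc)
  ultimately show thesis using that bY by blast
qed

text \<open>Conjugation by the transposition of i and y = \<open>w b\<close> turns
  \<open>w \<circ> transpose i b\<close> into \<open>w \<circ> transpose i y\<close> and is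
  permitted unless y = x. So the set of good b contains x and is closed under w, hence is
  everything.\<close>

lemma full_cycle_insert_invariant:
  assumes w: "full_cycle (insert x X) w" and i: "i \<notin> insert x X" and b: "b \<in> insert x X"
    and F: "\<And>g \<sigma>. g permutes insert i X \<Longrightarrow> \<sigma> permutes insert x (insert i X) \<Longrightarrow> F (g \<circ> \<sigma> \<circ> inv g) = F \<sigma>"
  shows "F (w \<circ> transpose i b) = F (w \<circ> transpose i x)"
proof -
  have wp: "w permutes insert x X" using w by (simp add: full_cycle_def)
  have wi: "w i = i" using wp i by (simp add: permutes_not_in)
  let ?T = "{b \<in> insert x X. F (w \<circ> transpose i b) = F (w \<circ> transpose i x)}"
  have "?T = insert x X"
  proof -
    have "w ` ?T \<subseteq> ?T"
    proof
      fix y assume "y \<in> w ` ?T"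
      then obtain b where b: "b \<in> insert x X" "F (w \<circ> transpose i b) = F (w \<circ> transpose i x)" "y = w b" by auto
      have y: "y \<in> insert x X" using b(1,3) permutes_in_image [OF wp, of b] by simp
      have "F (w \<circ> transpose i y) = F (w \<circ> transpose i b)" if "y \<noteq> x"
      proof -
        let ?g = "transpose i y"
        have g: "?g permutes insert i X" using y that by (intro permutes_swap_id) auto
        have "w \<circ> transpose i b permutes insert x (insert i X)"
          by (intro permutes_compose permutes_swap_id permutes_subset [OF wp]) (use b in auto)
        then have "F (?g \<circ> (w \<circ> transpose i b) \<circ> inv ?g) = F (w \<circ> transpose i b)"
          by (rule F [OF g])
        moreover have "w \<circ> transpose i b = ?g \<circ> w"
          using bij_transpose_comp [OF permutes_bij [OF wp], of i b] wi b(3) by simp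
        then have "?g \<circ> (w \<circ> transpose i b) \<circ> inv ?g = w \<circ> transpose i y"
          by (simp only: inv_transpose_eq comp_assoc [symmetric] transpose_comp_involutory id_comp)
        ultimately show ?thesis by (simp only:)
      qed
      then show "y \<in> ?T" using b y by (cases "y = x") auto
    qed
    moreover have "x \<in> ?T" by simp
    ultimately show ?thesis using w unfolding full_cycle_def by blast
  qed
  then show ?thesis using b by blast
qed

text \<open>Invariance is assumed only for permutations fixing \<open>x\<close>: the function \<open>F'\<close> to which the
  induction hypothesis is applied is no class function, as it treats \<open>x\<close> specially.\<close>

lemma class_sum_hooks:
  fixes F :: "('a \<Rightarrow> 'a) \<Rightarrow> complex"
  assumes "finite X" "x \<notin> X" "full_cycle (insert x X) w"
    and "\<And>g \<sigma>. g permutes X \<Longrightarrow> \<sigma> permutes insert x X \<Longrightarrow> F (g \<circ> \<sigma> \<circ> inv g) = F \<sigma>"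
  shows "(\<Sum>S\<in>Pow X. (-1) ^ card S * (\<Sum>a | a permutes insert x S. \<Sum>b | b permutes insert x (X - S).
      of_int (sign a) * F (a \<circ> b))) = fact (card X + 1) * F w"
  using assms
proof (induction X arbitrary: F w)
  case empty
  then have "w = id" by (simp add: full_cycle_def)
  then show ?case by simp
next
  case (insert i X)
  have ix: "i \<noteq> x" "i \<notin> insert x X" and xX: "x \<notin> X" using insert by auto
  have "full_cycle (insert i (insert x X)) w" using insert.prems by (simp add: insert_commute)
  then obtain b w' where w': "b \<in> insert x X" "full_cycle (insert x X) w'" "w = w' \<circ> transpose i b"
    using full_cycle_remove [OF _ ix(2)] by blast
  have w'p: "w' permutes insert x X" using w' by (simp add: full_cycle_def)
  \<comment> \<open>The terms left over when the hook with i in the leg is subtracted from that with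
    i in the arm. The corner x belongs to both, so its transposition with i occurs twice, once on
    each side.\<close>
  define F' where "F' \<sigma> = (\<Sum>y\<in>insert x X. F (\<sigma> \<circ> transpose i y)) + F (transpose i x \<circ> \<sigma>)" for \<sigma>
  let ?H = "\<lambda>X F S. \<Sum>a | a permutes insert x S. \<Sum>b | b permutes insert x (X - S).
      of_int (sign a) * F (a \<circ> b) :: complex"
  have perm_t: "\<sigma> \<circ> transpose i y permutes insert x (insert i X)" if "\<sigma> permutes insert x X" "y \<in> insert x X" for \<sigma> y
    using that by (intro permutes_compose permutes_swap_id permutes_subset [OF that(1)]) auto
  \<comment> \<open>The subsets S and \<open>insert i S\<close> have opposite signs. In the
    difference the terms without a transposition of i cancel, and the sign of a column transposition
    makes the others add up.\<close>
  have step: "?H (insert i X) F S - ?H (insert i X) F (insert i S) = ?H X F' S" if S: "S \<subseteq> X" for S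
  proof -
    have fin: "finite S" "finite (X - S)" using S insert.hyps finite_subset by auto
    have iS: "i \<notin> insert x S" "i \<notin> insert x (X - S)" using ix S by auto
    have e1: "insert x (insert i X - S) = insert i (insert x (X - S))" and
      e2: "insert x (insert i S) = insert i (insert x S)" and
      e3: "insert x (insert i X - insert i S) = insert x (X - S)"
      using iS ix S insert.hyps by auto
    have H1: "?H (insert i X) F S = (\<Sum>a | a permutes insert x S. \<Sum>b | b permutes insert x (X - S).
        of_int (sign a) * F (a \<circ> b) + (\<Sum>y\<in>insert x (X - S). of_int (sign a) * F (a \<circ> (b \<circ> transpose i y))))"
      unfolding e1 using fin iS by (intro sum.cong refl sum_permutes_insert_right) auto
    have "?H (insert i X) F (insert i S) = (\<Sum>a | a permutes insert x S.
        (\<Sum>b | b permutes insert x (X - S). of_int (sign a) * F (a \<circ> b)) +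
        (\<Sum>c\<in>insert x S. \<Sum>b | b permutes insert x (X - S).
          of_int (sign (transpose i c \<circ> a)) * F (transpose i c \<circ> a \<circ> b)))"
      unfolding e2 e3 using fin iS by (intro sum_permutes_insert_left) auto
    also have "\<dots> = (\<Sum>a | a permutes insert x S. \<Sum>b | b permutes insert x (X - S).
        of_int (sign a) * F (a \<circ> b) - (\<Sum>c\<in>insert x S. of_int (sign a) * F (transpose i c \<circ> (a \<circ> b))))"
    proof (rule sum.cong [OF refl])
      fix a assume "a \<in> {a. a permutes insert x S}"
      then have a: "a permutes insert x S" by simp
      have s: "sign (transpose i c \<circ> a) = - sign a" if "c \<in> insert x S" for c
        using that fin a iS
        by (subst sign_permutes_compose [of "insert i (insert x S)" "insert x S"])
          (auto simp: sign_swap_id intro: permutes_swap_id)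
      have "(\<Sum>c\<in>insert x S. \<Sum>b | b permutes insert x (X - S).
          of_int (sign (transpose i c \<circ> a)) * F (transpose i c \<circ> a \<circ> b)) =
        (\<Sum>c\<in>insert x S. \<Sum>b | b permutes insert x (X - S).
          - (of_int (sign a) * F (transpose i c \<circ> (a \<circ> b))))"
        by (intro sum.cong refl) (simp add: s comp_assoc)
      also have "\<dots> = - (\<Sum>b | b permutes insert x (X - S).
          \<Sum>c\<in>insert x S. of_int (sign a) * F (transpose i c \<circ> (a \<circ> b)))"
        unfolding sum_negf by (subst sum.swap) (rule refl)
      finally show "(\<Sum>b | b permutes insert x (X - S). of_int (sign a) * F (a \<circ> b)) +
        (\<Sum>c\<in>insert x S. \<Sum>b | b permutes insert x (X - S).
          of_int (sign (transpose i c \<circ> a)) * F (transpose i c \<circ> a \<circ> b)) =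
        (\<Sum>b | b permutes insert x (X - S).
        of_int (sign a) * F (a \<circ> b) - (\<Sum>c\<in>insert x S. of_int (sign a) * F (transpose i c \<circ> (a \<circ> b))))"
        by (simp add: sum_subtractf)
    qed
    finally have H2: "?H (insert i X) F (insert i S) = (\<Sum>a | a permutes insert x S. \<Sum>b | b permutes insert x (X - S).
        of_int (sign a) * F (a \<circ> b) - (\<Sum>c\<in>insert x S. of_int (sign a) * F (transpose i c \<circ> (a \<circ> b))))" .
    show ?thesis
      unfolding H1 H2 sum_subtractf [symmetric]
    proof (intro sum.cong refl)
      fix a b assume "a \<in> {a. a permutes insert x S}" "b \<in> {b. b permutes insert x (X - S)}"
      then have ab: "a \<circ> b permutes insert x X"
        using S by (intro permutes_compose) (auto elim!: permutes_subset)
      have c: "F (transpose i c \<circ> (a \<circ> b)) = F (a \<circ> b \<circ> transpose i c)" if "c \<in> S" for c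
      proof -
        have "F (transpose i c \<circ> (a \<circ> b \<circ> transpose i c) \<circ> inv (transpose i c)) = F (a \<circ> b \<circ> transpose i c)"
          using that S by (intro insert.prems(3) perm_t [OF ab] permutes_swap_id) auto
        then show ?thesis by (simp add: comp_assoc)
      qed
      have "(\<Sum>y\<in>insert x (X - S). F (a \<circ> b \<circ> transpose i y)) + (\<Sum>c\<in>insert x S. F (transpose i c \<circ> (a \<circ> b))) =
        (\<Sum>y\<in>insert x (X - S). F (a \<circ> b \<circ> transpose i y)) + (\<Sum>y\<in>S. F (a \<circ> b \<circ> transpose i y)) +
          F (transpose i x \<circ> (a \<circ> b))"
        using fin xX S by (subst (2) sum.insert) (auto simp: c)
      also have "(\<Sum>y\<in>insert x (X - S). F (a \<circ> b \<circ> transpose i y)) + (\<Sum>y\<in>S. F (a \<circ> b \<circ> transpose i y)) =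
          (\<Sum>y\<in>insert x (X - S) \<union> S. F (a \<circ> b \<circ> transpose i y))"
        using fin xX S by (subst sum.union_disjoint) auto
      also have "insert x (X - S) \<union> S = insert x X" using S by auto
      finally have "(\<Sum>y\<in>insert x (X - S). F (a \<circ> b \<circ> transpose i y)) +
          (\<Sum>c\<in>insert x S. F (transpose i c \<circ> (a \<circ> b))) = F' (a \<circ> b)"
        by (simp only: F'_def)
      then have e: "F' (a \<circ> b) = (\<Sum>y\<in>insert x (X - S). F (a \<circ> (b \<circ> transpose i y))) +
          (\<Sum>c\<in>insert x S. F (transpose i c \<circ> (a \<circ> b)))"
        by (simp only: comp_assoc)
      have aux: "s * f + s * g - (s * f - s * h) = s * (g + h)" for s f g h :: complex
        by (simp add: algebra_simps)
      show "of_int (sign a) * F (a \<circ> b) + (\<Sum>y\<in>insert x (X - S). of_int (sign a) * F (a \<circ> (b \<circ> transpose i y))) -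
         (of_int (sign a) * F (a \<circ> b) - (\<Sum>c\<in>insert x S. of_int (sign a) * F (transpose i c \<circ> (a \<circ> b)))) =
         of_int (sign a) * F' (a \<circ> b)"
        unfolding sum_distrib_left [symmetric] e aux ..
    qed
  qed
  have "(\<Sum>S\<in>Pow (insert i X). (-1) ^ card S * ?H (insert i X) F S) =
      (\<Sum>S\<in>Pow X. (-1) ^ card S * ?H (insert i X) F S) +
      (\<Sum>S\<in>Pow X. (-1) ^ card (insert i S) * ?H (insert i X) F (insert i S))"
  proof -
    have "inj_on (insert i) (Pow X)" using insert.hyps by (auto simp: inj_on_def)
    then have "(\<Sum>S\<in>insert i ` Pow X. (-1) ^ card S * ?H (insert i X) F S) =
        (\<Sum>S\<in>Pow X. (-1) ^ card (insert i S) * ?H (insert i X) F (insert i S))"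
      by (simp add: sum.reindex)
    moreover have "Pow X \<inter> insert i ` Pow X = {}" using insert.hyps by auto
    ultimately show ?thesis
      unfolding Pow_insert using insert.hyps by (subst sum.union_disjoint) auto
  qed
  also have "\<dots> = (\<Sum>S\<in>Pow X. (-1) ^ card S * (?H (insert i X) F S - ?H (insert i X) F (insert i S)))"
    unfolding sum.distrib [symmetric]
  proof (rule sum.cong [OF refl])
    fix S assume "S \<in> Pow X"
    then have "card (insert i S) = Suc (card S)"
      using insert.hyps finite_subset by (subst card_insert_disjoint) auto
    then show "(-1) ^ card S * ?H (insert i X) F S + (-1) ^ card (insert i S) * ?H (insert i X) F (insert i S) =
        (-1) ^ card S * (?H (insert i X) F S - ?H (insert i X) F (insert i S))"
      by (simp add: algebra_simps)
  qed
  also have "\<dots> = (\<Sum>S\<in>Pow X. (-1) ^ card S * ?H X F' S)"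
    using step by (intro sum.cong refl) simp
  also have "\<dots> = fact (card X + 1) * F' w'"
  proof (rule insert.IH [OF xX w'(2)])
    fix g \<sigma> assume g: "g permutes X" and \<sigma>: "\<sigma> permutes insert x X"
    have g': "g permutes insert i X" using g by (rule permutes_subset) auto
    have gx: "g permutes insert x X" using g by (rule permutes_subset) auto
    have gi: "g i = i" "g x = x" using g insert.hyps xX by (auto simp: permutes_not_in)
    have conj: "g \<circ> transpose i (inv g y) = transpose i y \<circ> g" for y
      using bij_transpose_comp [OF permutes_bij [OF g], of i "inv g y"] gi permutes_inverses [OF g] by simp
    have conj': "inv g \<circ> transpose i y = transpose i (inv g y) \<circ> inv g" for y
    proof -
      have "inv g \<circ> transpose i y = inv g \<circ> (transpose i y \<circ> g) \<circ> inv g"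
        by (simp add: comp_assoc permutes_inv_o [OF g])
      also have "\<dots> = (inv g \<circ> g) \<circ> transpose i (inv g y) \<circ> inv g"
        by (simp only: conj [symmetric] comp_assoc)
      finally show ?thesis by (simp add: permutes_inv_o [OF g])
    qed
    have 1: "F (g \<circ> \<sigma> \<circ> inv g \<circ> transpose i y) = F (\<sigma> \<circ> transpose i (inv g y))" if "y \<in> insert x X" for y
    proof -
      have "g \<circ> \<sigma> \<circ> inv g \<circ> transpose i y = g \<circ> (\<sigma> \<circ> transpose i (inv g y)) \<circ> inv g"
        by (simp only: comp_assoc conj')
      moreover have "inv g y \<in> insert x X"
        using that permutes_in_image [OF permutes_inv [OF gx], of y] by simp
      then have "F (g \<circ> (\<sigma> \<circ> transpose i (inv g y)) \<circ> inv g) = F (\<sigma> \<circ> transpose i (inv g y))"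
        by (intro insert.prems(3) g' perm_t \<sigma>)
      ultimately show ?thesis by (simp only:)
    qed
    have "(\<Sum>y\<in>insert x X. F (g \<circ> \<sigma> \<circ> inv g \<circ> transpose i y)) =
        (\<Sum>y\<in>insert x X. F (\<sigma> \<circ> transpose i (inv g y)))"
      by (intro sum.cong refl 1)
    also have "\<dots> = (\<Sum>y\<in>insert x X. F (\<sigma> \<circ> transpose i y))"
      using sum.permute [OF permutes_inv [OF gx], of "\<lambda>y. F (\<sigma> \<circ> transpose i y)"] by (simp add: comp_def)
    finally have A: "(\<Sum>y\<in>insert x X. F (g \<circ> \<sigma> \<circ> inv g \<circ> transpose i y)) =
      (\<Sum>y\<in>insert x X. F (\<sigma> \<circ> transpose i y))" .
    have "inv g x = x" using gi(2) permutes_inverses [OF g] by metis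
    then have "transpose i x \<circ> g = g \<circ> transpose i x" using conj [of x] by simp
    then have "transpose i x \<circ> (g \<circ> \<sigma> \<circ> inv g) = g \<circ> (transpose i x \<circ> \<sigma>) \<circ> inv g"
      by (metis comp_assoc)
    moreover have "transpose i x \<circ> \<sigma> permutes insert x (insert i X)"
      by (intro permutes_compose permutes_swap_id permutes_subset [OF \<sigma>]) auto
    ultimately have B: "F (transpose i x \<circ> (g \<circ> \<sigma> \<circ> inv g)) = F (transpose i x \<circ> \<sigma>)"
      using insert.prems(3) [OF g', of "transpose i x \<circ> \<sigma>"] by (simp only:)
    show "F' (g \<circ> \<sigma> \<circ> inv g) = F' \<sigma>"
      unfolding F'_def A B ..
  qed
  \<comment> \<open>The card X + 1 transpositions on the right and the one on the left all give
    \<open>F w\<close>; their number card X + 2 continues the factorial.\<close>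
  also have "F' w' = of_nat (card X + 2) * F w"
  proof -
    have all: "F (w' \<circ> transpose i y) = F w" if "y \<in> insert x X" for y
    proof -
      have "F (w' \<circ> transpose i y) = F (w' \<circ> transpose i x)"
        by (rule full_cycle_insert_invariant [OF w'(2) ix(2) that]) (rule insert.prems(3))
      also have "\<dots> = F (w' \<circ> transpose i b)"
        by (rule full_cycle_insert_invariant [OF w'(2) ix(2) w'(1), symmetric]) (rule insert.prems(3))
      finally show ?thesis unfolding w'(3) .
    qed
    have "w' i = i" using w'p ix by (simp add: permutes_not_in)
    then have "transpose i x \<circ> w' = w' \<circ> transpose i (inv w' x)"
      using bij_transpose_comp [OF permutes_bij [OF w'p], of i "inv w' x"] permutes_inverses [OF w'p] by simp
    moreover have "inv w' x \<in> insert x X"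
      using permutes_in_image [OF permutes_inv [OF w'p], of x] by simp
    ultimately have "F (transpose i x \<circ> w') = F w" using all by (simp only:)
    then show ?thesis
      using insert.hyps xX by (simp add: F'_def all distrib_right del: sum.insert)
  qed
  finally show ?case
    using insert.hyps by (simp add: mult_ac)
qed



section \<open>Factorizations of a cycle weighted by colourings\<close>

text \<open>The factors of w are \<sigma> and \<open>inv \<sigma> \<circ> w\<close>. For
  permutations of k points, sign and colourings of the second combine to (-1)^k times a power of -q,
  so this is the factorization formula for the character polynomial.\<close>

definition factsum :: "nat \<Rightarrow> nat \<Rightarrow> 'a set \<Rightarrow> ('a \<Rightarrow> 'a) \<Rightarrow> complex"
  where "factsum p q K w = (\<Sum>\<sigma> | \<sigma> permutes K. of_nat (colourings p K \<sigma>) *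
    (of_int (sign (inv \<sigma> \<circ> w)) * of_nat (colourings q K (inv \<sigma> \<circ> w))))"

lemma colourings_conj:
  assumes "g permutes K" "\<sigma> permutes K"
  shows "colourings q K (g \<circ> \<sigma> \<circ> inv g) = colourings q K \<sigma>"
proof -
  have ext: "r \<circ> h \<in> K \<rightarrow>\<^sub>E {..<q}" if "r \<in> K \<rightarrow>\<^sub>E {..<q}" "h permutes K" for r h
    using that permutes_in_image [OF that(2)] permutes_not_in [OF that(2)]
    by (auto simp: PiE_def extensional_def Pi_def)
  have gK: "g x \<in> K \<longleftrightarrow> x \<in> K" "inv g x \<in> K \<longleftrightarrow> x \<in> K" for x
    using assms permutes_in_image permutes_inv by metis+
  have gi: "g (inv g x) = x" "inv g (g x) = x" for x
    using permutes_inverses [OF assms(1)] by auto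
  have "bij_betw (\<lambda>r. r \<circ> g) {r \<in> K \<rightarrow>\<^sub>E {..<q}. \<forall>x\<in>K. r ((g \<circ> \<sigma> \<circ> inv g) x) = r x}
      {r \<in> K \<rightarrow>\<^sub>E {..<q}. \<forall>x\<in>K. r (\<sigma> x) = r x}"
  proof (rule bij_betw_byWitness [where f' = "\<lambda>r. r \<circ> inv g"])
    show "(\<lambda>r. r \<circ> g) ` {r \<in> K \<rightarrow>\<^sub>E {..<q}. \<forall>x\<in>K. r ((g \<circ> \<sigma> \<circ> inv g) x) = r x}
        \<subseteq> {r \<in> K \<rightarrow>\<^sub>E {..<q}. \<forall>x\<in>K. r (\<sigma> x) = r x}"
    proof (rule image_subsetI)
      fix r assume r: "r \<in> {r \<in> K \<rightarrow>\<^sub>E {..<q}. \<forall>x\<in>K. r ((g \<circ> \<sigma> \<circ> inv g) x) = r x}"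
      then have "r (g (\<sigma> x)) = r (g x)" if "x \<in> K" for x
        using that gK(1) [of x] by (auto simp: gi dest!: bspec [of _ _ "g x"])
      with r ext [OF _ assms(1)] show "r \<circ> g \<in> {r \<in> K \<rightarrow>\<^sub>E {..<q}. \<forall>x\<in>K. r (\<sigma> x) = r x}" by auto
    qed
    show "(\<lambda>r. r \<circ> inv g) ` {r \<in> K \<rightarrow>\<^sub>E {..<q}. \<forall>x\<in>K. r (\<sigma> x) = r x} \<subseteq>
        {r \<in> K \<rightarrow>\<^sub>E {..<q}. \<forall>x\<in>K. r ((g \<circ> \<sigma> \<circ> inv g) x) = r x}"
      using ext [OF _ permutes_inv [OF assms(1)]] gK by (auto simp: gi)
  qed (auto simp: fun_eq_iff gi)
  then show ?thesis
    unfolding colourings_def by (rule bij_betw_same_card)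
qed

lemma sum_permutes_conj:
  assumes "g permutes K"
  shows "(\<Sum>\<sigma> | \<sigma> permutes K. f \<sigma>) = (\<Sum>\<sigma> | \<sigma> permutes K. f (g \<circ> \<sigma> \<circ> inv g))"
proof -
  have "(\<Sum>\<sigma> | \<sigma> permutes K. f \<sigma>) = (\<Sum>\<sigma> | \<sigma> permutes K. f (\<sigma> \<circ> inv g))"
    by (rule sum_permutations_compose_right [OF permutes_inv [OF assms]])
  also have "\<dots> = (\<Sum>\<sigma> | \<sigma> permutes K. f (g \<circ> \<sigma> \<circ> inv g))"
    by (rule setum_permutations_compose_left [OF assms])
  finally show ?thesis .
qed

lemma sign_conj:
  assumes "finite K" "g permutes K" "\<sigma> permutes K"
  shows "sign (g \<circ> \<sigma> \<circ> inv g) = sign \<sigma>"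
proof -
  have "sign (g \<circ> \<sigma> \<circ> inv g) = sign g * sign \<sigma> * sign (inv g)"
    using assms by (simp add: sign_permutes_compose [OF assms(1,1)] permutes_compose permutes_inv)
  also have "sign (inv g) = sign g"
    using assms by (intro sign_inverse permutes_imp_permutation)
  also have "sign g * sign \<sigma> * sign g = sign \<sigma>"
    by (metis mult.assoc mult.commute mult_1 sign_idempotent)
  finally show ?thesis .
qed

lemma factsum_conj:
  assumes "finite K" "g permutes K" "w permutes K"
  shows "factsum p q K (g \<circ> w \<circ> inv g) = factsum p q K w"
proof -
  have "factsum p q K (g \<circ> w \<circ> inv g) = (\<Sum>\<sigma> | \<sigma> permutes K. of_nat (colourings p K (g \<circ> \<sigma> \<circ> inv g)) *
    (of_int (sign (inv (g \<circ> \<sigma> \<circ> inv g) \<circ> (g \<circ> w \<circ> inv g))) *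
     of_nat (colourings q K (inv (g \<circ> \<sigma> \<circ> inv g) \<circ> (g \<circ> w \<circ> inv g)))))"
    unfolding factsum_def by (rule sum_permutes_conj [OF assms(2)])
  also have "\<dots> = factsum p q K w"
    unfolding factsum_def
  proof (rule sum.cong [OF refl])
    fix \<sigma> assume "\<sigma> \<in> {\<sigma>. \<sigma> permutes K}"
    then have \<sigma>: "\<sigma> permutes K" by simp
    have b: "bij g" "bij \<sigma>" using assms \<sigma> by (auto intro: permutes_bij)
    have "inv (g \<circ> \<sigma> \<circ> inv g) = g \<circ> inv \<sigma> \<circ> inv g"
      using b by (simp add: o_inv_distrib bij_comp bij_imp_bij_inv inv_inv_eq comp_assoc)
    then have "inv (g \<circ> \<sigma> \<circ> inv g) \<circ> (g \<circ> w \<circ> inv g) = g \<circ> inv \<sigma> \<circ> (inv g \<circ> g) \<circ> w \<circ> inv g"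
      by (simp add: comp_assoc)
    then have e: "inv (g \<circ> \<sigma> \<circ> inv g) \<circ> (g \<circ> w \<circ> inv g) = g \<circ> (inv \<sigma> \<circ> w) \<circ> inv g"
      by (simp add: permutes_inv_o [OF assms(2)] comp_assoc)
    have "inv \<sigma> \<circ> w permutes K" using \<sigma> assms by (intro permutes_compose permutes_inv)
    then show "of_nat (colourings p K (g \<circ> \<sigma> \<circ> inv g)) *
      (of_int (sign (inv (g \<circ> \<sigma> \<circ> inv g) \<circ> (g \<circ> w \<circ> inv g))) *
       of_nat (colourings q K (inv (g \<circ> \<sigma> \<circ> inv g) \<circ> (g \<circ> w \<circ> inv g)))) =
      of_nat (colourings p K \<sigma>) *
       (complex_of_int (sign (inv \<sigma> \<circ> w)) * of_nat (colourings q K (inv \<sigma> \<circ> w)))"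
      unfolding e by (simp only: colourings_conj [OF assms(2)] sign_conj [OF assms(1,2)] \<sigma>)
  qed
  finally show ?thesis .
qed

text \<open>Once \<tau> is written as a product \<sigma> \<rho>, the two weights separate and the
  symmetrizer absorbs one after the other: the sum over \<sigma> gives the eigenvalue in p, that
  over \<rho> the one in q, and the coefficient at \<open>id\<close> is 1.\<close>

lemma factsum_hooksym:
  assumes "finite K" "x \<in> K" "S \<subseteq> K - {x}"
  shows "(\<Sum>a | a permutes insert x S. \<Sum>b | b permutes insert x (K - {x} - S).
      of_int (sign a) * factsum p q K (a \<circ> b)) =
    falling (of_nat p + of_nat (card K - 1 - card S)) (card K) * falling (of_nat q + of_nat (card S)) (card K)"
proof -
  define A where "A = insert x S"
  define B where "B = insert x (K - {x} - S)"
  let ?\<alpha> = "\<lambda>\<sigma>. of_nat (colourings p K \<sigma>) :: complex"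
  let ?\<beta> = "\<lambda>\<sigma>. of_int (sign \<sigma>) * of_nat (colourings q K \<sigma>) :: complex"
  have fin: "finite A" "finite B" "finite S" using assms finite_subset by (auto simp: A_def B_def)
  have K: "A \<union> B = K" and BA: "B - A = K - {x} - S" and AB: "A \<inter> B = {x}" and x: "x \<in> A" "x \<in> B"
    using assms by (auto simp: A_def B_def)
  have "card (K - {x} - S) = card (K - {x}) - card S"
    using assms fin by (intro card_Diff_subset) auto
  then have cBA: "card (B - A) = card K - 1 - card S"
    using assms unfolding BA by simp
  have "x \<notin> S" using assms by auto
  then have cA: "card A = card S + 1"
    using fin by (simp add: A_def)
  have sub: "A \<subseteq> K" "B \<subseteq> K" using K by auto
  \<comment> \<open>A summation over \<tau> is inserted to collect the pairs with
    \<open>a \<circ> b = \<tau>\<close> into \<open>hooksym\<close>.\<close>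
  have "(\<Sum>a | a permutes A. \<Sum>b | b permutes B. of_int (sign a) * factsum p q K (a \<circ> b)) =
    (\<Sum>a | a permutes A. \<Sum>b | b permutes B. \<Sum>\<tau> | \<tau> permutes K.
      (if a \<circ> b = \<tau> then of_int (sign a) else 0) * factsum p q K \<tau>)"
  proof (intro sum.cong refl)
    fix a b assume "a \<in> {a. a permutes A}" "b \<in> {b. b permutes B}"
    then have ab: "a \<circ> b permutes K"
      using sub by (intro permutes_compose) (auto elim!: permutes_subset)
    have "(\<Sum>\<tau> | \<tau> permutes K. (if a \<circ> b = \<tau> then of_int (sign a) else 0) * factsum p q K \<tau>) =
        (\<Sum>\<tau> | \<tau> permutes K. if a \<circ> b = \<tau> then of_int (sign a) * factsum p q K \<tau> else 0)"
      by (intro sum.cong refl) auto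
    also have "\<dots> = of_int (sign a) * factsum p q K (a \<circ> b)"
      using ab assms(1) by (subst sum.delta') (auto simp: finite_permutations)
    finally show "of_int (sign a) * factsum p q K (a \<circ> b) =
      (\<Sum>\<tau> | \<tau> permutes K. (if a \<circ> b = \<tau> then of_int (sign a) else 0) * factsum p q K \<tau>)" ..
  qed
  also have "\<dots> = (\<Sum>a | a permutes A. \<Sum>\<tau> | \<tau> permutes K. \<Sum>b | b permutes B.
      (if a \<circ> b = \<tau> then of_int (sign a) else 0) * factsum p q K \<tau>)"
    by (intro sum.cong refl sum.swap)
  also have "\<dots> = (\<Sum>\<tau> | \<tau> permutes K. \<Sum>a | a permutes A. \<Sum>b | b permutes B.
      (if a \<circ> b = \<tau> then of_int (sign a) else 0) * factsum p q K \<tau>)"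
    by (rule sum.swap)
  also have "\<dots> = (\<Sum>\<tau> | \<tau> permutes K. hooksym A B \<tau> * factsum p q K \<tau>)"
    unfolding hooksym_def sum_distrib_right ..
  also have "\<dots> = (\<Sum>\<tau> | \<tau> permutes K. \<Sum>\<sigma> | \<sigma> permutes K. ?\<alpha> \<sigma> * (?\<beta> (inv \<sigma> \<circ> \<tau>) * hooksym A B \<tau>))"
    unfolding factsum_def sum_distrib_left by (intro sum.cong refl) (simp only: mult_ac)
  also have "\<dots> = (\<Sum>\<sigma> | \<sigma> permutes K. \<Sum>\<tau> | \<tau> permutes K. ?\<alpha> \<sigma> * (?\<beta> (inv \<sigma> \<circ> \<tau>) * hooksym A B \<tau>))"
    by (rule sum.swap)
  also have "\<dots> = (\<Sum>\<sigma> | \<sigma> permutes K. \<Sum>\<rho> | \<rho> permutes K. ?\<alpha> \<sigma> * (?\<beta> \<rho> * hooksym A B (\<sigma> \<circ> \<rho>)))"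
  proof (rule sum.cong [OF refl])
    fix \<sigma> assume "\<sigma> \<in> {\<sigma>. \<sigma> permutes K}"
    then have \<sigma>: "\<sigma> permutes K" by simp
    have e: "inv \<sigma> \<circ> (\<sigma> \<circ> \<rho>) = \<rho>" for \<rho>
      by (simp only: comp_assoc [symmetric] permutes_inv_o(2) [OF \<sigma>] id_comp)
    show "(\<Sum>\<tau> | \<tau> permutes K. ?\<alpha> \<sigma> * (?\<beta> (inv \<sigma> \<circ> \<tau>) * hooksym A B \<tau>)) =
        (\<Sum>\<rho> | \<rho> permutes K. ?\<alpha> \<sigma> * (?\<beta> \<rho> * hooksym A B (\<sigma> \<circ> \<rho>)))"
      by (subst setum_permutations_compose_left [OF \<sigma>]) (simp only: e)
  qed
  also have "\<dots> = (\<Sum>\<rho> | \<rho> permutes K. \<Sum>\<sigma> | \<sigma> permutes K. ?\<alpha> \<sigma> * (?\<beta> \<rho> * hooksym A B (\<sigma> \<circ> \<rho>)))"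
    by (rule sum.swap)
  also have "\<dots> = (\<Sum>\<rho> | \<rho> permutes K. ?\<beta> \<rho> * (\<Sum>\<sigma> | \<sigma> permutes K. ?\<alpha> \<sigma> * hooksym A B (\<sigma> \<circ> \<rho>)))"
    unfolding sum_distrib_left by (intro sum.cong refl) (simp only: mult_ac)
  also have "\<dots> = (\<Sum>\<rho> | \<rho> permutes K. ?\<beta> \<rho> *
      (falling (of_nat p + of_nat (card (B - A))) (card K) * hooksym A B \<rho>))"
    using sum_colourings_hooksym [OF fin(1) x fin(2), of p] unfolding K by (simp only:)
  also have "\<dots> = falling (of_nat p + of_nat (card (B - A))) (card K) *
      (\<Sum>\<rho> | \<rho> permutes K. ?\<beta> \<rho> * hooksym A B (\<rho> \<circ> id))"
    unfolding sum_distrib_left comp_id by (intro sum.cong refl) (simp only: mult_ac)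
  also have "(\<Sum>\<rho> | \<rho> permutes K. ?\<beta> \<rho> * hooksym A B (\<rho> \<circ> id)) =
      falling (of_nat q - 1 + of_nat (card A)) (card K) * hooksym A B id"
    using sum_sign_colourings_hooksym [OF fin(1) x fin(2), of q id] unfolding K .
  also have "hooksym A B id = 1" by (rule hooksym_id [OF fin(1,2) AB])
  also have "of_nat q - 1 + of_nat (card A) = (of_nat q + of_nat (card S) :: complex)"
    by (simp add: cA)
  finally show ?thesis
    unfolding A_def [symmetric] B_def [symmetric] cBA by (simp only: mult_1_right)
qed

lemma sum_Pow_card:
  fixes f :: "nat \<Rightarrow> complex"
  assumes "finite X"
  shows "(\<Sum>S\<in>Pow X. f (card S)) = (\<Sum>m\<le>card X. of_nat (card X choose m) * f m)"
proof -
  have "(\<Sum>S\<in>Pow X. f (card S)) = (\<Sum>m\<le>card X. \<Sum>S\<in>{S \<in> Pow X. card S = m}. f (card S))"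
    using assms by (subst sum.group) (auto intro: card_mono)
  also have "\<dots> = (\<Sum>m\<le>card X. of_nat (card X choose m) * f m)"
    using n_subsets [OF assms] by (intro sum.cong refl) simp
  finally show ?thesis .
qed

text \<open>S runs through the legs of hooks with corner x on the points of K. Only its size m
  enters the eigenvalues, and a binomial coefficient counts the legs of that size.\<close>

lemma factsum_full_cycle:
  assumes "finite K" "full_cycle K w"
  shows "fact (card K) * factsum p q K w =
    (\<Sum>m\<le>card K - 1. of_nat (card K - 1 choose m) * ((-1) ^ m *
      falling (of_nat p + of_nat (card K - 1 - m)) (card K) * falling (of_nat q + of_nat m) (card K)))"
proof -
  obtain x where x: "x \<in> K" using assms by (auto simp: full_cycle_def)
  define X where "X = K - {x}"
  have K: "insert x X = K" "x \<notin> X" "finite X" using x assms by (auto simp: X_def)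
  have cX: "card X = card K - 1" "card X + 1 = card K"
    using K card_insert_disjoint [OF K(3,2)] by auto
  have "fact (card X + 1) * factsum p q K w =
      (\<Sum>S\<in>Pow X. (-1) ^ card S * (\<Sum>a | a permutes insert x S. \<Sum>b | b permutes insert x (X - S).
        of_int (sign a) * factsum p q K (a \<circ> b)))"
  proof (rule class_sum_hooks [symmetric])
    fix g \<sigma> assume "g permutes X" "\<sigma> permutes insert x X"
    then show "factsum p q K (g \<circ> \<sigma> \<circ> inv g) = factsum p q K \<sigma>"
      using K(1) by (intro factsum_conj assms(1)) (auto elim!: permutes_subset)
  qed (use K assms in auto)
  also have "\<dots> = (\<Sum>S\<in>Pow X. (-1) ^ card S *
     (falling (of_nat p + of_nat (card K - 1 - card S)) (card K) * falling (of_nat q + of_nat (card S)) (card K)))"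
    unfolding X_def by (intro sum.cong refl arg_cong2 [of _ _ _ _ "(*)"] factsum_hooksym assms x) auto
  also have "\<dots> = (\<Sum>m\<le>card X. of_nat (card X choose m) * ((-1) ^ m *
     (falling (of_nat p + of_nat (card K - 1 - m)) (card K) * falling (of_nat q + of_nat m) (card K))))"
    by (rule sum_Pow_card [OF K(3)])
  finally show ?thesis
    unfolding cX(2) unfolding cX(1) by (simp only: mult.assoc)
qed


section \<open>Placements of a cycle in a rectangle\<close>

definition placesum :: "'a set \<Rightarrow> ('a \<Rightarrow> 'a) \<Rightarrow> ('a \<Rightarrow> nat \<times> nat) \<Rightarrow> complex"
  where "placesum K w f = (\<Sum>\<sigma> | \<sigma> permutes K.
    if (\<forall>x\<in>K. fst (f (\<sigma> x)) = fst (f x)) \<and> (\<forall>x\<in>K. snd (f ((inv \<sigma> \<circ> w) x)) = snd (f x))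
    then of_int (sign (inv \<sigma> \<circ> w)) else 0)"

lemma card_colourings_pair:
  assumes "\<sigma> permutes K" "\<tau> permutes K"
  shows "card {f \<in> K \<rightarrow>\<^sub>E {..<p} \<times> {..<q}. (\<forall>x\<in>K. fst (f (\<sigma> x)) = fst (f x)) \<and>
      (\<forall>x\<in>K. snd (f (\<tau> x)) = snd (f x))} = colourings p K \<sigma> * colourings q K \<tau>"
proof -
  have in_K: "\<sigma> x \<in> K" "\<tau> x \<in> K" if "x \<in> K" for x
    using assms that permutes_in_image by metis+
  have "bij_betw (\<lambda>f. (restrict (fst \<circ> f) K, restrict (snd \<circ> f) K))
    {f \<in> K \<rightarrow>\<^sub>E {..<p} \<times> {..<q}. (\<forall>x\<in>K. fst (f (\<sigma> x)) = fst (f x)) \<and> (\<forall>x\<in>K. snd (f (\<tau> x)) = snd (f x))}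
    ({r \<in> K \<rightarrow>\<^sub>E {..<p}. \<forall>x\<in>K. r (\<sigma> x) = r x} \<times> {r \<in> K \<rightarrow>\<^sub>E {..<q}. \<forall>x\<in>K. r (\<tau> x) = r x})"
  proof (rule bij_betw_byWitness [where f' = "\<lambda>(r, s). restrict (\<lambda>x. (r x, s x)) K"], goal_cases)
    case 1
    show ?case by (auto simp: fun_eq_iff PiE_def extensional_def)
  next
    case 2
    show ?case by (auto simp: fun_eq_iff PiE_def extensional_def)
  next
    case 3
    show ?case by (auto simp: in_K PiE_def Pi_def mem_Times_iff)
  next
    case 4
    show ?case by (auto simp: in_K PiE_def Pi_def)
  qed
  then show ?thesis
    unfolding colourings_def card_cartesian_product [symmetric] by (rule bij_betw_same_card)
qed

lemma sum_placesum:
  assumes "finite K" "w permutes K"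
  shows "(\<Sum>f\<in>K \<rightarrow>\<^sub>E {..<p} \<times> {..<q}. placesum K w f) = factsum p q K w"
proof -
  have fin: "finite (K \<rightarrow>\<^sub>E {..<p} \<times> {..<q})" using assms by (intro finite_PiE) auto
  have "(\<Sum>f\<in>K \<rightarrow>\<^sub>E {..<p} \<times> {..<q}. placesum K w f) =
    (\<Sum>\<sigma> | \<sigma> permutes K. \<Sum>f\<in>K \<rightarrow>\<^sub>E {..<p} \<times> {..<q}.
      if (\<forall>x\<in>K. fst (f (\<sigma> x)) = fst (f x)) \<and> (\<forall>x\<in>K. snd (f ((inv \<sigma> \<circ> w) x)) = snd (f x))
      then of_int (sign (inv \<sigma> \<circ> w)) else 0)"
    unfolding placesum_def by (rule sum.swap)
  also have "\<dots> = factsum p q K w"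
    unfolding factsum_def
  proof (rule sum.cong [OF refl])
    fix \<sigma> assume "\<sigma> \<in> {\<sigma>. \<sigma> permutes K}"
    then have \<sigma>: "\<sigma> permutes K" by simp
    then have \<tau>: "inv \<sigma> \<circ> w permutes K" using assms by (intro permutes_compose permutes_inv)
    show "(\<Sum>f\<in>K \<rightarrow>\<^sub>E {..<p} \<times> {..<q}.
      if (\<forall>x\<in>K. fst (f (\<sigma> x)) = fst (f x)) \<and> (\<forall>x\<in>K. snd (f ((inv \<sigma> \<circ> w) x)) = snd (f x))
      then of_int (sign (inv \<sigma> \<circ> w)) else 0) = of_nat (colourings p K \<sigma>) *
        (complex_of_int (sign (inv \<sigma> \<circ> w)) * of_nat (colourings q K (inv \<sigma> \<circ> w)))"
      unfolding sum.inter_filter [OF fin, symmetric] sum_constant card_colourings_pair [OF \<sigma> \<tau>]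
      by (simp only: of_nat_mult mult_ac)
  qed
  finally show ?thesis .
qed

text \<open>Let t exchange two points placed in the same box. Replacing \<sigma> by
  \<open>\<sigma> \<circ> t\<close> changes neither condition, as f is blind to t, but reverses the
  sign.\<close>

lemma placesum_not_inj:
  assumes "finite K" "w permutes K" "\<not> inj_on f K"
  shows "placesum K w f = 0"
proof -
  obtain x y where xy: "x \<in> K" "y \<in> K" "x \<noteq> y" "f x = f y"
    using assms(3) by (auto simp: inj_on_def)
  define t where "t = transpose x y"
  have t: "t permutes K" "t \<circ> t = id" "\<And>z. t (t z) = z" "sign t = - 1"
    using xy by (auto simp: t_def sign_swap_id intro: permutes_swap_id)
  have ft: "f (t z) = f z" for z
    using xy by (simp add: t_def transpose_def)
  have tK: "t z \<in> K \<longleftrightarrow> z \<in> K" for z using permutes_in_image [OF t(1)] .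
  have "placesum K w f = (\<Sum>\<sigma> | \<sigma> permutes K.
    if (\<forall>x\<in>K. fst (f ((\<sigma> \<circ> t) x)) = fst (f x)) \<and> (\<forall>x\<in>K. snd (f ((inv (\<sigma> \<circ> t) \<circ> w) x)) = snd (f x))
    then of_int (sign (inv (\<sigma> \<circ> t) \<circ> w)) else 0)"
    unfolding placesum_def by (rule sum_permutations_compose_right [OF t(1)])
  also have "\<dots> = (\<Sum>\<sigma> | \<sigma> permutes K.
    - (if (\<forall>x\<in>K. fst (f (\<sigma> x)) = fst (f x)) \<and> (\<forall>x\<in>K. snd (f ((inv \<sigma> \<circ> w) x)) = snd (f x))
    then of_int (sign (inv \<sigma> \<circ> w)) else 0))"
  proof (rule sum.cong [OF refl])
    fix \<sigma> assume "\<sigma> \<in> {\<sigma>. \<sigma> permutes K}"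
    then have \<sigma>: "\<sigma> permutes K" by simp
    have "inv t = t" by (simp add: t_def)
    then have inv: "inv (\<sigma> \<circ> t) \<circ> w = t \<circ> (inv \<sigma> \<circ> w)"
      using permutes_bij [OF \<sigma>] permutes_bij [OF t(1)] by (simp add: o_inv_distrib comp_assoc)
    have "inv \<sigma> \<circ> w permutes K" using \<sigma> assms by (intro permutes_compose permutes_inv)
    then have sgn: "sign (inv (\<sigma> \<circ> t) \<circ> w) = - sign (inv \<sigma> \<circ> w)"
      unfolding inv using t assms(1) by (simp add: sign_permutes_compose [OF assms(1,1) t(1)])
    have c1: "(\<forall>x\<in>K. fst (f ((\<sigma> \<circ> t) x)) = fst (f x)) \<longleftrightarrow> (\<forall>x\<in>K. fst (f (\<sigma> x)) = fst (f x))"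
    proof
      assume *: "\<forall>x\<in>K. fst (f ((\<sigma> \<circ> t) x)) = fst (f x)"
      show "\<forall>x\<in>K. fst (f (\<sigma> x)) = fst (f x)"
      proof
        fix x assume "x \<in> K"
        then show "fst (f (\<sigma> x)) = fst (f x)" using *[rule_format, of "t x"] by (simp add: tK t ft)
      qed
    next
      assume *: "\<forall>x\<in>K. fst (f (\<sigma> x)) = fst (f x)"
      show "\<forall>x\<in>K. fst (f ((\<sigma> \<circ> t) x)) = fst (f x)"
      proof
        fix x assume "x \<in> K"
        then show "fst (f ((\<sigma> \<circ> t) x)) = fst (f x)" using *[rule_format, of "t x"] by (simp add: tK t ft)
      qed
    qed
    have c2: "(\<forall>x\<in>K. snd (f ((inv (\<sigma> \<circ> t) \<circ> w) x)) = snd (f x)) \<longleftrightarrow>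
        (\<forall>x\<in>K. snd (f ((inv \<sigma> \<circ> w) x)) = snd (f x))"
      unfolding inv by (simp add: ft)
    show "(if (\<forall>x\<in>K. fst (f ((\<sigma> \<circ> t) x)) = fst (f x)) \<and> (\<forall>x\<in>K. snd (f ((inv (\<sigma> \<circ> t) \<circ> w) x)) = snd (f x))
      then complex_of_int (sign (inv (\<sigma> \<circ> t) \<circ> w)) else 0) =
      - (if (\<forall>x\<in>K. fst (f (\<sigma> x)) = fst (f x)) \<and> (\<forall>x\<in>K. snd (f ((inv \<sigma> \<circ> w) x)) = snd (f x))
      then of_int (sign (inv \<sigma> \<circ> w)) else 0)"
      unfolding c1 c2 sgn by simp
  qed
  also have "\<dots> = - placesum K w f"
    by (simp add: placesum_def sum_negf)
  finally show ?thesis by simp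
qed

lemma sum_placesum_inj:
  assumes "finite K" "w permutes K"
  shows "(\<Sum>f | f \<in> K \<rightarrow>\<^sub>E {..<p} \<times> {..<q} \<and> inj_on f K. placesum K w f) = factsum p q K w"
proof -
  have "finite (K \<rightarrow>\<^sub>E {..<p} \<times> {..<q})" using assms by (intro finite_PiE) auto
  then have "(\<Sum>f | f \<in> K \<rightarrow>\<^sub>E {..<p} \<times> {..<q} \<and> inj_on f K. placesum K w f) =
      (\<Sum>f\<in>K \<rightarrow>\<^sub>E {..<p} \<times> {..<q}. placesum K w f)"
    by (rule sum.mono_neutral_left) (use placesum_not_inj [OF assms] in auto)
  with sum_placesum [OF assms] show ?thesis by simp
qed

text \<open>The permutations inducing f form a left coset of the group of permutations of
  \<open>N - K\<close>.\<close>

lemma card_permutes_extending: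
  assumes "finite N" "K \<subseteq> N" "bij_betw bx N Z" "f \<in> K \<rightarrow>\<^sub>E Z" "inj_on f K"
  shows "card {g. g permutes N \<and> restrict (bx \<circ> g) K = f} = fact (card N - card K)"
proof -
  have finK: "finite K" using assms finite_subset by auto
  define f' where "f' = inv_into N bx \<circ> f"
  have fZ: "f x \<in> Z" if "x \<in> K" for x using assms that by auto
  have bxf': "bx (f' x) = f x" "f' x \<in> N" if "x \<in> K" for x
    using fZ [OF that] assms(3) by (auto simp: f'_def bij_betw_def f_inv_into_f inv_into_into)
  have "inj_on f' K"
    by (rule inj_onI) (metis assms(5) bxf'(1) inj_onD)
  then have card: "card (f' ` K) = card K" by (rule card_image)
  have "card (N - K) = card (N - f' ` K)"
    using assms finK bxf' card by (simp add: card_Diff_subset image_subset_iff)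
  then obtain h where h: "bij_betw h (N - K) (N - f' ` K)"
    using assms finite_same_card_bij by (metis finite_Diff)
  \<comment> \<open>One element of the coset: prescribed on K and completed by an arbitrary
    bijection of the complements.\<close>
  define g where "g x = (if x \<in> K then f' x else if x \<in> N then h x else x)" for x
  have gp: "g permutes N"
  proof (rule bij_imp_permutes)
    have "bij_betw g (K \<union> (N - K)) (f' ` K \<union> (N - f' ` K))"
    proof (rule bij_betw_combine)
      show "bij_betw g K (f' ` K)"
        using \<open>inj_on f' K\<close> by (subst bij_betw_cong [of K g f']) (auto simp: g_def bij_betw_def)
      show "bij_betw g (N - K) (N - f' ` K)"
        using h by (subst bij_betw_cong [of "N - K" g h]) (auto simp: g_def)
    qed auto
    moreover have "K \<union> (N - K) = N" "f' ` K \<union> (N - f' ` K) = N"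
      using assms bxf' by auto
    ultimately show "bij_betw g N N" by simp
  qed (use assms in \<open>auto simp: g_def\<close>)
  have gK: "bx (g x) = f x" if "x \<in> K" for x
    using that bxf' by (simp add: g_def)
  have "{g. g permutes N \<and> restrict (bx \<circ> g) K = f} = (\<lambda>h. g \<circ> h) ` {h. h permutes N - K}"
  proof (intro equalityI subsetI)
    fix g' assume "g' \<in> {g. g permutes N \<and> restrict (bx \<circ> g) K = f}"
    then have g': "g' permutes N" "restrict (bx \<circ> g') K = f" by auto
    have eq: "g' x = g x" if "x \<in> K" for x
    proof -
      have "bx (g' x) = f x" using g'(2) that by (auto simp: fun_eq_iff restrict_def split: if_splits)
      then have "bx (g' x) = bx (g x)" using gK that by simp
      moreover have "g' x \<in> N" "g x \<in> N" using that assms g'(1) gp by (auto simp: permutes_in_image)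
      ultimately show ?thesis using assms(3) by (auto simp: bij_betw_def dest: inj_onD)
    qed
    have "inv g \<circ> g' permutes N" using g' gp by (intro permutes_compose permutes_inv)
    then have "inv g \<circ> g' permutes N - K"
      by (rule permutes_superset) (use eq permutes_inverses [OF gp] in auto)
    moreover have "g' = g \<circ> (inv g \<circ> g')"
      by (simp only: comp_assoc [symmetric] permutes_inv_o [OF gp] id_comp)
    ultimately show "g' \<in> (\<lambda>h. g \<circ> h) ` {h. h permutes N - K}" by blast
  next
    fix g' assume "g' \<in> (\<lambda>h. g \<circ> h) ` {h. h permutes N - K}"
    then obtain h where h: "g' = g \<circ> h" "h permutes N - K" by auto
    have "g' permutes N"
      unfolding h(1) by (intro permutes_compose gp permutes_subset [OF h(2)]) auto
    moreover have "restrict (bx \<circ> g') K = f"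
    proof
      fix x show "restrict (bx \<circ> g') K x = f x"
        using h gK assms(4) permutes_not_in [OF h(2), of x] by (auto simp: PiE_def extensional_def)
    qed
    ultimately show "g' \<in> {g. g permutes N \<and> restrict (bx \<circ> g) K = f}" by simp
  qed
  moreover have "inj_on (\<lambda>h. g \<circ> h) {h. h permutes N - K}"
    by (rule inj_onI) (simp only: comp_left_cancel [OF gp])
  ultimately have "card {g. g permutes N \<and> restrict (bx \<circ> g) K = f} = card {h. h permutes N - K}"
    by (simp only: card_image)
  also have "\<dots> = fact (card N - card K)"
    using assms finK by (subst card_permutations [OF refl]) (auto simp: card_Diff_subset)
  finally show ?thesis .
qed

lemma sum_permutes_restrict:
  fixes \<phi> :: "('a \<Rightarrow> 'b) \<Rightarrow> complex"
  assumes "finite N" "K \<subseteq> N" "bij_betw bx N Z"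
  shows "(\<Sum>g | g permutes N. \<phi> (restrict (bx \<circ> g) K)) =
    fact (card N - card K) * (\<Sum>f | f \<in> K \<rightarrow>\<^sub>E Z \<and> inj_on f K. \<phi> f)"
proof -
  let ?I = "{f. f \<in> K \<rightarrow>\<^sub>E Z \<and> inj_on f K}"
  have "finite Z" using assms bij_betw_finite by auto
  then have finI: "finite ?I"
    using finite_subset [OF assms(2,1)] by (intro finite_subset [OF _ finite_PiE [of K "\<lambda>_. Z"]]) auto
  have rI: "restrict (bx \<circ> g) K \<in> ?I" if "g permutes N" for g
  proof -
    have gN: "g x \<in> N" if "x \<in> K" for x
      using that assms \<open>g permutes N\<close> by (auto simp: permutes_in_image)
    have "inj_on (bx \<circ> g) K"
    proof (rule comp_inj_on)
      show "inj_on g K" using \<open>g permutes N\<close> by (rule permutes_inj_on)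
      show "inj_on bx (g ` K)" using gN assms(3) by (auto simp: bij_betw_def intro: inj_on_subset)
    qed
    moreover have "bx (g x) \<in> Z" if "x \<in> K" for x
      using gN [OF that] assms(3) by (auto simp: bij_betw_def)
    ultimately show ?thesis by (auto simp: inj_on_def)
  qed
  have "(\<lambda>g. restrict (bx \<circ> g) K) ` {g. g permutes N} \<subseteq> ?I" using rI by blast
  then have "(\<Sum>g | g permutes N. \<phi> (restrict (bx \<circ> g) K)) =
      (\<Sum>f\<in>?I. \<Sum>g\<in>{g \<in> {g. g permutes N}. restrict (bx \<circ> g) K = f}. \<phi> (restrict (bx \<circ> g) K))"
    by (rule sum.group [OF finite_permutations [OF assms(1)] finI, symmetric])
  also have "\<dots> = (\<Sum>f\<in>?I. fact (card N - card K) * \<phi> f)"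
  proof (rule sum.cong [OF refl])
    fix f assume "f \<in> ?I"
    then have "card {g. g permutes N \<and> restrict (bx \<circ> g) K = f} = fact (card N - card K)"
      by (intro card_permutes_extending [OF assms]) auto
    moreover have "(\<Sum>g\<in>{g \<in> {g. g permutes N}. restrict (bx \<circ> g) K = f}. \<phi> (restrict (bx \<circ> g) K)) =
        (\<Sum>g\<in>{g. g permutes N \<and> restrict (bx \<circ> g) K = f}. \<phi> f)"
      by (intro sum.cong) auto
    ultimately show "(\<Sum>g\<in>{g \<in> {g. g permutes N}. restrict (bx \<circ> g) K = f}. \<phi> (restrict (bx \<circ> g) K)) =
        fact (card N - card K) * \<phi> f"
      by simp
  qed
  finally show ?thesis by (simp add: sum_distrib_left)
qed



section \<open>The group algebra\<close>

lemma finite_Sym: "finite (Sym n)"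
  by (simp add: Sym_def finite_permutations)

lemma card_Sym: "card (Sym n) = fact n"
  unfolding Sym_def by (rule card_permutations) auto

lemma Sym_comp: "u \<in> Sym n \<Longrightarrow> v \<in> Sym n \<Longrightarrow> u \<circ> v \<in> Sym n"
  by (simp add: Sym_def permutes_compose)

lemma Sym_inv: "u \<in> Sym n \<Longrightarrow> inv u \<in> Sym n"
  by (simp add: Sym_def permutes_inv)

lemma Sym_id: "id \<in> Sym n"
  by (simp add: Sym_def)

lemma Sym_inv_comp:
  assumes "u \<in> Sym n"
  shows "inv u \<circ> (u \<circ> x) = x" "u \<circ> (inv u \<circ> x) = x" "x \<circ> u \<circ> inv u = x" "x \<circ> inv u \<circ> u = x"
    "inv u \<circ> u = id" "u \<circ> inv u = id"
  using assms permutes_inv_o [of u "{..<n}"] unfolding Sym_def mem_Collect_eq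
  by (metis comp_assoc id_comp comp_id)+

lemma Sym_inv_distrib:
  "u \<in> Sym n \<Longrightarrow> v \<in> Sym n \<Longrightarrow> inv (u \<circ> v) = inv v \<circ> inv u"
  unfolding Sym_def by (auto intro!: o_inv_distrib permutes_bij)

lemma Sym_inv_inv: "u \<in> Sym n \<Longrightarrow> inv (inv u) = u"
  unfolding Sym_def by (auto intro!: inv_inv_eq permutes_bij)

lemma sum_Sym_comp_left: "g \<in> Sym n \<Longrightarrow> sum f (Sym n) = (\<Sum>u\<in>Sym n. f (g \<circ> u))"
  unfolding Sym_def by (rule setum_permutations_compose_left) simp

lemma sum_Sym_conj: "g \<in> Sym n \<Longrightarrow> sum f (Sym n) = (\<Sum>u\<in>Sym n. f (g \<circ> u \<circ> inv g))"
  unfolding Sym_def by (rule sum_permutes_conj) simp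

lemma sum_Sym_inv: "sum f (Sym n) = (\<Sum>u\<in>Sym n. f (inv u))"
  unfolding Sym_def by (rule sum_permutations_inverse)

lemma sign_Sym_comp: "u \<in> Sym n \<Longrightarrow> v \<in> Sym n \<Longrightarrow> sign (u \<circ> v) = sign u * sign v"
  unfolding Sym_def by (auto intro: sign_permutes_compose)

lemma gmult_apply:
  assumes "w \<in> Sym n"
  shows "gmult n x y w = (\<Sum>u\<in>Sym n. x u * y (inv u \<circ> w))"
  unfolding gmult_def
proof (rule sum.cong [OF refl])
  fix u assume u: "u \<in> Sym n"
  have "u \<circ> v = w \<longleftrightarrow> v = inv u \<circ> w" for v
    by (metis Sym_inv_comp(1,2) u)
  then have "(\<Sum>v\<in>Sym n. if u \<circ> v = w then x u * y v else 0) =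
      (\<Sum>v\<in>Sym n. if v = inv u \<circ> w then x u * y v else 0)" by simp
  also have "\<dots> = x u * y (inv u \<circ> w)"
    using Sym_comp [OF Sym_inv [OF u] assms] by (subst sum.delta) (auto simp: finite_Sym)
  finally show "(\<Sum>v\<in>Sym n. if u \<circ> v = w then x u * y v else 0) = x u * y (inv u \<circ> w)" .
qed

lemma gmult_outside: "w \<notin> Sym n \<Longrightarrow> gmult n x y w = 0"
  unfolding gmult_def using Sym_comp by (intro sum.neutral ballI) auto

lemma gmult_in_group_algebra: "gmult n x y \<in> group_algebra n"
  by (simp add: group_algebra_def gmult_outside)

lemma gmult_assoc: "gmult n (gmult n x y) z = gmult n x (gmult n y z)"
proof
  fix w
  show "gmult n (gmult n x y) z w = gmult n x (gmult n y z) w"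
  proof (cases "w \<in> Sym n")
    case True
    have "gmult n (gmult n x y) z w =
        (\<Sum>u\<in>Sym n. \<Sum>s\<in>Sym n. x s * y (inv s \<circ> u) * z (inv u \<circ> w))"
      unfolding gmult_apply [OF True] by (intro sum.cong refl) (simp add: gmult_apply sum_distrib_right)
    also have "\<dots> = (\<Sum>s\<in>Sym n. \<Sum>u\<in>Sym n. x s * y (inv s \<circ> u) * z (inv u \<circ> w))"
      by (rule sum.swap)
    also have "\<dots> = (\<Sum>s\<in>Sym n. x s * gmult n y z (inv s \<circ> w))"
    proof (rule sum.cong [OF refl])
      fix s assume s: "s \<in> Sym n"
      have "(\<Sum>u\<in>Sym n. x s * y (inv s \<circ> u) * z (inv u \<circ> w)) =
          (\<Sum>t\<in>Sym n. x s * y (inv s \<circ> (s \<circ> t)) * z (inv (s \<circ> t) \<circ> w))"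
        by (rule sum_Sym_comp_left [OF s])
      also have "\<dots> = (\<Sum>t\<in>Sym n. x s * (y t * z (inv t \<circ> (inv s \<circ> w))))"
        by (intro sum.cong refl)
          (simp only: Sym_inv_comp(1) [OF s] Sym_inv_distrib [OF s] comp_assoc mult.assoc)
      also have "\<dots> = x s * gmult n y z (inv s \<circ> w)"
        using Sym_comp [OF Sym_inv [OF s] True] by (simp only: gmult_apply sum_distrib_left)
      finally show "(\<Sum>u\<in>Sym n. x s * y (inv s \<circ> u) * z (inv u \<circ> w)) = x s * gmult n y z (inv s \<circ> w)" .
    qed
    also have "\<dots> = gmult n x (gmult n y z) w"
      by (simp only: gmult_apply [OF True])
    finally show ?thesis .
  qed (simp add: gmult_outside)
qed

lemma gmult_add_left: "gmult n (x + x') y = gmult n x y + gmult n x' y"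
  unfolding gmult_def fun_eq_iff plus_fun_apply sum.distrib [symmetric]
  by (intro allI sum.cong refl) (simp add: distrib_right)

lemma gmult_add_right: "gmult n x (y + y') = gmult n x y + gmult n x y'"
  unfolding gmult_def fun_eq_iff plus_fun_apply sum.distrib [symmetric]
  by (intro allI sum.cong refl) (simp add: distrib_left)

lemma gmult_scale_left: "gmult n (gscale a x) y = gscale a (gmult n x y)"
  unfolding gmult_def gscale_def fun_eq_iff sum_distrib_left
  by (intro allI sum.cong refl) simp

lemma gmult_scale_right: "gmult n x (gscale a y) = gscale a (gmult n x y)"
  unfolding gmult_def gscale_def fun_eq_iff sum_distrib_left
  by (intro allI sum.cong refl) simp

lemma gmult_gelem_left:
  assumes "g \<in> Sym n" "w \<in> Sym n"
  shows "gmult n (gelem g) x w = x (inv g \<circ> w)"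
proof -
  have "gmult n (gelem g) x w = (\<Sum>u\<in>Sym n. if u = g then x (inv u \<circ> w) else 0)"
    unfolding gmult_apply [OF assms(2)] gelem_def by (intro sum.cong refl) auto
  then show ?thesis using assms(1) by (simp add: sum.delta finite_Sym)
qed

lemma sum_fun_apply: "(\<Sum>i\<in>A. f i) x = (\<Sum>i\<in>A. f i x)" for f :: "_ \<Rightarrow> galg"
  by (induction A rule: infinite_finite_induct) auto

lemma group_algebra_expand:
  assumes "x \<in> group_algebra n"
  shows "x = (\<Sum>g\<in>Sym n. gscale (x g) (gelem g))"
proof
  fix w
  have "(\<Sum>g\<in>Sym n. gscale (x g) (gelem g)) w = (\<Sum>g\<in>Sym n. if w = g then x g else 0)"
    unfolding sum_fun_apply by (intro sum.cong refl) (simp add: gscale_def gelem_def)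
  also have "\<dots> = x w"
    using assms by (simp add: sum.delta' finite_Sym group_algebra_def)
  finally show "x w = (\<Sum>g\<in>Sym n. gscale (x g) (gelem g)) w" ..
qed

text \<open>A linear map with values in a subspace has the same trace on the whole algebra as on
  that subspace. Comparing with the basis of group elements makes any basis that \<open>SOME\<close>
  delivers as good as another.\<close>

lemma sum_diagonal_eq_representation:
  assumes B: "galg.independent B" "finite B" "B \<subseteq> group_algebra n"
    and add: "\<And>x y. \<Psi> (x + y) = \<Psi> x + \<Psi> y" and scale: "\<And>a x. \<Psi> (gscale a x) = gscale a (\<Psi> x)"
    and span: "\<And>g. g \<in> Sym n \<Longrightarrow> \<Psi> (gelem g) \<in> galg.span B"
  shows "(\<Sum>g\<in>Sym n. \<Psi> (gelem g) g) = (\<Sum>b\<in>B. galg.representation B (\<Psi> b) b)"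
proof -
  have zero: "\<Psi> 0 = 0"
    using scale [of 0 0] by (simp only: galg.scale_zero_left)
  have sum: "\<Psi> (\<Sum>i\<in>A. f i) = (\<Sum>i\<in>A. \<Psi> (f i))" for f and A :: "(nat \<Rightarrow> nat) set"
    by (induction A rule: infinite_finite_induct) (simp_all only: sum.infinite sum.empty sum.insert zero add not_False_eq_True)
  have "(\<Sum>g\<in>Sym n. \<Psi> (gelem g) g) =
      (\<Sum>g\<in>Sym n. \<Sum>b\<in>B. galg.representation B (\<Psi> (gelem g)) b * b g)"
  proof (rule sum.cong [OF refl])
    fix g assume g: "g \<in> Sym n"
    have "\<Psi> (gelem g) g = (\<Sum>b\<in>B. gscale (galg.representation B (\<Psi> (gelem g)) b) b) g"
      using galg.sum_representation_eq [OF B(1) span [OF g] B(2) subset_refl] by simp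
    then show "\<Psi> (gelem g) g = (\<Sum>b\<in>B. galg.representation B (\<Psi> (gelem g)) b * b g)"
      by (simp add: sum_fun_apply gscale_def)
  qed
  \<comment> \<open>This exchange is the identity tr (R S) = tr (S R), for the B-coordinates of the
    images of group elements and the coefficients of the elements of B.\<close>
  also have "\<dots> = (\<Sum>b\<in>B. \<Sum>g\<in>Sym n. galg.representation B (\<Psi> (gelem g)) b * b g)"
    by (rule sum.swap)
  also have "\<dots> = (\<Sum>b\<in>B. galg.representation B (\<Psi> b) b)"
  proof (rule sum.cong [OF refl])
    fix b assume "b \<in> B"
    then have "b = (\<Sum>g\<in>Sym n. gscale (b g) (gelem g))"
      using B(3) by (intro group_algebra_expand) auto
    then have "\<Psi> b = (\<Sum>g\<in>Sym n. gscale (b g) (\<Psi> (gelem g)))"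
      by (metis (no_types, lifting) scale sum sum.cong)
    then have "galg.representation B (\<Psi> b) =
        (\<lambda>c. \<Sum>g\<in>Sym n. galg.representation B (gscale (b g) (\<Psi> (gelem g))) c)"
      using galg.representation_sum [OF B(1), of "Sym n" "\<lambda>g. gscale (b g) (\<Psi> (gelem g))"] span
      by (simp add: galg.span_scale)
    then show "(\<Sum>g\<in>Sym n. galg.representation B (\<Psi> (gelem g)) b * b g) = galg.representation B (\<Psi> b) b"
      using galg.representation_scale [OF B(1) span] by (simp add: mult.commute)
  qed
  finally show ?thesis .
qed

text \<open>On V right multiplication by c is the scalar \<gamma>. The traces of x \<mapsto> x c and
  x \<mapsto> w x c are computed on V and as diagonal sums over the group; the first gives \<gamma>
  dim V = n!, so dim V is nonzero, and eliminates \<gamma> from the second.\<close>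

lemma left_ideal_character:
  assumes V: "V = (\<lambda>x. gmult n x c) ` group_algebra n"
    and cc: "gmult n c c = gscale \<gamma> c" and c1: "c id = 1" and w: "w \<in> Sym n"
  shows "trace_on V (gmult n (gelem w)) * fact n =
      of_nat (galg.dim V) * (\<Sum>g\<in>Sym n. c (inv g \<circ> (inv w \<circ> g)))"
    and "galg.dim V \<noteq> 0"
proof -
  have inV: "gmult n x c \<in> V" for x
  proof -
    \<comment> \<open>\<open>gmult\<close> reads x only on \<open>Sym n\<close>, so x may be cut off
      to an element of the group algebra.\<close>
    let ?x = "\<lambda>u. if u \<in> Sym n then x u else 0"
    have "gmult n x c = gmult n ?x c"
      unfolding gmult_def fun_eq_iff by (intro allI sum.cong refl) auto
    moreover have "?x \<in> group_algebra n" by (simp add: group_algebra_def)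
    ultimately show ?thesis unfolding V by blast
  qed
  have sub: "galg.subspace V"
    unfolding galg.subspace_def
  proof (intro conjI ballI allI)
    show "0 \<in> V"
      using inV [of 0] gmult_scale_left [of n 0 0 c] by (simp only: galg.scale_zero_left)
    show "x + y \<in> V" if "x \<in> V" "y \<in> V" for x y
      using that inV unfolding V by (auto simp: gmult_add_left [symmetric] simp del: plus_fun_apply)
    show "gscale a x \<in> V" if "x \<in> V" for a x
      using that inV unfolding V by (auto simp: gmult_scale_left [symmetric])
  qed
  have VA: "V \<subseteq> group_algebra n" unfolding V using gmult_in_group_algebra by auto
  define B where "B = (SOME B. galg.independent B \<and> galg.span B = V)"
  obtain B0 where "B0 \<subseteq> V" "galg.independent B0" "V \<subseteq> galg.span B0"
    by (rule galg.maximal_independent_subset)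
  then have "galg.independent B0 \<and> galg.span B0 = V"
    using galg.span_subspace [OF _ _ sub] by blast
  then have B: "galg.independent B" "galg.span B = V"
    unfolding B_def by (metis (mono_tags, lifting) someI_ex)+
  have BV: "B \<subseteq> V" using B(2) galg.span_superset by blast
  have "group_algebra n \<subseteq> galg.span (gelem ` Sym n)"
  proof
    fix x assume "x \<in> group_algebra n"
    then have "x = (\<Sum>g\<in>Sym n. gscale (x g) (gelem g))" by (rule group_algebra_expand)
    moreover have "\<dots> \<in> galg.span (gelem ` Sym n)"
      by (intro galg.span_sum galg.span_scale galg.span_base) auto
    ultimately show "x \<in> galg.span (gelem ` Sym n)" by simp
  qed
  then have finB: "finite B"
    using galg.independent_span_bound [OF finite_imageI [OF finite_Sym [of n]] B(1)] BV VA by blast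
  have dim: "galg.dim V = card B"
    using galg.dim_eq_card [of B V] B galg.span_eq_iff sub by metis
  have bc: "gmult n b c = gscale \<gamma> b" if b: "b \<in> V" for b
  proof -
    obtain x where "b = gmult n x c" using b V by auto
    then show ?thesis by (simp only: gmult_assoc cc gmult_scale_right)
  qed
  have rep: "galg.representation B b b = 1" if "b \<in> B" for b
    using galg.representation_basis [OF B(1) that] by simp
  have wV: "gmult n (gelem w) b \<in> V" if b: "b \<in> V" for b
  proof -
    obtain x where "b = gmult n x c" using b V by auto
    then show ?thesis using inV [of "gmult n (gelem w) x"] by (simp only: gmult_assoc)
  qed
  have "(\<Sum>g\<in>Sym n. gmult n (gelem g) c g) = (\<Sum>b\<in>B. galg.representation B (gmult n b c) b)"
    using BV VA by (intro sum_diagonal_eq_representation B finB)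
      (auto simp only: gmult_add_left gmult_scale_left B(2) inV)
  also have "\<dots> = (\<Sum>b\<in>B. \<gamma> * galg.representation B b b)"
  proof (rule sum.cong [OF refl])
    fix b assume b: "b \<in> B"
    then have "b \<in> galg.span B" using BV B(2) by blast
    with b BV show "galg.representation B (gmult n b c) b = \<gamma> * galg.representation B b b"
      by (simp add: bc subset_iff galg.representation_scale [OF B(1)])
  qed
  also have "\<dots> = \<gamma> * of_nat (galg.dim V)"
    by (simp add: rep dim)
  also have "(\<Sum>g\<in>Sym n. gmult n (gelem g) c g) = (\<Sum>g\<in>Sym n. 1)"
    by (intro sum.cong refl) (simp add: gmult_gelem_left Sym_inv_comp c1)
  finally have 1: "\<gamma> * of_nat (galg.dim V) = fact n"
    by (simp add: card_Sym)
  then show "galg.dim V \<noteq> 0"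
    by (metis fact_nonzero mult_zero_right of_nat_0)
  have "(\<Sum>g\<in>Sym n. gmult n (gelem w) (gmult n (gelem g) c) g) =
      (\<Sum>b\<in>B. galg.representation B (gmult n (gelem w) (gmult n b c)) b)"
    using BV VA by (intro sum_diagonal_eq_representation [where \<Psi> = "\<lambda>x. gmult n (gelem w) (gmult n x c)"] B finB)
      (auto simp only: gmult_add_left gmult_scale_left gmult_add_right gmult_scale_right B(2) inV wV)
  also have "\<dots> = (\<Sum>b\<in>B. \<gamma> * galg.representation B (gmult n (gelem w) b) b)"
  proof (rule sum.cong [OF refl])
    fix b assume b: "b \<in> B"
    then have "gmult n (gelem w) b \<in> galg.span B" using BV B(2) wV by blast
    with b BV show "galg.representation B (gmult n (gelem w) (gmult n b c)) b =
        \<gamma> * galg.representation B (gmult n (gelem w) b) b"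
      by (simp add: bc subset_iff gmult_scale_right galg.representation_scale [OF B(1)])
  qed
  also have "\<dots> = \<gamma> * trace_on V (gmult n (gelem w))"
    unfolding trace_on_def B_def [symmetric] Let_def by (simp add: sum_distrib_left)
  also have "(\<Sum>g\<in>Sym n. gmult n (gelem w) (gmult n (gelem g) c) g) =
      (\<Sum>g\<in>Sym n. c (inv g \<circ> (inv w \<circ> g)))"
  proof (rule sum.cong [OF refl])
    fix g assume g: "g \<in> Sym n"
    then have "inv w \<circ> g \<in> Sym n" using w by (intro Sym_comp Sym_inv)
    then show "gmult n (gelem w) (gmult n (gelem g) c) g = c (inv g \<circ> (inv w \<circ> g))"
      by (simp only: gmult_gelem_left g w)
  qed
  finally have 2: "(\<Sum>g\<in>Sym n. c (inv g \<circ> (inv w \<circ> g))) = \<gamma> * trace_on V (gmult n (gelem w))" .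
  show "trace_on V (gmult n (gelem w)) * fact n =
      of_nat (galg.dim V) * (\<Sum>g\<in>Sym n. c (inv g \<circ> (inv w \<circ> g)))"
    unfolding 2 1 [symmetric] by (simp only: mult_ac)
qed


section \<open>The Young symmetrizer of a rectangle\<close>

lemma parts_rect: "parts (rect p q) = replicate p q"
proof -
  have "sort (replicate p q) = replicate p q"
    by (simp add: sorted_sort_id)
  then have "sorted_list_of_multiset (replicate_mset p q) = replicate p q"
    by (metis mset_replicate sorted_list_of_multiset_mset)
  then show ?thesis by (simp add: parts_def rect_def)
qed

lemma sum_mset_rect: "sum_mset (rect p q) = p * q"
  by (simp add: rect_def)

lemma nth_concat_pairs:
  "length (concat (map (\<lambda>i. map (Pair i) [0..<q]) [0..<p])) = p * q \<and>
    (\<forall>m<p * q. concat (map (\<lambda>i. map (Pair i) [0..<q]) [0..<p]) ! m = (m div q, m mod q))"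
proof (induction p)
  case (Suc p)
  show ?case
  proof (intro conjI allI impI)
    fix m assume m: "m < Suc p * q"
    show "concat (map (\<lambda>i. map (Pair i) [0..<q]) [0..<Suc p]) ! m = (m div q, m mod q)"
    proof (cases "m < p * q")
      case False
      then have "m = p * q + (m - p * q)" "m - p * q < q" using m by auto
      then have "m div q = p" "m mod q = m - p * q"
        by (metis add.right_neutral div_less div_mult_self3 less_nat_zero_code mult.commute)
          (metis \<open>m = p * q + (m - p * q)\<close> \<open>m - p * q < q\<close> mod_less mod_mult_self3)
      with Suc False \<open>m - p * q < q\<close> show ?thesis by (simp add: nth_append)
    qed (use Suc in \<open>simp add: nth_append\<close>)
  qed (use Suc in simp)
qed simp

lemma boxes_rect:
  assumes "m < p * q"
  shows "boxes (rect p q) ! m = (m div q, m mod q)"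
proof -
  have "boxes (rect p q) = concat (map (\<lambda>i. map (Pair i) [0..<q]) [0..<p])"
    unfolding boxes_def parts_rect by (auto simp: rect_def intro!: arg_cong [of _ _ concat])
  then show ?thesis using nth_concat_pairs assms by simp
qed

definition rows :: "nat \<Rightarrow> nat \<Rightarrow> (nat \<Rightarrow> nat) set"
  where "rows p q = {w \<in> Sym (p * q). \<forall>m<p * q. w m div q = m div q}"

definition columns :: "nat \<Rightarrow> nat \<Rightarrow> (nat \<Rightarrow> nat) set"
  where "columns p q = {w \<in> Sym (p * q). \<forall>m<p * q. w m mod q = m mod q}"

lemma Sym_less: "w \<in> Sym n \<Longrightarrow> w m < n \<longleftrightarrow> m < n"
  using permutes_in_image [of w "{..<n}" m] by (simp add: Sym_def)

lemma row_group_rect: "row_group (rect p q) = rows p q"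
  and column_group_rect: "column_group (rect p q) = columns p q"
  unfolding row_group_def column_group_def rows_def columns_def sum_mset_rect
  by (auto simp: boxes_rect Sym_less)

text \<open>In a factorization of \<tau> the column factor is determined by the row factor, so one
  summation suffices.\<close>

definition ysym :: "nat \<Rightarrow> nat \<Rightarrow> galg"
  where "ysym p q \<tau> = (\<Sum>u\<in>Sym (p * q). if u \<in> rows p q \<and> inv u \<circ> \<tau> \<in> columns p q
    then of_int (sign (inv u \<circ> \<tau>)) else 0)"

lemma sum_gelem_apply:
  assumes "finite A"
  shows "(\<Sum>u\<in>A. gscale (f u) (gelem u)) s = (if s \<in> A then f s else 0)"
  using assms unfolding sum_fun_apply by (simp add: gscale_def gelem_def if_distrib sum.delta' cong: if_cong)

lemma rows_subset: "rows p q \<subseteq> Sym (p * q)" and columns_subset: "columns p q \<subseteq> Sym (p * q)"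
  by (auto simp: rows_def columns_def)

lemma young_symmetrizer_rect:
  assumes "\<tau> \<in> Sym (p * q)"
  shows "young_symmetrizer (rect p q) \<tau> = ysym p q \<tau>"
proof -
  have fin: "finite (rows p q)" "finite (columns p q)"
    using rows_subset columns_subset finite_Sym finite_subset by metis+
  have "(\<Sum>u\<in>rows p q. gelem u) s = (if s \<in> rows p q then 1 else 0)" for s
    using sum_gelem_apply [OF fin(1), of "\<lambda>_. 1" s] by simp
  then show ?thesis
    unfolding young_symmetrizer_def row_group_rect column_group_rect sum_mset_rect
      gmult_apply [OF assms] ysym_def sum_gelem_apply [OF fin(2)]
    by (intro sum.cong refl) auto
qed

lemma rows_comp: "u \<in> rows p q \<Longrightarrow> v \<in> rows p q \<Longrightarrow> u \<circ> v \<in> rows p q"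
  by (auto simp: rows_def Sym_comp Sym_less)

lemma columns_comp: "u \<in> columns p q \<Longrightarrow> v \<in> columns p q \<Longrightarrow> u \<circ> v \<in> columns p q"
  by (auto simp: columns_def Sym_comp Sym_less)

lemma Sym_inverses: "u \<in> Sym n \<Longrightarrow> u (inv u m) = m" "u \<in> Sym n \<Longrightarrow> inv u (u m) = m"
  using permutes_inverses [of u "{..<n}" m] by (simp_all add: Sym_def)

lemma rows_inv: "u \<in> rows p q \<Longrightarrow> inv u \<in> rows p q"
  unfolding rows_def by (auto simp: Sym_inv) (metis Sym_inverses(1) Sym_inv Sym_less)

lemma columns_inv: "u \<in> columns p q \<Longrightarrow> inv u \<in> columns p q"
  unfolding columns_def by (auto simp: Sym_inv) (metis Sym_inverses(1) Sym_inv Sym_less)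

lemma rows_id: "id \<in> rows p q" and columns_id: "id \<in> columns p q"
  by (simp_all add: rows_def columns_def Sym_id)

lemma rows_columns_id:
  assumes "u \<in> rows p q" "u \<in> columns p q"
  shows "u = id"
proof
  fix m
  show "u m = id m"
  proof (cases "m < p * q")
    case True
    then have "u m div q = m div q" "u m mod q = m mod q"
      using assms by (auto simp: rows_def columns_def)
    then show ?thesis by (metis div_mult_mod_eq id_apply)
  next
    case False
    then show ?thesis using assms(1) permutes_not_in [of u "{..<p * q}" m] by (auto simp: rows_def Sym_def)
  qed
qed

lemma columns_comp_right:
  assumes "v \<in> columns p q"
  shows "x \<circ> v \<in> columns p q \<longleftrightarrow> x \<in> columns p q"
proof
  assume "x \<circ> v \<in> columns p q"
  then have "x \<circ> v \<circ> inv v \<in> columns p q" by (rule columns_comp [OF _ columns_inv [OF assms]])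
  then show "x \<in> columns p q"
    using assms columns_subset by (metis Sym_inv_comp(3) subsetD)
qed (use assms columns_comp in blast)

lemma rows_comp_left:
  assumes "u \<in> rows p q"
  shows "u \<circ> x \<in> rows p q \<longleftrightarrow> x \<in> rows p q"
proof
  assume "u \<circ> x \<in> rows p q"
  then have "inv u \<circ> (u \<circ> x) \<in> rows p q" by (rule rows_comp [OF rows_inv [OF assms]])
  then show "x \<in> rows p q"
    using assms rows_subset by (metis Sym_inv_comp(1) subsetD)
qed (use assms rows_comp in blast)

lemma ysym_row:
  assumes u: "u \<in> rows p q"
  shows "ysym p q (u \<circ> \<tau>) = ysym p q \<tau>"
proof -
  have uS: "u \<in> Sym (p * q)" using u rows_subset by auto
  have "ysym p q (u \<circ> \<tau>) = (\<Sum>s\<in>Sym (p * q).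
      if u \<circ> s \<in> rows p q \<and> inv (u \<circ> s) \<circ> (u \<circ> \<tau>) \<in> columns p q
      then of_int (sign (inv (u \<circ> s) \<circ> (u \<circ> \<tau>))) else 0)"
    unfolding ysym_def by (rule sum_Sym_comp_left [OF uS])
  also have "\<dots> = ysym p q \<tau>"
    unfolding ysym_def
    by (intro sum.cong refl)
      (simp only: rows_comp_left [OF u] Sym_inv_distrib [OF uS] comp_assoc Sym_inv_comp(1) [OF uS])
  finally show ?thesis .
qed

lemma ysym_column:
  assumes v: "v \<in> columns p q"
  shows "ysym p q (\<tau> \<circ> v) = of_int (sign v) * ysym p q \<tau>"
  unfolding ysym_def sum_distrib_left
proof (rule sum.cong [OF refl])
  fix u
  have "inv u \<circ> (\<tau> \<circ> v) \<in> columns p q \<longleftrightarrow> inv u \<circ> \<tau> \<in> columns p q"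
    unfolding comp_assoc [symmetric] by (rule columns_comp_right [OF v])
  moreover have "sign (inv u \<circ> (\<tau> \<circ> v)) = sign v * sign (inv u \<circ> \<tau>)" if "inv u \<circ> \<tau> \<in> columns p q"
    using that v columns_subset sign_Sym_comp [of "inv u \<circ> \<tau>" "p * q" v]
    by (auto simp: comp_assoc [symmetric] mult.commute)
  ultimately show "(if u \<in> rows p q \<and> inv u \<circ> (\<tau> \<circ> v) \<in> columns p q
      then complex_of_int (sign (inv u \<circ> (\<tau> \<circ> v))) else 0) =
      of_int (sign v) * (if u \<in> rows p q \<and> inv u \<circ> \<tau> \<in> columns p q then of_int (sign (inv u \<circ> \<tau>)) else 0)"
    by auto
qed

lemma ysym_id: "ysym p q id = 1"
proof -
  have "u \<in> rows p q \<and> inv u \<in> columns p q \<longleftrightarrow> u = id" for u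
    using rows_columns_id [OF rows_inv] rows_id columns_id rows_subset
    by (metis Sym_inv_inv inv_id subsetD)
  then have "ysym p q id = (\<Sum>u\<in>Sym (p * q). if u = id then 1 else 0)"
    unfolding ysym_def comp_id by (intro sum.cong refl) auto
  then show ?thesis by (simp add: sum.delta finite_Sym Sym_id)
qed

text \<open>If no two entries of a row lie in the same column after applying \<open>inv \<sigma>\<close>, each row meets
  each column exactly once, so the rows can be sorted: this is the row factor of \<open>\<sigma>\<close>.\<close>

lemma rect_dichotomy:
  assumes \<sigma>: "\<sigma> \<in> Sym (p * q)"
  obtains u v where "u \<in> rows p q" "v \<in> columns p q" "\<sigma> = u \<circ> v"
  | t v where "t \<in> rows p q" "v \<in> columns p q" "sign v = -1" "t \<circ> \<sigma> = \<sigma> \<circ> v"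
proof (cases "\<exists>a b. a < p * q \<and> b < p * q \<and> a \<noteq> b \<and> a div q = b div q \<and> inv \<sigma> a mod q = inv \<sigma> b mod q")
  case True
  then obtain a b where ab: "a < p * q" "b < p * q" "a \<noteq> b" "a div q = b div q" "inv \<sigma> a mod q = inv \<sigma> b mod q"
    by blast
  \<comment> \<open>Exchanging a and b inside their row after \<sigma> is the same as exchanging
    their preimages inside a column before \<sigma>.\<close>
  define t where "t = transpose a b"
  define v where "v = transpose (inv \<sigma> a) (inv \<sigma> b)"
  have lt: "inv \<sigma> a < p * q" "inv \<sigma> b < p * q"
    using ab Sym_less [OF Sym_inv [OF \<sigma>]] by auto
  have ne: "inv \<sigma> a \<noteq> inv \<sigma> b" using ab(3) Sym_inverses(1) [OF \<sigma>] by metis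
  have "t \<in> rows p q"
    using ab by (auto simp: rows_def t_def Sym_def transpose_def intro!: permutes_swap_id)
  moreover have "v \<in> columns p q"
    using ab lt by (auto simp: columns_def v_def Sym_def transpose_def intro!: permutes_swap_id)
  moreover have "sign v = -1" using ne by (simp add: v_def sign_swap_id)
  moreover have "bij \<sigma>" using \<sigma> by (auto simp: Sym_def intro: permutes_bij)
  then have "t \<circ> \<sigma> = \<sigma> \<circ> v"
    unfolding t_def v_def
    using bij_transpose_comp [of \<sigma> "inv \<sigma> a" "inv \<sigma> b"] by (simp add: Sym_inverses(1) [OF \<sigma>])
  ultimately show thesis using that(2) by blast
next
  case False
  \<comment> \<open>u moves m within its row to the column of \<open>inv \<sigma> m\<close>, so
    \<open>u \<circ> \<sigma>\<close> preserves columns; u is the inverse of the row factor. The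
    negated case assumption excludes collisions.\<close>
  define u where "u m = (if m < p * q then m div q * q + inv \<sigma> m mod q else m)" for m
  have udm: "u m div q = m div q" "u m mod q = inv \<sigma> m mod q" "u m < p * q" if m: "m < p * q" for m
  proof -
    have q: "q > 0" using m by (cases q) auto
    have r: "inv \<sigma> m mod q < q" using q by simp
    show "u m div q = m div q" "u m mod q = inv \<sigma> m mod q"
      using m q r by (simp_all add: u_def)
    have "m div q < p" using m q by (simp add: less_mult_imp_div_less)
    then have "Suc (m div q) * q \<le> p * q" by (intro mult_le_mono1) simp
    then show "u m < p * q" using r m by (simp add: u_def)
  qed
  have "u permutes {..<p * q}"
  proof (rule inj_imp_permutes)
    show "inj_on u {..<p * q}"
      by (rule inj_onI) (metis False lessThan_iff udm(1,2))
  qed (use udm(3) in \<open>auto simp: u_def\<close>)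
  then have uS: "u \<in> Sym (p * q)" by (simp add: Sym_def)
  then have u: "u \<in> rows p q" using udm by (simp add: rows_def)
  have "u \<circ> \<sigma> \<in> columns p q"
    using uS \<sigma> udm(2) Sym_less [OF \<sigma>] Sym_inverses(2) [OF \<sigma>] by (simp add: columns_def Sym_comp)
  moreover have "\<sigma> = inv u \<circ> (u \<circ> \<sigma>)" by (simp only: Sym_inv_comp(1) [OF uS])
  ultimately show thesis using that(1) rows_inv [OF u] by blast
qed

text \<open>A function with these symmetries is determined by its value at \<open>id\<close>: on a
  product of a row and a column permutation it is that value times a sign, elsewhere it equals its
  own negative.\<close>

lemma ysym_unique:
  assumes row: "\<And>u \<tau>. u \<in> rows p q \<Longrightarrow> \<tau> \<in> Sym (p * q) \<Longrightarrow> y (u \<circ> \<tau>) = y \<tau>"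
    and col: "\<And>v \<tau>. v \<in> columns p q \<Longrightarrow> \<tau> \<in> Sym (p * q) \<Longrightarrow> y (\<tau> \<circ> v) = of_int (sign v) * y \<tau>"
    and \<sigma>: "\<sigma> \<in> Sym (p * q)"
  shows "y \<sigma> = y id * ysym p q \<sigma>"
proof (cases rule: rect_dichotomy [OF \<sigma>])
  case (1 u v)
  have "y \<sigma> = of_int (sign v) * y id"
    using row [OF 1(1), of v] col [OF 1(2) Sym_id] 1 columns_subset by auto
  moreover have "ysym p q \<sigma> = of_int (sign v)"
    using ysym_row [OF 1(1), of v] ysym_column [OF 1(2), of id] 1 by (simp add: ysym_id)
  ultimately show ?thesis by simp
next
  case (2 t v)
  have "y \<sigma> = - y \<sigma>"
    using row [OF 2(1) \<sigma>] col [OF 2(2) \<sigma>] 2 by simp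
  moreover have "ysym p q \<sigma> = - ysym p q \<sigma>"
    using ysym_row [OF 2(1), of \<sigma>] ysym_column [OF 2(2), of \<sigma>] 2 by simp
  ultimately show ?thesis by simp
qed

text \<open>The square inherits the row symmetry from its left factor and the signed column symmetry
  from its right factor, so \<open>ysym_unique\<close> applies.\<close>

lemma young_symmetrizer_square:
  "gmult (p * q) (young_symmetrizer (rect p q)) (young_symmetrizer (rect p q)) =
    gscale (gmult (p * q) (young_symmetrizer (rect p q)) (young_symmetrizer (rect p q)) id)
      (young_symmetrizer (rect p q))"
proof
  let ?c = "young_symmetrizer (rect p q)" and ?n = "p * q"
  fix \<sigma>
  show "gmult ?n ?c ?c \<sigma> = gscale (gmult ?n ?c ?c id) ?c \<sigma>"
  proof (cases "\<sigma> \<in> Sym ?n")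
    case True
    have "gmult ?n ?c ?c \<sigma> = gmult ?n ?c ?c id * ysym p q \<sigma>"
    proof (rule ysym_unique [OF _ _ True])
      fix u \<tau> assume u: "u \<in> rows p q" and \<tau>: "\<tau> \<in> Sym ?n"
      have uS: "u \<in> Sym ?n" using u rows_subset by auto
      have "gmult ?n ?c ?c (u \<circ> \<tau>) = (\<Sum>s\<in>Sym ?n. ?c (u \<circ> s) * ?c (inv (u \<circ> s) \<circ> (u \<circ> \<tau>)))"
        unfolding gmult_apply [OF Sym_comp [OF uS \<tau>]] by (rule sum_Sym_comp_left [OF uS])
      also have "\<dots> = (\<Sum>s\<in>Sym ?n. ?c s * ?c (inv s \<circ> \<tau>))"
      proof (rule sum.cong [OF refl])
        fix s assume s: "s \<in> Sym ?n"
        have "inv (u \<circ> s) \<circ> (u \<circ> \<tau>) = inv s \<circ> \<tau>"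
          by (simp only: Sym_inv_distrib [OF uS s] comp_assoc Sym_inv_comp(1) [OF uS])
        moreover have "?c (u \<circ> s) = ?c s"
          by (simp only: young_symmetrizer_rect Sym_comp [OF uS s] s ysym_row [OF u])
        ultimately show "?c (u \<circ> s) * ?c (inv (u \<circ> s) \<circ> (u \<circ> \<tau>)) = ?c s * ?c (inv s \<circ> \<tau>)"
          by (simp only:)
      qed
      finally show "gmult ?n ?c ?c (u \<circ> \<tau>) = gmult ?n ?c ?c \<tau>"
        by (simp only: gmult_apply [OF \<tau>])
    next
      fix v \<tau> assume v: "v \<in> columns p q" and \<tau>: "\<tau> \<in> Sym ?n"
      have vS: "v \<in> Sym ?n" using v columns_subset by auto
      have "?c (inv s \<circ> (\<tau> \<circ> v)) = of_int (sign v) * ?c (inv s \<circ> \<tau>)" if s: "s \<in> Sym ?n" for s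
      proof -
        have "inv s \<circ> \<tau> \<in> Sym ?n" "inv s \<circ> \<tau> \<circ> v \<in> Sym ?n"
          using s \<tau> vS by (auto intro!: Sym_comp Sym_inv)
        then show ?thesis
          by (simp only: young_symmetrizer_rect comp_assoc [symmetric] ysym_column [OF v])
      qed
      then show "gmult ?n ?c ?c (\<tau> \<circ> v) = of_int (sign v) * gmult ?n ?c ?c \<tau>"
        unfolding gmult_apply [OF \<tau>] gmult_apply [OF Sym_comp [OF \<tau> vS]] sum_distrib_left
        by (intro sum.cong refl) (simp only: mult.left_commute)
    qed
    then show ?thesis by (simp only: gscale_def young_symmetrizer_rect [OF True])
  next
    case False
    then have "?c \<sigma> = 0"
      unfolding young_symmetrizer_def sum_mset_rect by (rule gmult_outside)
    with False show ?thesis by (simp add: gmult_outside gscale_def)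
  qed
qed

lemma irr_character_rect:
  assumes "w \<in> Sym (p * q)"
  shows "irr_character (rect p q) w * fact (p * q) =
      of_nat (irr_dim (rect p q)) * (\<Sum>g\<in>Sym (p * q). ysym p q (inv g \<circ> (inv w \<circ> g)))"
    and "irr_dim (rect p q) \<noteq> 0"
proof -
  let ?c = "young_symmetrizer (rect p q)" and ?n = "p * q"
  have V: "specht (rect p q) = (\<lambda>x. gmult ?n x ?c) ` group_algebra ?n"
    by (simp add: specht_def sum_mset_rect)
  have c1: "?c id = 1" by (simp add: young_symmetrizer_rect Sym_id ysym_id)
  have eq: "(\<Sum>g\<in>Sym ?n. ?c (inv g \<circ> (inv w \<circ> g))) = (\<Sum>g\<in>Sym ?n. ysym p q (inv g \<circ> (inv w \<circ> g)))"
    using assms by (intro sum.cong refl young_symmetrizer_rect Sym_comp Sym_inv) auto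
  note L = left_ideal_character [OF V young_symmetrizer_square c1 assms]
  show "irr_character (rect p q) w * fact ?n =
      of_nat (irr_dim (rect p q)) * (\<Sum>g\<in>Sym ?n. ysym p q (inv g \<circ> (inv w \<circ> g)))"
    and "irr_dim (rect p q) \<noteq> 0"
    unfolding irr_character_def irr_dim_def sum_mset_rect eq [symmetric] by (fact L)+
qed



section \<open>Normalized characters of rectangles\<close>

definition box :: "nat \<Rightarrow> nat \<Rightarrow> nat \<times> nat"
  where "box q m = (m div q, m mod q)"

lemma bij_betw_box: "bij_betw (box q) {..<p * q} ({..<p} \<times> {..<q})"
proof (rule bij_betw_byWitness [where f' = "\<lambda>(i, j). i * q + j"])
  show "box q ` {..<p * q} \<subseteq> {..<p} \<times> {..<q}"
  proof (rule image_subsetI)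
    fix m assume m: "m \<in> {..<p * q}"
    then have "q > 0" by (cases q) auto
    with m show "box q m \<in> {..<p} \<times> {..<q}"
      by (simp add: box_def less_mult_imp_div_less)
  qed
  show "(\<lambda>(i, j). i * q + j) ` ({..<p} \<times> {..<q}) \<subseteq> {..<p * q}"
  proof clarsimp
    fix i j assume "i < p" "j < q"
    have "Suc i * q \<le> p * q" by (rule mult_le_mono1) (use \<open>i < p\<close> in simp)
    moreover have "i * q + j < Suc i * q" using \<open>j < q\<close> by simp
    ultimately show "i * q + j < p * q" by linarith
  qed
qed (auto simp: box_def)

text \<open>Conjugation by g relabels the boxes: the point x sits in the box with index
  \<open>inv g x\<close>. In these terms the row and column conditions concern the placement, and
  only permutations supported in K contribute.\<close>

lemma ysym_conj:
  assumes g: "g \<in> Sym (p * q)" and w: "w permutes K" and K: "K \<subseteq> {..<p * q}"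
  shows "ysym p q (inv g \<circ> (w \<circ> g)) = placesum K w (restrict (box q \<circ> inv g) K)"
proof -
  let ?n = "p * q"
  let ?b = "\<lambda>x. box q (inv g x)"
  let ?cond = "\<lambda>A \<sigma>. (\<forall>x\<in>A. fst (?b (\<sigma> x)) = fst (?b x)) \<and> (\<forall>x\<in>A. snd (?b ((inv \<sigma> \<circ> w) x)) = snd (?b x))"
  have wS: "w \<in> Sym ?n" using permutes_subset [OF w K] by (simp add: Sym_def)
  have gi: "inv g \<in> Sym ?n" "inv (inv g) = g" using g by (auto intro: Sym_inv Sym_inv_inv)
  have rows: "inv g \<circ> \<sigma> \<circ> g \<in> rows p q \<longleftrightarrow> (\<forall>x\<in>{..<?n}. fst (?b (\<sigma> x)) = fst (?b x))"
    if \<sigma>: "\<sigma> \<in> Sym ?n" for \<sigma>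
  proof -
    have "inv g \<circ> \<sigma> \<circ> g \<in> rows p q \<longleftrightarrow> (\<forall>m<?n. inv g (\<sigma> (g m)) div q = m div q)"
      using g \<sigma> by (simp add: rows_def Sym_comp Sym_inv)
    also have "\<dots> \<longleftrightarrow> (\<forall>x<?n. inv g (\<sigma> x) div q = inv g x div q)"
      by (metis Sym_inverses [OF g] Sym_less [OF g] Sym_less [OF gi(1)])
    finally show ?thesis unfolding box_def fst_conv snd_conv by (simp only: Ball_def lessThan_iff)
  qed
  have columns: "inv g \<circ> \<sigma> \<circ> g \<in> columns p q \<longleftrightarrow> (\<forall>x\<in>{..<?n}. snd (?b (\<sigma> x)) = snd (?b x))"
    if \<sigma>: "\<sigma> \<in> Sym ?n" for \<sigma>
  proof -
    have "inv g \<circ> \<sigma> \<circ> g \<in> columns p q \<longleftrightarrow> (\<forall>m<?n. inv g (\<sigma> (g m)) mod q = m mod q)"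
      using g \<sigma> by (simp add: columns_def Sym_comp Sym_inv)
    also have "\<dots> \<longleftrightarrow> (\<forall>x<?n. inv g (\<sigma> x) mod q = inv g x mod q)"
      by (metis Sym_inverses [OF g] Sym_less [OF g] Sym_less [OF gi(1)])
    finally show ?thesis unfolding box_def fst_conv snd_conv by (simp only: Ball_def lessThan_iff)
  qed
  have "ysym p q (inv g \<circ> (w \<circ> g)) = (\<Sum>u\<in>Sym ?n.
      if inv g \<circ> u \<circ> inv (inv g) \<in> rows p q \<and> inv (inv g \<circ> u \<circ> inv (inv g)) \<circ> (inv g \<circ> (w \<circ> g)) \<in> columns p q
      then of_int (sign (inv (inv g \<circ> u \<circ> inv (inv g)) \<circ> (inv g \<circ> (w \<circ> g)))) else 0)"
    unfolding ysym_def by (rule sum_Sym_conj [OF gi(1)])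
  also have "\<dots> = (\<Sum>\<sigma>\<in>Sym ?n. if ?cond {..<?n} \<sigma> then of_int (sign (inv \<sigma> \<circ> w)) else 0)"
  proof (rule sum.cong [OF refl])
    fix \<sigma> assume \<sigma>: "\<sigma> \<in> Sym ?n"
    have "inv (inv g \<circ> \<sigma> \<circ> g) = inv g \<circ> (inv \<sigma> \<circ> g)"
      by (simp only: Sym_inv_distrib [OF Sym_comp [OF gi(1) \<sigma>] g] Sym_inv_distrib [OF gi(1) \<sigma>] gi(2))
    then have e: "inv (inv g \<circ> \<sigma> \<circ> g) \<circ> (inv g \<circ> (w \<circ> g)) = inv g \<circ> (inv \<sigma> \<circ> w) \<circ> g"
      by (simp only: comp_assoc Sym_inv_comp(2) [OF g])
    have \<tau>: "inv \<sigma> \<circ> w \<in> Sym ?n" using \<sigma> wS by (intro Sym_comp Sym_inv)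
    have "sign (inv g \<circ> (inv \<sigma> \<circ> w) \<circ> inv (inv g)) = sign (inv \<sigma> \<circ> w)"
      using gi(1) \<tau> by (intro sign_conj [of "{..<?n}"]) (auto simp: Sym_def)
    then have s: "sign (inv g \<circ> (inv \<sigma> \<circ> w) \<circ> g) = sign (inv \<sigma> \<circ> w)"
      by (simp only: gi(2))
    show "(if inv g \<circ> \<sigma> \<circ> inv (inv g) \<in> rows p q \<and> inv (inv g \<circ> \<sigma> \<circ> inv (inv g)) \<circ> (inv g \<circ> (w \<circ> g)) \<in> columns p q
      then complex_of_int (sign (inv (inv g \<circ> \<sigma> \<circ> inv (inv g)) \<circ> (inv g \<circ> (w \<circ> g)))) else 0) =
      (if ?cond {..<?n} \<sigma> then of_int (sign (inv \<sigma> \<circ> w)) else 0)"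
      unfolding gi(2) e s rows [OF \<sigma>] columns [OF \<tau>] ..
  qed
  also have "\<dots> = (\<Sum>\<sigma> | \<sigma> permutes K. if ?cond {..<?n} \<sigma> then of_int (sign (inv \<sigma> \<circ> w)) else 0)"
  proof (rule sum.mono_neutral_right)
    show "{\<sigma>. \<sigma> permutes K} \<subseteq> Sym ?n"
      using K by (auto simp: Sym_def elim: permutes_subset)
    show "\<forall>\<sigma>\<in>Sym ?n - {\<sigma>. \<sigma> permutes K}. (if ?cond {..<?n} \<sigma> then complex_of_int (sign (inv \<sigma> \<circ> w)) else 0) = 0"
    proof
      fix \<sigma> assume \<sigma>': "\<sigma> \<in> Sym ?n - {\<sigma>. \<sigma> permutes K}"
      then have \<sigma>: "\<sigma> \<in> Sym ?n" by simp
      have "\<not> ?cond {..<?n} \<sigma>"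
      proof
        assume c: "?cond {..<?n} \<sigma>"
        \<comment> \<open>w fixes x. The preimage y of x under \<sigma> then shares the column of x,
          since \<open>inv \<sigma> \<circ> w\<close> preserves columns, and its row, since \<sigma>
          preserves rows; so y = x.\<close>
        have "\<sigma> x = x" if x: "x \<in> {..<?n} - K" for x
        proof -
          define y where "y = inv \<sigma> x"
          have y: "y < ?n" "\<sigma> y = x"
            using x Sym_less [OF Sym_inv [OF \<sigma>]] Sym_inverses(1) [OF \<sigma>] by (auto simp: y_def)
          have wx: "w x = x" using x permutes_not_in [OF w] by auto
          have "snd (?b y) = snd (?b x)"
            using bspec [OF conjunct2 [OF c], of x] x wx by (simp add: y_def)
          moreover have "fst (?b x) = fst (?b y)"
            using c y by force
          ultimately have "inv g y = inv g x"
            unfolding box_def fst_conv snd_conv by (metis div_mult_mod_eq)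
          then have "y = x" using Sym_inverses(1) [OF g] by metis
          then show ?thesis using y by simp
        qed
        moreover have "\<sigma> permutes {..<?n}" using \<sigma> by (simp add: Sym_def)
        ultimately have "\<sigma> permutes K" by (metis permutes_superset)
        then show False using \<sigma>' by simp
      qed
      then show "(if ?cond {..<?n} \<sigma> then complex_of_int (sign (inv \<sigma> \<circ> w)) else 0) = 0"
        by (simp only: if_False)
    qed
  qed (rule finite_Sym)
  also have "\<dots> = placesum K w (restrict (box q \<circ> inv g) K)"
    unfolding placesum_def
  proof (intro sum.cong refl if_cong)
    fix \<sigma> assume "\<sigma> \<in> {\<sigma>. \<sigma> permutes K}"
    then have \<sigma>: "\<sigma> permutes K" by simp
    have \<tau>: "inv \<sigma> \<circ> w permutes K" using \<sigma> w by (intro permutes_compose permutes_inv)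
    have red: "(\<forall>x\<in>{..<?n}. f (?b (s x)) = f (?b x)) \<longleftrightarrow>
        (\<forall>x\<in>K. f (restrict (box q \<circ> inv g) K (s x)) = f (restrict (box q \<circ> inv g) K x))"
      if "s permutes K" for s and f :: "nat \<times> nat \<Rightarrow> nat"
    proof -
      have "s x \<in> K \<longleftrightarrow> x \<in> K" "x \<notin> K \<Longrightarrow> s x = x" for x
        using that by (simp_all add: permutes_in_image permutes_not_in)
      then show ?thesis using K by (auto simp: subset_iff)
    qed
    show "?cond {..<?n} \<sigma> \<longleftrightarrow>
      ((\<forall>x\<in>K. fst (restrict (box q \<circ> inv g) K (\<sigma> x)) = fst (restrict (box q \<circ> inv g) K x)) \<and>
      (\<forall>x\<in>K. snd (restrict (box q \<circ> inv g) K ((inv \<sigma> \<circ> w) x)) = snd (restrict (box q \<circ> inv g) K x)))"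
      unfolding red [OF \<sigma>] red [OF \<tau>] ..
  qed
  finally show ?thesis .
qed

text \<open>The factorial counts the relabellings that induce one and the same injective placement
  of K.\<close>

lemma sum_ysym_conj:
  assumes w: "w permutes K" and K: "K \<subseteq> {..<p * q}"
  shows "(\<Sum>g\<in>Sym (p * q). ysym p q (inv g \<circ> (w \<circ> g))) = fact (p * q - card K) * factsum p q K w"
proof -
  have finK: "finite K" using K finite_subset by blast
  have "(\<Sum>g\<in>Sym (p * q). ysym p q (inv g \<circ> (w \<circ> g))) =
      (\<Sum>g\<in>Sym (p * q). placesum K w (restrict (box q \<circ> inv g) K))"
    by (intro sum.cong refl ysym_conj assms)
  also have "\<dots> = (\<Sum>g\<in>Sym (p * q). placesum K w (restrict (box q \<circ> g) K))"
    by (rule sum_Sym_inv [symmetric])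
  also have "\<dots> = fact (p * q - card K) *
      (\<Sum>f | f \<in> K \<rightarrow>\<^sub>E {..<p} \<times> {..<q} \<and> inj_on f K. placesum K w f)"
    unfolding Sym_def using sum_permutes_restrict [OF _ K bij_betw_box, of "placesum K w"] by simp
  finally show ?thesis by (simp only: sum_placesum_inj [OF finK w])
qed

section \<open>Full cycles and cycle types\<close>

lemma full_cycle_inv:
  assumes "finite K" "full_cycle K w"
  shows "full_cycle K (inv w)"
proof -
  have w: "w permutes K" and tr: "\<And>T. T \<subseteq> K \<Longrightarrow> T \<noteq> {} \<Longrightarrow> w ` T \<subseteq> T \<Longrightarrow> T = K"
    using assms(2) by (auto simp: full_cycle_def)
  have "T = K" if T: "T \<subseteq> K" "T \<noteq> {}" "inv w ` T \<subseteq> T" for T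
  proof (rule tr [OF T(1,2)])
    have "finite T" using T assms(1) finite_subset by blast
    moreover have "inj_on (inv w) T" using permutes_inv [OF w] by (rule permutes_inj_on)
    ultimately have "inv w ` T = T" using endo_inj_surj [OF _ T(3)] by blast
    then have "w ` T = w ` inv w ` T" by simp
    also have "\<dots> = T" using permutes_inverses(1) [OF w] by (simp add: image_image)
    finally show "w ` T \<subseteq> T" by simp
  qed
  then show ?thesis using assms(2) permutes_inv [OF w] by (simp add: full_cycle_def)
qed

text \<open>k occurs in the cycle type as the size of an orbit K. With K removed all other orbits
  are singletons, so w is supported on K and transitive there.\<close>

lemma full_cycle_of_cycle_type:
  assumes w: "w \<in> Sym n" and ct: "cycle_type n w = {#k#} + replicate_mset (n - k) 1" and k: "2 \<le> k"
  obtains K where "K \<subseteq> {..<n}" "card K = k" "full_cycle K w"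
proof -
  have wp: "w permutes {..<n}" using w by (simp add: Sym_def)
  then have perm: "permutation w" by (auto intro: permutes_imp_permutation)
  have self: "x \<in> orbit w x" for x using perm by (rule permutation_self_in_orbit)
  let ?O = "orbit w ` {..<n}"
  have "k \<in># image_mset card (mset_set ?O)" using ct by (simp add: cycle_type_def)
  then obtain K where K: "K \<in> ?O" "card K = k" by auto
  then have "mset_set ?O = add_mset K (mset_set (?O - {K}))"
    by (simp add: mset_set.remove)
  then have rest: "image_mset card (mset_set (?O - {K})) = replicate_mset (n - k) 1"
    using ct K by (simp add: cycle_type_def)
  obtain x where x: "x < n" "K = orbit w x" using K by auto
  have Kn: "K \<subseteq> {..<n}" unfolding x(2) using wp x(1) by (intro permutes_orbit_subset) auto
  have "w y = y" if y: "y \<in> {..<n} - K" for y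
  proof -
    have "orbit w y \<in> ?O - {K}" using y self by auto
    then have "card (orbit w y) \<in># image_mset card (mset_set (?O - {K}))" by auto
    then have "card (orbit w y) = 1" unfolding rest by (auto simp: in_replicate_mset split: if_splits)
    then obtain z where "orbit w y = {z}" by (rule card_1_singletonE)
    with self [of y] orbit.base [of w y] show ?thesis by auto
  qed
  with wp have wK: "w permutes K" by (metis permutes_superset)
  have "T = K" if T: "T \<subseteq> K" "T \<noteq> {}" "w ` T \<subseteq> T" for T
  proof -
    obtain t where t: "t \<in> T" using T by auto
    have "cyclic_on w K" unfolding x(2) by (rule cyclic_on_orbit' [OF perm])
    then have "orbit w t = K" using t T by (intro orbit_cyclic_eq3) auto
    moreover have "y \<in> T" if "y \<in> orbit w t" for y
      using that by induction (use t T in auto)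
    ultimately show ?thesis using T by auto
  qed
  then have "full_cycle K w"
    using wK x self by (auto simp: full_cycle_def)
  with Kn K(2) that show thesis by blast
qed

text \<open>Ensures that the \<open>SOME\<close> in \<open>irr_character_at\<close> chooses a
  permutation of the intended type.\<close>

lemma cycle_type_exists:
  assumes "1 \<le> k" "k \<le> n"
  shows "\<exists>w. w \<in> Sym n \<and> cycle_type n w = {#k#} + replicate_mset (n - k) 1"
proof (intro exI conjI)
  define w where "w x = (if x < k then if Suc x = k then 0 else Suc x else x)" for x
  have wp: "w permutes {..<k}"
  proof (rule inj_imp_permutes)
    show "inj_on w {..<k}"
      by (rule inj_onI) (auto simp: w_def split: if_splits)
  qed (use assms in \<open>auto simp: w_def\<close>)
  then have perm: "permutation w" by (auto intro: permutes_imp_permutation)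
  show "w \<in> Sym n" using permutes_subset [OF wp] assms by (auto simp: Sym_def)
  have "x \<in> orbit w 0" if "x < k" for x
    using that
  proof (induction x)
    case 0
    show ?case using perm by (rule permutation_self_in_orbit)
  next
    case (Suc x)
    then have "w x \<in> orbit w 0" by (intro orbit.step) simp
    moreover have "w x = Suc x" using Suc by (simp add: w_def)
    ultimately show ?case by (simp only:)
  qed
  moreover have "orbit w 0 \<subseteq> {..<k}" using wp assms by (intro permutes_orbit_subset) auto
  ultimately have orb0: "orbit w 0 = {..<k}" by auto
  have "cyclic_on w {..<k}" using cyclic_on_orbit' [OF perm, of 0] by (simp add: orb0)
  then have orb: "orbit w x = {..<k}" if "x < k" for x
    using that by (intro orbit_cyclic_eq3) auto
  have fix': "orbit w x = {x}" if "\<not> x < k" for x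
    using that by (simp add: orbit_eq_singleton_iff w_def)
  have "{..<n} = {..<k} \<union> {k..<n}" using assms by auto
  then have "orbit w ` {..<n} = orbit w ` {..<k} \<union> orbit w ` {k..<n}" by (simp add: image_Un)
  also have "orbit w ` {..<k} = {{..<k}}" using orb assms by (force simp: image_def)
  also have "orbit w ` {k..<n} = (\<lambda>x. {x}) ` {k..<n}" by (rule image_cong) (auto simp: fix')
  finally have O: "orbit w ` {..<n} = insert {..<k} ((\<lambda>x. {x}) ` {k..<n})" by simp
  \<comment> \<open>0 lies in the orbit \<open>{..<k}\<close> but in none of the singletons, so this
    orbit is counted separately even for k = 1.\<close>
  have "0 \<in> {..<k}" using assms by auto
  then have nin: "{..<k} \<notin> (\<lambda>x. {x}) ` {k..<n}" using assms by fastforce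
  have "mset_set ((\<lambda>x. {x}) ` {k..<n}) = image_mset (\<lambda>x. {x}) (mset_set {k..<n})"
    by (rule image_mset_mset_set [symmetric]) simp
  then have "image_mset card (mset_set ((\<lambda>x. {x}) ` {k..<n})) = replicate_mset (n - k) 1"
    by (simp add: image_mset.compositionality comp_def image_mset_const_eq)
  then show "cycle_type n w = {#k#} + replicate_mset (n - k) 1"
    unfolding cycle_type_def O using nin by simp
qed

text \<open>If k exceeds p q, the character is 0 by convention and so is the sum, because there are
  no injective placements. Otherwise left translation brings in the inverse of w, which is harmless
  since the sum is the same for every full cycle.\<close>

lemma Ch_rect_nat:
  assumes j: "2 \<le> k"
  shows "Ch {#k#} (rect p q) * fact k =
    (\<Sum>m\<le>k - 1. of_nat (k - 1 choose m) * ((-1) ^ m *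
      falling (of_nat p + of_nat (k - 1 - m)) k * falling (of_nat q + of_nat m) k))"
proof (cases "k \<le> p * q")
  case True
  let ?\<mu> = "{#k#} + replicate_mset (p * q - k) 1"
  define w where "w = (SOME w. w \<in> Sym (p * q) \<and> cycle_type (p * q) w = ?\<mu>)"
  have w: "w \<in> Sym (p * q)" "cycle_type (p * q) w = ?\<mu>"
    using someI_ex [OF cycle_type_exists [of k "p * q"]] j True unfolding w_def by auto
  obtain K where K: "K \<subseteq> {..<p * q}" "card K = k" "full_cycle K w"
    by (rule full_cycle_of_cycle_type [OF w j])
  have finK: "finite K" using K(1) finite_subset by blast
  have iw: "full_cycle K (inv w)" by (rule full_cycle_inv [OF finK K(3)])
  then have "(\<Sum>g\<in>Sym (p * q). ysym p q (inv g \<circ> (inv w \<circ> g))) = fact (p * q - k) * factsum p q K (inv w)"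
    using sum_ysym_conj [OF _ K(1), of "inv w"] K(2) by (simp only: full_cycle_def)
  with irr_character_rect [OF w(1)]
  have "irr_character (rect p q) w * fact (p * q) =
      of_nat (irr_dim (rect p q)) * (fact (p * q - k) * factsum p q K (inv w))"
    and "irr_dim (rect p q) \<noteq> 0" by (simp_all only: not_False_eq_True)
  then have \<chi>: "irr_character (rect p q) w / of_nat (irr_dim (rect p q)) =
      fact (p * q - k) * factsum p q K (inv w) / fact (p * q)"
    by (simp add: field_simps)
  have "Ch {#k#} (rect p q) =
      falling (of_nat (p * q)) k * (irr_character (rect p q) w / of_nat (irr_dim (rect p q)))"
    using True by (simp add: Ch_def Let_def sum_mset_rect irr_character_at_def w_def)
  also have "\<dots> = falling (of_nat (p * q)) k * fact (p * q - k) * factsum p q K (inv w) / fact (p * q)"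
    unfolding \<chi> by simp
  also have "falling (of_nat (p * q)) k * fact (p * q - k) = (fact (p * q) :: complex)"
    by (rule falling_of_nat [OF True])
  finally have "Ch {#k#} (rect p q) = factsum p q K (inv w)" by simp
  then show ?thesis
    using factsum_full_cycle [OF finK iw, of p q] unfolding K(2) by (simp only: mult.commute)
next
  case False
  obtain w where w: "w \<in> Sym k" "cycle_type k w = {#k#} + replicate_mset (k - k) 1"
    using cycle_type_exists [of k k] j by auto
  obtain K where K: "K \<subseteq> {..<k}" "card K = k" "full_cycle K w"
    by (rule full_cycle_of_cycle_type [OF w j])
  have finK: "finite K" using K(1) finite_subset by blast
  have "\<not> inj_on f K" if "f \<in> K \<rightarrow>\<^sub>E {..<p} \<times> {..<q}" for f
  proof
    assume "inj_on f K"
    then have "card K \<le> card ({..<p} \<times> {..<q})"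
      using that by (intro card_inj_on_le [of f]) (auto simp only: image_subset_iff PiE_mem finite_cartesian_product finite_lessThan)
    then show False using False K(2) by (simp add: card_cartesian_product)
  qed
  then have empty: "{f. f \<in> K \<rightarrow>\<^sub>E {..<p} \<times> {..<q} \<and> inj_on f K} = {}" by blast
  have "w permutes K" using K(3) by (simp add: full_cycle_def)
  then have "factsum p q K w = 0"
    using sum_placesum_inj [OF finK, of w p q] unfolding empty by simp
  moreover have "Ch {#k#} (rect p q) = 0" using False by (simp add: Ch_def sum_mset_rect)
  ultimately show ?thesis
    using factsum_full_cycle [OF finK K(3), of p q] unfolding K(2) by (simp only: mult_zero_left mult_zero_right)
qed


section \<open>The interpolating polynomial\<close>

lemma map_poly_add_hom:
  "f 0 = 0 \<Longrightarrow> (\<And>a b. f (a + b) = f a + f b) \<Longrightarrow> map_poly f (P + Q) = map_poly f P + map_poly f Q"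
  by (intro poly_eqI) (simp add: coeff_map_poly)

lemma map_poly_mult_hom:
  fixes f :: "'a::comm_ring_1 \<Rightarrow> 'b::comm_ring_1"
  assumes "f 0 = 0" "\<And>a b. f (a + b) = f a + f b" "\<And>a b. f (a * b) = f a * f b"
  shows "map_poly f (P * Q) = map_poly f P * map_poly f Q"
proof (induction P)
  case (pCons a P)
  then show ?case
    by (simp add: map_poly_pCons map_poly_add_hom map_poly_smult assms)
qed simp

definition ratpoly_eval :: "complex \<Rightarrow> rat poly \<Rightarrow> complex"
  where "ratpoly_eval x c = poly (map_poly of_rat c) x"

lemma ratpoly_eval_0 [simp]: "ratpoly_eval x 0 = 0"
  and ratpoly_eval_const [simp]: "ratpoly_eval x [:a:] = of_rat a"
  and ratpoly_eval_add: "ratpoly_eval x (P + Q) = ratpoly_eval x P + ratpoly_eval x Q"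
  and ratpoly_eval_mult: "ratpoly_eval x (P * Q) = ratpoly_eval x P * ratpoly_eval x Q"
  by (simp_all add: ratpoly_eval_def map_poly_pCons map_poly_add_hom map_poly_mult_hom of_rat_add of_rat_mult)

lemma ratpoly_eval_smult: "ratpoly_eval x (smult a P) = of_rat a * ratpoly_eval x P"
  by (simp add: ratpoly_eval_def map_poly_smult of_rat_mult)

lemma eval2_altdef: "eval2 P p q = poly (map_poly (ratpoly_eval q) P) p"
  unfolding eval2_def ratpoly_eval_def [abs_def] ..

lemma eval2_sum: "eval2 (\<Sum>i\<in>A. P i) p q = (\<Sum>i\<in>A. eval2 (P i) p q)"
  by (induction A rule: infinite_finite_induct)
    (simp_all add: eval2_altdef map_poly_add_hom ratpoly_eval_add)

text \<open>The outer variable is p, so a polynomial f in p gets constant coefficients and a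
  polynomial g in q acts as a scalar.\<close>

lemma eval2_product:
  "eval2 (smult g (map_poly (\<lambda>c. [:c:]) f)) p q = ratpoly_eval q g * ratpoly_eval p f"
proof -
  have "map_poly (ratpoly_eval q) (map_poly (\<lambda>c. [:c:]) f) = map_poly of_rat f"
    by (subst map_poly_map_poly) (simp_all add: comp_def)
  then show ?thesis
    by (simp add: eval2_altdef map_poly_smult ratpoly_eval_mult ratpoly_eval_def [of p])
qed

lemma poly_eq_on_nat:
  fixes P Q :: "complex poly"
  assumes "\<And>n. 0 < n \<Longrightarrow> poly P (of_nat n) = poly Q (of_nat n)"
  shows "P = Q"
proof (rule ccontr)
  assume "P \<noteq> Q"
  then have "finite {x. poly (P - Q) x = 0}" by (intro poly_roots_finite) simp
  moreover have "of_nat ` {0<..} \<subseteq> {x. poly (P - Q) x = 0}" using assms by auto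
  ultimately have "finite (of_nat ` {0<..} :: complex set)" using finite_subset by blast
  then have "finite {0::nat<..}" by (rule finite_imageD) (simp add: inj_on_def)
  then show False by (simp add: infinite_Ioi)
qed

text \<open>Agreement at infinitely many points is used first in p for each fixed q, then in q for
  every coefficient. This is the uniqueness behind the \<open>THE\<close> in
  \<open>Ch_rect_poly\<close>.\<close>

lemma eval2_inject:
  assumes "\<And>p q. 0 < p \<Longrightarrow> 0 < q \<Longrightarrow> eval2 P (of_nat p) (of_nat q) = eval2 Q (of_nat p) (of_nat q)"
  shows "P = Q"
proof (rule poly_eqI)
  fix i
  have "map_poly (ratpoly_eval (of_nat q)) P = map_poly (ratpoly_eval (of_nat q)) Q" if "0 < q" for q
    using assms that by (intro poly_eq_on_nat) (simp add: eval2_altdef)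
  then have "ratpoly_eval (of_nat q) (coeff P i) = ratpoly_eval (of_nat q) (coeff Q i)" if "0 < q" for q
    using that by (metis coeff_map_poly ratpoly_eval_0)
  then have "map_poly of_rat (coeff P i) = (map_poly of_rat (coeff Q i) :: complex poly)"
    by (intro poly_eq_on_nat) (simp add: ratpoly_eval_def)
  then show "coeff P i = coeff Q i"
    by (metis coeff_map_poly of_rat_0 of_rat_eq_iff poly_eqI)
qed

definition falling_poly :: "nat \<Rightarrow> nat \<Rightarrow> rat poly"
  where "falling_poly a k = (\<Prod>r<k. [:of_nat a - of_nat r, 1:])"

lemma ratpoly_eval_falling_poly: "ratpoly_eval x (falling_poly a k) = falling (x + of_nat a) k"
proof (induction k)
  case 0
  show ?case by (simp add: falling_poly_def ratpoly_eval_def)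
next
  case (Suc k)
  have "falling_poly a (Suc k) = falling_poly a k * [:of_nat a - of_nat k, 1:]"
    by (simp add: falling_poly_def)
  moreover have "ratpoly_eval x [:of_nat a - of_nat k, 1:] = x + of_nat a - of_nat k"
    by (simp add: ratpoly_eval_def map_poly_pCons of_rat_diff)
  ultimately show ?case
    by (simp only: ratpoly_eval_mult Suc falling_Suc)
qed

lemma Ch_rect_cycle:
  assumes "2 \<le> k"
  shows "Ch_rect {#k#} p q =
    (\<Sum>m\<le>k - 1. of_nat (k - 1 choose m) * ((-1) ^ m *
      falling (p + of_nat (k - 1 - m)) k * falling (q + of_nat m) k)) / fact k"
proof -
  \<comment> \<open>The witness for \<open>THE\<close>: the hook sum with rational coefficients, in
    which the binomial, the sign and 1 / k! are attached to the factor in q.\<close>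
  define P where "P = (\<Sum>m\<le>k - 1. smult (smult (of_nat (k - 1 choose m) * (-1) ^ m / fact k) (falling_poly m k))
    (map_poly (\<lambda>c. [:c:]) (falling_poly (k - 1 - m) k)))"
  have P: "eval2 P p q =
    (\<Sum>m\<le>k - 1. of_nat (k - 1 choose m) * ((-1) ^ m *
      falling (p + of_nat (k - 1 - m)) k * falling (q + of_nat m) k)) / fact k" for p q
  proof -
    have "of_rat (fact k) = (fact k :: complex)"
      by (metis of_nat_fact of_rat_of_nat_eq)
    then show ?thesis
      unfolding P_def eval2_sum eval2_product sum_divide_distrib
      by (intro sum.cong refl)
        (simp add: ratpoly_eval_smult ratpoly_eval_falling_poly of_rat_mult of_rat_divide of_rat_power)
  qed
  have "eval2 P (of_nat p) (of_nat q) = Ch {#k#} (rect p q)" for p q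
    unfolding P Ch_rect_nat [OF assms, symmetric] by simp
  then have "Ch_rect_poly {#k#} = P"
    unfolding Ch_rect_poly_def by (intro the_equality eval2_inject) auto
  then show ?thesis
    by (simp only: Ch_rect_def P)
qed

theorem theorem1p7:
  fixes j :: nat and d e :: complex
  assumes "j \<ge> 1"
  shows "Ch_rect {#2 * j#} (e - d) (e + d) =
    (-1) ^ (j - 1) * of_nat ((2 * j - 1) choose j) *
      (\<Sum>k = 0..j. gcoeff k j * (2 * d * (\<Prod>r = 1..k. d\<^sup>2 - (of_nat r)\<^sup>2)
                              * (\<Prod>r = k + 1..j. e\<^sup>2 - (of_nat r)\<^sup>2)))"
proof -
  have "2 \<le> 2 * j" using assms by simp
  show ?thesis
    unfolding Ch_rect_cycle [OF \<open>2 \<le> 2 * j\<close>] by (rule hook_sum_eq [OF assms])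
qed

end
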